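(* Let $d$ be a positive integer, and let $\alpha$ be a concave modulus, differentiable on $(0,\infty)$, such that \[\int_0^1\frac{\alpha^{-1}(t)}{t^{d+1}}\,dt<\infty\qquad\text{and}\qquad \sup_{t>0}\frac{\alpha(t)}{t\,\alpha'(t)}<\infty.\] If $\rho\colon \mathbb Z^d\to\mathrm{Diff}_+^{1,\alpha}(S^1)$ is a faithful representation that is $C^1$-conjugate into the rotation group $\mathrm{SO}(2,\mathbb R)$, then there exists a sequence \[\rho_k\colon \mathbb Z^d\to\mathrm{Diff}_+^{1,\alpha}(S^1)\] of exceptional actions which converges to $\rho$ in the $C^1$-topology.
   Context: $S^1=\mathbb R/\mathbb Z$, and $|x-y|$ for $x,y\in S^1$ is the distance modulo $1$. A concave modulus is a homeomorphism $\alpha\colon[0,\infty)\to[0,\infty)$ that is concave; $\alpha^{-1}$ is its inverse function. A function $g\colon S^1\to\mathbb R$ is $\alpha$-continuous if $\sup_{x\neq y}|g(x)-g(y)|/\alpha(|x-y|)<\infty$. $\mathrm{Diff}_+^{1}(S^1)$ is the group of orientation-preserving $C^1$ diffeomorphisms of $S^1$, and $\mathrm{Diff}_+^{1,\alpha}(S^1)$ is the subgroup of those with $\alpha$-continuous derivative. "$\rho$ is $C^1$-conjugate into $\mathrm{SO}(2,\mathbb R)$" means that there is $h\in\mathrm{Diff}_+^1(S^1)$ such that $h\rho(g)h^{-1}$ is a rotation for every $g$. An action is exceptional if it admits an exceptional minimal set, i.e. a minimal nonempty closed invariant set homeomorphic to a Cantor set. Convergence $\rho_k\to\rho$ in the $C^1$-topology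 means that $\rho_k(g)\to\rho(g)$ uniformly together with first derivatives, for each $g\in\mathbb Z^d$. *)

theory Defs
  imports "HOL-Analysis.Analysis"
begin

section \<open>The circle as the quotient of the reals by the integers\<close>

quotient_type circle = real / "\<lambda>x y::real. x - y \<in> \<int>"
proof (rule equivpI)
  show "reflp (\<lambda>x y::real. x - y \<in> \<int>)"
    by (simp add: reflp_def)
  show "symp (\<lambda>x y::real. x - y \<in> \<int>)"
    by (metis (mono_tags, lifting) Ints_minus minus_diff_eq sympI)
  show "transp (\<lambda>x y::real. x - y \<in> \<int>)"
  proof (rule transpI)
    fix x y z :: real
    assume "x - y \<in> \<int>" "y - z \<in> \<int>"
    then have "(x - y) + (y - z) \<in> \<int>" by (rule Ints_add)
    then show "x - z \<in> \<int>" by simp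
  qed
qed

lemma infdist_Ints_shift:
  fixes x n :: real
  assumes "n \<in> \<int>"
  shows "infdist (x + n) \<int> = infdist x \<int>"
proof -
  have *: "infdist (x + m) \<int> \<le> infdist x \<int>" if m: "m \<in> \<int>" for x m :: real
  proof -
    have ne: "(\<int>::real set) \<noteq> {}" using Ints_0 by blast
    have "infdist (x + m) \<int> \<le> dist x a" if "a \<in> \<int>" for a
      using infdist_le[of "a + m" "\<int>" "x + m"] that m by (simp add: dist_norm)
    then show ?thesis
      unfolding infdist_notempty[OF ne, of x] by (intro cINF_greatest ne)
  qed
  show ?thesis
    using *[OF assms, of x] *[of "- n" "x + n"] assms by simp
qed

lemma infdist_Ints_uminus: "infdist (- x) \<int> = infdist (x::real) \<int>"
proof -
  have ne: "(\<int>::real set) \<noteq> {}" using Ints_0 by blast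
  have *: "infdist (- x) \<int> \<le> infdist x \<int>" for x :: real
  proof -
    have "infdist (- x) \<int> \<le> dist x a" if "a \<in> \<int>" for a
      using infdist_le[of "- a" "\<int>" "- x"] that by (simp add: dist_minus)
    then show ?thesis
      unfolding infdist_notempty[OF ne, of x] by (intro cINF_greatest ne)
  qed
  from *[of x] *[of "- x"] show ?thesis by simp
qed

instantiation circle :: ab_group_add
begin

lift_definition zero_circle :: circle is 0 .

lift_definition plus_circle :: "circle \<Rightarrow> circle \<Rightarrow> circle" is "(+)"
  by (metis Ints_add add_diff_add)

lift_definition uminus_circle :: "circle \<Rightarrow> circle" is uminus
  by (metis Ints_minus minus_diff_minus)

lift_definition minus_circle :: "circle \<Rightarrow> circle \<Rightarrow> circle" is "(-)"
  by (metis Ints_diff diff_diff_eq2 diff_add_eq add_diff_eq diff_diff_eq add.commute)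

instance
  by standard (transfer; simp add: algebra_simps)+

end

instantiation circle :: metric_space
begin

lift_definition dist_circle :: "circle \<Rightarrow> circle \<Rightarrow> real" is "\<lambda>x y. infdist (x - y) \<int>"
proof -
  fix x x' y y' :: real
  assume "x - x' \<in> \<int>" "y - y' \<in> \<int>"
  then have "(x - x') - (y - y') \<in> \<int>" by (rule Ints_diff)
  from infdist_Ints_shift[OF this, of "x' - y'"]
  show "infdist (x - y) \<int> = infdist (x' - y') \<int>"
    by (simp add: algebra_simps)
qed

definition uniformity_circle :: "(circle \<times> circle) filter"
  where "uniformity_circle = (INF e\<in>{0<..}. principal {(x, y). dist x y < e})"

definition open_circle :: "circle set \<Rightarrow> bool"
  where "open_circle U \<longleftrightarrow>
    (\<forall>x\<in>U. eventually (\<lambda>(x', y). x' = x \<longrightarrow> y \<in> U) uniformity)"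

instance
proof
  fix x y z :: circle
  show "dist x y = 0 \<longleftrightarrow> x = y"
  proof transfer
    fix x y :: real
    have "closed (\<int>::real set)" "(\<int>::real set) \<noteq> {}"
      by (simp, use Ints_0 in blast)
    then show "infdist (x - y) \<int> = 0 \<longleftrightarrow> x - y \<in> \<int>"
      by (simp add: in_closed_iff_infdist_zero)
  qed
  show "dist x y \<le> dist x z + dist y z"
  proof transfer
    fix x y z :: real
    have ne: "(\<int>::real set) \<noteq> {}" using Ints_0 by blast
    have "infdist (x - y) \<int> - infdist (x - z) \<int> \<le> dist (y - z) a" if a: "a \<in> \<int>" for a
    proof -
      have "infdist (x - y) \<int> = infdist ((x - y) + a) \<int>"
        using infdist_Ints_shift[OF a] by simp
      also have "\<dots> \<le> infdist (x - z) \<int> + dist (x - y + a) (x - z)"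
        by (rule infdist_triangle)
      also have "dist (x - y + a) (x - z) = dist (y - z) a"
        by (simp add: dist_real_def)
      finally show ?thesis by simp
    qed
    then have "infdist (x - y) \<int> - infdist (x - z) \<int> \<le> infdist (y - z) \<int>"
      unfolding infdist_notempty[OF ne, of "y - z"] by (intro cINF_greatest ne)
    then show "infdist (x - y) \<int> \<le> infdist (x - z) \<int> + infdist (y - z) \<int>"
      by simp
  qed
qed (fact uniformity_circle_def open_circle_def)+

end


section \<open>Differentiability of circle maps\<close>

definition lift_of :: "(real \<Rightarrow> real) \<Rightarrow> (circle \<Rightarrow> circle) \<Rightarrow> bool"
  where "lift_of F f \<longleftrightarrow>
    continuous_on UNIV F \<and> (\<forall>x. f (abs_circle x) = abs_circle (F x))"

definition C1_circle :: "(circle \<Rightarrow> circle) \<Rightarrow> bool"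
  where "C1_circle f \<longleftrightarrow> (\<exists>F. lift_of F f \<and> F C1_differentiable_on UNIV)"

definition circle_deriv :: "(circle \<Rightarrow> circle) \<Rightarrow> circle \<Rightarrow> real"
  where "circle_deriv f p =
    (THE D. \<exists>F x. lift_of F f \<and> abs_circle x = p \<and> (F has_real_derivative D) (at x))"

lemma abs_circle_eq_iff: "abs_circle x = abs_circle y \<longleftrightarrow> x - y \<in> \<int>"
  by (simp add: circle.abs_eq_iff)

text \<open>The derivative of a circle map may be computed with any lift and any representative.\<close>

lemma circle_deriv_lift:
  assumes F: "lift_of F f" and D: "(F has_real_derivative D) (at x)"
  shows "circle_deriv f (abs_circle x) = D"
  unfolding circle_deriv_def
proof (rule the_equality)
  show "\<exists>F y. lift_of F f \<and> abs_circle y = abs_circle x \<and> (F has_real_derivative D) (at y)"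
    using assms by blast
next
  fix E
  assume "\<exists>G y. lift_of G f \<and> abs_circle y = abs_circle x \<and> (G has_real_derivative E) (at y)"
  then obtain G y where G: "lift_of G f" and y: "abs_circle y = abs_circle x"
    and E: "(G has_real_derivative E) (at y)" by blast
  define n where "n = y - x"
  have n: "n \<in> \<int>" using y by (simp add: n_def abs_circle_eq_iff)
  define h where "h = (\<lambda>t. G (t + n) - F t)"
  have hZ: "h t \<in> \<int>" for t
  proof -
    have "abs_circle (t + n) = abs_circle t" using n by (simp add: abs_circle_eq_iff)
    then show ?thesis
      using F G by (metis abs_circle_eq_iff h_def lift_of_def)
  qed
  have cont: "continuous_on UNIV h"
    unfolding h_def using F G
    by (auto simp: lift_of_def intro!: continuous_intros continuous_on_compose2[of UNIV G])
  have "h constant_on UNIV"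
  proof (rule continuous_discrete_range_constant[OF _ cont])
    fix s :: real
    show "\<exists>e>0. \<forall>t. t \<in> UNIV \<and> h t \<noteq> h s \<longrightarrow> e \<le> norm (h t - h s)"
    proof (intro exI[of _ 1] conjI allI impI)
      fix t assume "t \<in> UNIV \<and> h t \<noteq> h s"
      moreover have "h t - h s \<in> \<int>" using hZ by simp
      ultimately show "1 \<le> norm (h t - h s)"
        using Ints_nonzero_abs_ge1[of "h t - h s"] by simp
    qed simp
  qed simp
  then obtain c where c: "\<And>t. G (t + n) - F t = c"
    by (auto simp: constant_on_def h_def)
  have "((\<lambda>t. G (t + n)) has_real_derivative E) (at x)"
    using E DERIV_shift[of G E x n] by (simp add: n_def)
  moreover have "(\<lambda>t. G (t + n)) = (\<lambda>t. F t + c)"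
    using c by (auto simp: fun_eq_iff algebra_simps)
  ultimately have "((\<lambda>t. F t + c) has_real_derivative E) (at x)" by simp
  moreover have "((\<lambda>t. F t + c) has_real_derivative D) (at x)"
    using D by (auto intro!: derivative_eq_intros)
  ultimately show "E = D" by (rule DERIV_unique)
qed

text \<open>For a \<open>C\<^sup>1\<close> diffeomorphism, positive derivative means orientation preserving.\<close>

definition Diff1 :: "(circle \<Rightarrow> circle) set"
  where "Diff1 = {f. bij f \<and> C1_circle f \<and> C1_circle (inv f) \<and> (\<forall>p. circle_deriv f p > 0)}"

definition rotation :: "circle \<Rightarrow> circle \<Rightarrow> circle"
  where "rotation a = (\<lambda>p. p + a)"


section \<open>Concave moduli and the groups of diffeomorphisms of intermediate regularity\<close>

definition concave_modulus :: "(real \<Rightarrow> real) \<Rightarrow> bool"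
  where "concave_modulus \<alpha> \<longleftrightarrow>
    (\<exists>\<beta>. homeomorphism {0..} {0..} \<alpha> \<beta>) \<and> concave_on {0..} \<alpha>"

definition modulus_continuous :: "(real \<Rightarrow> real) \<Rightarrow> (circle \<Rightarrow> real) \<Rightarrow> bool"
  where "modulus_continuous \<alpha> g \<longleftrightarrow>
    bdd_above {\<bar>g x - g y\<bar> / \<alpha> (dist x y) | x y. x \<noteq> y}"

definition Diff1_modulus :: "(real \<Rightarrow> real) \<Rightarrow> (circle \<Rightarrow> circle) set"
  where "Diff1_modulus \<alpha> = {f \<in> Diff1. modulus_continuous \<alpha> (circle_deriv f)}"


section \<open>Actions on the circle\<close>

text \<open>Representations are written for an additive acting group; the group \<open>\<int>\<^sup>d\<close> is rendered
  as the type \<open>int ^ 'd\<close> with \<open>d = CARD('d)\<close>.\<close>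

definition representation_into ::
    "(circle \<Rightarrow> circle) set \<Rightarrow> ('g::ab_group_add \<Rightarrow> circle \<Rightarrow> circle) \<Rightarrow> bool"
  where "representation_into G \<rho> \<longleftrightarrow>
    (\<forall>g. \<rho> g \<in> G) \<and> (\<forall>g h. \<rho> (g + h) = \<rho> g \<circ> \<rho> h)"

definition C1_conjugate_into_rotations :: "('g \<Rightarrow> circle \<Rightarrow> circle) \<Rightarrow> bool"
  where "C1_conjugate_into_rotations \<rho> \<longleftrightarrow>
    (\<exists>h\<in>Diff1. \<forall>g. \<exists>a. h \<circ> \<rho> g \<circ> inv h = rotation a)"

text \<open>For an action of a group, \<open>\<rho> g ` K \<subseteq> K\<close> for all \<open>g\<close> forces \<open>\<rho> g ` K = K\<close>.\<close>

definition nonempty_closed_invariant :: "('g \<Rightarrow> circle \<Rightarrow> circle) \<Rightarrow> circle set \<Rightarrow> bool"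
  where "nonempty_closed_invariant \<rho> K \<longleftrightarrow> K \<noteq> {} \<and> closed K \<and> (\<forall>g. \<rho> g ` K \<subseteq> K)"

definition minimal_set :: "('g \<Rightarrow> circle \<Rightarrow> circle) \<Rightarrow> circle set \<Rightarrow> bool"
  where "minimal_set \<rho> K \<longleftrightarrow>
    nonempty_closed_invariant \<rho> K \<and> (\<forall>L. nonempty_closed_invariant \<rho> L \<and> L \<subseteq> K \<longrightarrow> L = K)"

text \<open>The model Cantor set is \<open>nat \<Rightarrow> bool\<close> with the product topology.\<close>

definition exceptional :: "('g \<Rightarrow> circle \<Rightarrow> circle) \<Rightarrow> bool"
  where "exceptional \<rho> \<longleftrightarrow>
    (\<exists>K. minimal_set \<rho> K \<and> K homeomorphic (UNIV :: (nat \<Rightarrow> bool) set))"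

definition C1_converges ::
    "(nat \<Rightarrow> 'g \<Rightarrow> circle \<Rightarrow> circle) \<Rightarrow> ('g \<Rightarrow> circle \<Rightarrow> circle) \<Rightarrow> bool"
  where "C1_converges \<rho>s \<rho> \<longleftrightarrow>
    (\<forall>g. uniform_limit UNIV (\<lambda>k. \<rho>s k g) (\<rho> g) sequentially \<and>
         uniform_limit UNIV (\<lambda>k. circle_deriv (\<rho>s k g)) (circle_deriv (\<rho> g)) sequentially)"

end

theory Submission
  imports Defs
begin

text \<open>The conjugacy to rotations identifies an orbit with a dense set of points \<open>\<theta> g + \<int>\<close>.  Each
  point \<open>\<theta> g\<close> is blown up to an interval of length \<open>c g = \<alpha>\<inverse> (1 / (2 + k + \<bar>g\<bar>\<^sub>1))\<close>: the
  integral condition makes these lengths summable over \<open>\<int>\<^sup>d\<close>, and the bound on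
  \<open>\<alpha> t / (t \<alpha>' t)\<close> gives \<open>\<bar>c h / c (h + g) - 1\<bar> = O(\<alpha> (c h))\<close>.  Hence the blown-up translations,
  extended over the gaps by Yoccoz's maps, have derivatives that are \<open>\<alpha>\<close>-continuous and tend uniformly
  to \<open>1\<close> as \<open>k \<rightarrow> \<infinity>\<close>.

  The conjugacy back to the original action is only \<open>C\<^sup>1\<close>, so conjugating by it could destroy
  \<open>\<alpha>\<close>-continuity.  It is lifted to the blown-up circle by a map that is affine on each gap; then the new
  derivative is the old derivative at the collapsed point times the derivative of the blown-up
  translation, and both factors are \<open>\<alpha>\<close>-continuous.\<close>

text \<open>The lengths are chosen backwards from the estimate. By definition
  \<open>\<alpha> (c h) = 1 / (2 + k + l1 h)\<close>, which is also the order of the relative change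
  of \<open>2 + k + l1 h\<close> when \<open>h\<close> is translated by a fixed element; since
  \<alpha>-inverse is Lipschitz in logarithmic coordinates, the ratio of neighbouring lengths
  deviates from 1 by the same order. A Yoccoz map from length a to length b has a derivative with
  Lipschitz constant of order |(a/b)^2 - 1| / a, hence O(\<alpha> a / a). As \<alpha> t / t is
  nonincreasing, this is an \<alpha>-bound at every scale below a, with a constant that is the same
  for all gaps. The gaps are dense, so differentiability at a point outside them is not a local
  matter; it comes from a mean value inequality summed over the infinitely many gaps in between. The
  blow-up keeps a Lebesgue part of density 1 - mass > 0. It restores the period 1, translations act
  on it with ratio 1, in agreement with tangency to the identity at the gap ends, and it makes the
  collapsing map Lipschitz, so that the \<alpha>-bound of the original derivative survives
  composition with it.\<close>

section \<open>Interval maps tangent to the identity at both ends\<close>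

text \<open>A globally continuous choice of the argument of the vector (cos x, k sin x). The
  quotient inside \<open>arctan\<close> is the tangent of the angle between this vector and (cos x,
  sin x); for k > 0 its denominator never vanishes, so the two directions stay less than a right
  angle apart and no branch has to be chosen.\<close>

definition ang :: "real \<Rightarrow> real \<Rightarrow> real"
  where "ang k x = x + arctan ((k - 1) * sin x * cos x / ((cos x)\<^sup>2 + k * (sin x)\<^sup>2))"

lemma cos_sin_form_pos:
  fixes k :: real
  assumes "k > 0"
  shows "(cos x)\<^sup>2 + k * (sin x)\<^sup>2 > 0"
proof (cases "sin x = 0")
  case True
  then show ?thesis by (metis add.right_neutral mult_zero_right power_zero_numeral sin_cos_squared_add2 zero_less_one)
next
  case False
  then show ?thesis using assms by (intro add_nonneg_pos) auto
qed

lemma ang_cos_sin: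
  assumes k: "k > 0"
  shows "cos (ang k x) = cos x / sqrt ((cos x)\<^sup>2 + k\<^sup>2 * (sin x)\<^sup>2)"
    and "sin (ang k x) = k * sin x / sqrt ((cos x)\<^sup>2 + k\<^sup>2 * (sin x)\<^sup>2)"
proof -
  define q where "q = (cos x)\<^sup>2 + k * (sin x)\<^sup>2"
  define p where "p = (cos x)\<^sup>2 + k\<^sup>2 * (sin x)\<^sup>2"
  define v where "v = (k - 1) * sin x * cos x / q"
  have q: "q > 0" and p: "p > 0"
    unfolding q_def p_def using k by (auto intro!: cos_sin_form_pos)
  have c2: "(sin x)\<^sup>2 = 1 - (cos x)\<^sup>2" by (simp add: sin_squared_eq)
  \<comment> \<open>Lagrange's identity: \<open>q\<close> and (k - 1) sin x cos x are the scalar and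
    the cross product of (cos x, sin x) and (cos x, k sin x), and \<open>p\<close> is the squared
    length of the second vector.\<close>
  have "q\<^sup>2 + ((k - 1) * sin x * cos x)\<^sup>2 = p"
    unfolding q_def p_def power_mult_distrib c2 by (simp add: algebra_simps power2_eq_square)
  then have "1 + v\<^sup>2 = p / q\<^sup>2"
    using q by (simp add: v_def power_divide field_simps)
  then have sq: "sqrt (1 + v\<^sup>2) = sqrt p / q"
    using q by (simp add: real_sqrt_divide)
  have ca: "cos (arctan v) = q / sqrt p" and sa: "sin (arctan v) = (k - 1) * sin x * cos x / sqrt p"
    using q by (simp_all add: cos_arctan sin_arctan sq) (simp add: v_def)
  have "cos x * q - sin x * ((k - 1) * sin x * cos x) = cos x"
  proof -
    have "cos x * q - sin x * ((k - 1) * sin x * cos x) = cos x * (q - (k - 1) * (sin x)\<^sup>2)"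
      by (simp add: algebra_simps power2_eq_square)
    also have "q - (k - 1) * (sin x)\<^sup>2 = 1"
      unfolding q_def cos_squared_eq by (simp add: algebra_simps)
    finally show ?thesis by simp
  qed
  then have "cos (x + arctan v) = cos x / sqrt p"
    unfolding cos_add ca sa by (metis diff_divide_distrib times_divide_eq_right)
  then show "cos (ang k x) = cos x / sqrt ((cos x)\<^sup>2 + k\<^sup>2 * (sin x)\<^sup>2)"
    by (simp add: ang_def v_def q_def p_def)
  have "sin x * q + cos x * ((k - 1) * sin x * cos x) = k * sin x"
  proof -
    have "sin x * q + cos x * ((k - 1) * sin x * cos x) = sin x * (q + (k - 1) * (cos x)\<^sup>2)"
      by (simp add: algebra_simps power2_eq_square)
    also have "q + (k - 1) * (cos x)\<^sup>2 = k"
      unfolding q_def cos_squared_eq by (simp add: algebra_simps)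
    finally show ?thesis by simp
  qed
  then have "sin (x + arctan v) = k * sin x / sqrt p"
    unfolding sin_add ca sa by (metis add_divide_distrib times_divide_eq_right)
  then show "sin (ang k x) = k * sin x / sqrt ((cos x)\<^sup>2 + k\<^sup>2 * (sin x)\<^sup>2)"
    by (simp add: ang_def v_def q_def p_def)
qed

lemma ang_deriv:
  assumes k: "k > 0"
  shows "(ang k has_real_derivative k / ((cos x)\<^sup>2 + k\<^sup>2 * (sin x)\<^sup>2)) (at x)"
proof -
  define q where "q = (cos x)\<^sup>2 + k * (sin x)\<^sup>2"
  define p where "p = (cos x)\<^sup>2 + k\<^sup>2 * (sin x)\<^sup>2"
  define N where "N = (k - 1) * sin x * cos x"
  define N' where "N' = (k - 1) * ((cos x)\<^sup>2 - (sin x)\<^sup>2)"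
  define q' where "q' = 2 * (k - 1) * sin x * cos x"
  have q: "q > 0" and p: "p > 0"
    unfolding q_def p_def using k by (auto intro!: cos_sin_form_pos)
  have c2: "(sin x)\<^sup>2 = 1 - (cos x)\<^sup>2" by (simp add: sin_squared_eq)
  have pq: "q\<^sup>2 + N\<^sup>2 = p"
    unfolding q_def p_def N_def power_mult_distrib c2 by (simp add: algebra_simps power2_eq_square)
  have main: "p + (N' * q - N * q') = k"
  proof -
    have 1: "N * q' = 2 * (k - 1)\<^sup>2 * ((sin x)\<^sup>2 * (cos x)\<^sup>2)"
      by (simp add: N_def q'_def power2_eq_square)
    show ?thesis unfolding 1 unfolding p_def q_def N'_def cos_squared_eq
      by (simp add: algebra_simps power2_eq_square)
  qed
  have dN: "((\<lambda>x. (k - 1) * sin x * cos x) has_real_derivative N') (at x)"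
    unfolding N'_def
    by (rule derivative_eq_intros refl)+ (simp add: power2_eq_square algebra_simps)
  have dq: "((\<lambda>x. (cos x)\<^sup>2 + k * (sin x)\<^sup>2) has_real_derivative q') (at x)"
    unfolding q'_def
    by (rule derivative_eq_intros refl)+ (simp add: algebra_simps)
  have d: "((\<lambda>x. (k - 1) * sin x * cos x / ((cos x)\<^sup>2 + k * (sin x)\<^sup>2)) has_real_derivative
     (N' * q - N * q') / (q * q)) (at x)"
    using DERIV_divide[OF dN dq] q unfolding q_def N_def by simp
  have "((\<lambda>x. arctan ((k - 1) * sin x * cos x / ((cos x)\<^sup>2 + k * (sin x)\<^sup>2))) has_real_derivative
      inverse (1 + (N / q)\<^sup>2) * ((N' * q - N * q') / (q * q))) (at x)"
    using DERIV_chain2[OF DERIV_arctan d] unfolding N_def q_def .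
  from DERIV_add[OF DERIV_ident this]
  have "(ang k has_real_derivative 1 + ((N' * q - N * q') / (q * q)) * inverse (1 + (N / q)\<^sup>2)) (at x)"
    unfolding ang_def[abs_def] by (simp add: mult.commute)
  moreover have "1 + ((N' * q - N * q') / (q * q)) * inverse (1 + (N / q)\<^sup>2) = k / p"
  proof -
    have "1 + (N / q)\<^sup>2 = p / (q * q)" using q pq by (simp add: field_simps power2_eq_square)
    then have "1 + ((N' * q - N * q') / (q * q)) * inverse (1 + (N / q)\<^sup>2) = 1 + (N' * q - N * q') / p"
      using q by simp
    also have "\<dots> = k / p" using p main by (simp add: field_simps)
    finally show ?thesis .
  qed
  ultimately show ?thesis by (simp add: p_def)
qed

lemma ang_0 [simp]: "ang k 0 = 0"
  and ang_pi [simp]: "ang k pi = pi"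
  and ang_one [simp]: "ang 1 x = x"
  by (simp_all add: ang_def)

text \<open>The linear maps diag(1, k) compose multiplicatively, and so do their actions on
  directions. For the chosen branch this is checked by comparing derivatives; both sides vanish at
  0.\<close>

lemma ang_ang:
  assumes k: "k > 0" and l: "l > 0"
  shows "ang k (ang l x) = ang (k * l) x"
proof -
  have kl: "k * l > 0" using k l by simp
  have "((\<lambda>x. ang k (ang l x) - ang (k * l) x) has_real_derivative 0) (at x)" for x
  proof -
    define p where "p = (cos x)\<^sup>2 + l\<^sup>2 * (sin x)\<^sup>2"
    define P where "P = (cos x)\<^sup>2 + (k * l)\<^sup>2 * (sin x)\<^sup>2"
    have p: "p > 0" and P: "P > 0"
      unfolding p_def P_def using k l kl by (auto intro!: cos_sin_form_pos)
    have "(cos (ang l x))\<^sup>2 + k\<^sup>2 * (sin (ang l x))\<^sup>2 = P / p"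
      using p unfolding ang_cos_sin[OF l] p_def[symmetric]
      by (simp add: power_divide power_mult_distrib P_def add_divide_distrib)
    then have eq: "k / ((cos (ang l x))\<^sup>2 + k\<^sup>2 * (sin (ang l x))\<^sup>2) * (l / p) = k * l / P"
      using p by simp
    then show ?thesis
      using DERIV_diff[OF DERIV_chain2[OF ang_deriv[OF k] ang_deriv[OF l]] ang_deriv[OF kl], of x]
      by (simp only: p_def[symmetric] P_def[symmetric] eq diff_self)
  qed
  then have "ang k (ang l x) - ang (k * l) x = ang k (ang l 0) - ang (k * l) 0"
    using DERIV_const_ratio_const[of x 0 "\<lambda>x. ang k (ang l x) - ang (k * l) x" 0]
    by (cases "x = 0") auto
  then show ?thesis by simp
qed

text \<open>Yoccoz's equivariant family of interval diffeomorphisms.  In the coordinate \<open>cot (\<pi>u/a)\<close> the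
  map \<open>[0,a] \<rightarrow> [0,b]\<close> is multiplication by \<open>b/a\<close>.  For \<open>a = b = 0\<close> the
  junk value of division gives the constant \<open>0\<close> and the derivative \<open>1\<close>, which is what is needed
  at points outside the gaps.\<close>

definition gap_map :: "real \<Rightarrow> real \<Rightarrow> real \<Rightarrow> real"
  where "gap_map a b u = b / pi * ang (a / b) (pi * u / a)"

definition gap_deriv :: "real \<Rightarrow> real \<Rightarrow> real \<Rightarrow> real"
  where "gap_deriv a b u = 1 / ((cos (pi * u / a))\<^sup>2 + (a / b)\<^sup>2 * (sin (pi * u / a))\<^sup>2)"

lemma gap_map_zero [simp]: "gap_map a b 0 = 0" "gap_map 0 0 u = 0"
  and gap_deriv_zero [simp]: "gap_deriv a b 0 = 1" "gap_deriv 0 0 u = 1"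
  by (simp_all add: gap_map_def gap_deriv_def)

lemma gap_map_end [simp]: "a \<noteq> 0 \<Longrightarrow> gap_map a b a = b"
  by (simp add: gap_map_def)

text \<open>The sine vanishes at the ends, so the tangency to the identity does not depend on the
  ratio of the lengths. This common value 1 is what links the derivatives on different gaps.\<close>

lemma gap_deriv_end [simp]: "gap_deriv a b a = 1"
  by (cases "a = 0") (simp_all add: gap_deriv_def)

lemma gap_map_same [simp]: "a \<noteq> 0 \<Longrightarrow> gap_map a a u = u"
  by (simp add: gap_map_def)

text \<open>Equivariance: the gap maps between all pairs of lengths form one consistent family, so
  the blown-up translations compose exactly and remain an action.\<close>

lemma gap_map_comp:
  assumes "a > 0" "b > 0" "c > 0"
  shows "gap_map b c (gap_map a b u) = gap_map a c u"
proof -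
  have "gap_map b c (gap_map a b u) = c / pi * ang (b / c) (ang (a / b) (pi * u / a))"
    using assms by (simp add: gap_map_def)
  also have "ang (b / c) (ang (a / b) (pi * u / a)) = ang (a / c) (pi * u / a)"
    using assms by (subst ang_ang) auto
  finally show ?thesis by (simp add: gap_map_def)
qed

lemma gap_map_deriv:
  assumes "a > 0" "b > 0"
  shows "(gap_map a b has_real_derivative gap_deriv a b u) (at u)"
proof -
  have ab: "a / b > 0" using assms by simp
  have "((\<lambda>u. pi * u / a) has_real_derivative pi / a) (at u)"
    using assms by (auto intro!: derivative_eq_intros)
  from DERIV_cmult[OF DERIV_chain2[OF ang_deriv[OF ab] this], of "b / pi"]
  show ?thesis
    using assms by (simp add: gap_map_def[abs_def] gap_deriv_def)
qed

lemma gap_deriv_pos: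
  assumes "a > 0" "b > 0"
  shows "gap_deriv a b u > 0"
  using cos_sin_form_pos[of "(a/b)\<^sup>2" "pi * u / a"] assms by (simp add: gap_deriv_def)

lemma gap_map_mono:
  assumes "a > 0" "b > 0" "u < v"
  shows "gap_map a b u < gap_map a b v"
  using DERIV_pos_imp_increasing[OF \<open>u < v\<close>, of "gap_map a b"] gap_map_deriv[OF assms(1,2)]
    gap_deriv_pos[OF assms(1,2)] by blast

lemma cos_sin_form_ge:
  fixes k m :: real
  assumes "m \<le> 1" "m \<le> k"
  shows "m \<le> (cos x)\<^sup>2 + k * (sin x)\<^sup>2"
proof -
  have "m = m * (cos x)\<^sup>2 + m * (sin x)\<^sup>2" by (metis distrib_left mult.right_neutral sin_cos_squared_add2)
  also have "\<dots> \<le> 1 * (cos x)\<^sup>2 + k * (sin x)\<^sup>2"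
    using assms by (intro add_mono mult_right_mono) auto
  finally show ?thesis by simp
qed

lemma gap_deriv_near_one:
  assumes "B \<ge> 1" "(a / b)\<^sup>2 \<ge> 1 / B"
  shows "\<bar>gap_deriv a b u - 1\<bar> \<le> B * \<bar>(a / b)\<^sup>2 - 1\<bar>"
proof -
  define k x where "k = (a / b)\<^sup>2" and "x = pi * u / a"
  define p where "p = (cos x)\<^sup>2 + k * (sin x)\<^sup>2"
  have p: "p \<ge> 1 / B" using assms cos_sin_form_ge[of "1/B" k x] by (simp add: p_def k_def)
  have B: "1 / B > 0" using assms by simp
  have p0: "p > 0" using p B by linarith
  have "1 / p - 1 = (1 - k) * (sin x)\<^sup>2 / p"
    using p0 by (simp add: field_simps) (simp add: p_def cos_squared_eq algebra_simps)
  moreover have "gap_deriv a b u = 1 / p" by (simp add: gap_deriv_def p_def k_def x_def)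
  ultimately have "\<bar>gap_deriv a b u - 1\<bar> = \<bar>k - 1\<bar> * (sin x)\<^sup>2 * (1 / p)"
    using p0 by (simp add: abs_mult abs_minus_commute[of 1])
  also have "\<dots> \<le> \<bar>k - 1\<bar> * 1 * B"
    using p p0 B assms(1) by (intro mult_mono) (auto simp: abs_square_le_1 field_simps)
  finally show ?thesis by (simp add: k_def mult_ac)
qed

lemma gap_deriv_le:
  assumes "B \<ge> 1" "(a / b)\<^sup>2 \<ge> 1 / B"
  shows "gap_deriv a b u \<le> B"
proof -
  have "1 / B \<le> (cos (pi * u / a))\<^sup>2 + (a / b)\<^sup>2 * (sin (pi * u / a))\<^sup>2"
    using assms by (intro cos_sin_form_ge) auto
  moreover have "1 / B > 0" using assms by simp
  ultimately have "1 / ((cos (pi * u / a))\<^sup>2 + (a / b)\<^sup>2 * (sin (pi * u / a))\<^sup>2) \<le> 1 / (1 / B)"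
    by (intro divide_left_mono mult_pos_pos) linarith+
  then show ?thesis by (simp add: gap_deriv_def)
qed

text \<open>The reciprocal of the derivative is 1 plus (a/b)^2 - 1 times a squared sine, and
  rescaling to length a costs 1/a. Both factors are kept: the first will be O(\<alpha> a), which
  leaves \<alpha> a / a.\<close>

lemma gap_deriv_lipschitz:
  assumes "B \<ge> 1" "(a / b)\<^sup>2 \<ge> 1 / B" "a > 0"
  shows "\<bar>gap_deriv a b u - gap_deriv a b v\<bar> \<le> 2 * pi * B\<^sup>2 * \<bar>(a / b)\<^sup>2 - 1\<bar> / a * \<bar>u - v\<bar>"
proof -
  define k where "k = (a / b)\<^sup>2"
  define p where "p = (\<lambda>x. (cos x)\<^sup>2 + k * (sin x)\<^sup>2)"
  define S where "S = (\<lambda>x::real. (sin x)\<^sup>2)"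
  have ge: "p x \<ge> 1 / B" for x using assms cos_sin_form_ge[of "1/B" k x] by (simp add: p_def k_def)
  have B: "1 / B > 0" using assms by simp
  have p0: "p x > 0" for x using ge[of x] B by linarith
  have inv: "1 / p x \<le> B" for x using ge[of x] p0[of x] B assms(1) by (simp add: field_simps)
  have pS: "p x - p y = (k - 1) * (S x - S y)" for x y
    by (simp add: p_def S_def cos_squared_eq algebra_simps)
  have dS: "\<bar>S x - S y\<bar> \<le> 2 * \<bar>x - y\<bar>" for x y :: real
  proof -
    have "norm (S x - S y) \<le> 2 * norm (x - y)"
    proof (rule field_differentiable_bound[of UNIV S "\<lambda>x. 2 * sin x * cos x"])
      show "(S has_field_derivative 2 * sin z * cos z) (at z within UNIV)" for z
        unfolding S_def by (auto intro!: derivative_eq_intros)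
      show "norm (2 * sin z * cos z) \<le> 2" for z :: real
      proof -
        have "\<bar>sin z\<bar> * \<bar>cos z\<bar> \<le> 1 * 1" by (intro mult_mono) auto
        then show ?thesis by (simp add: abs_mult)
      qed
    qed auto
    then show ?thesis by simp
  qed
  have "\<bar>1 / p x - 1 / p y\<bar> \<le> B * B * (\<bar>k - 1\<bar> * (2 * \<bar>x - y\<bar>))" for x y
  proof -
    have "1 / p x - 1 / p y = (1 / p x) * (1 / p y) * (p y - p x)"
      using p0[of x] p0[of y] by (simp add: field_simps)
    then have "\<bar>1 / p x - 1 / p y\<bar> = (1 / p x) * (1 / p y) * (\<bar>k - 1\<bar> * \<bar>S y - S x\<bar>)"
      using p0[of x] p0[of y] by (simp add: abs_mult pS)
    also have "\<dots> \<le> B * B * (\<bar>k - 1\<bar> * (2 * \<bar>y - x\<bar>))"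
      using inv[of x] inv[of y] p0[of x] p0[of y] assms(1) dS[of y x]
      by (intro mult_mono) (auto simp: less_imp_le)
    finally show ?thesis by (simp add: abs_minus_commute)
  qed
  from this[of "pi * u / a" "pi * v / a"]
  have "\<bar>gap_deriv a b u - gap_deriv a b v\<bar> \<le> B * B * (\<bar>k - 1\<bar> * (2 * \<bar>pi * u / a - pi * v / a\<bar>))"
    by (simp add: gap_deriv_def p_def k_def)
  also have "\<bar>pi * u / a - pi * v / a\<bar> = pi / a * \<bar>u - v\<bar>"
    using assms(3) by (simp add: abs_mult diff_divide_distrib[symmetric] right_diff_distrib[symmetric])
  finally show ?thesis by (simp add: k_def power2_eq_square mult_ac)
qed

section \<open>Blowing up an orbit of translations\<close>

text \<open>\<open>\<theta>\<close> stands for an injective homomorphism into the circle with dense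
  image, written with representatives in [0,1), hence additive only up to integers. Total weight
  below 1 leaves room for a Lebesgue part on a circle of length 1.\<close>

locale blowup =
  fixes \<theta> :: "'g::ab_group_add \<Rightarrow> real" and c :: "'g \<Rightarrow> real"
  assumes theta_range: "0 \<le> \<theta> g" "\<theta> g < 1"
    and theta_add: "\<theta> (g + h) - \<theta> g - \<theta> h \<in> \<int>"
    and theta_inj: "\<theta> g \<in> \<int> \<Longrightarrow> g = 0"
    and theta_dense: "a < b \<Longrightarrow> \<exists>g. \<exists>n\<in>\<int>. a < \<theta> g + n \<and> \<theta> g + n < b"
    and c_pos: "c g > 0"
    and c_summable: "c summable_on UNIV"
    and mass_less: "infsum c UNIV < 1"
begin

section \<open>Distribution functions of the blown-up measure\<close>

definition mass :: real where "mass = infsum c UNIV"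
definition wsum :: "('g \<Rightarrow> real) \<Rightarrow> real" where "wsum f = (\<Sum>\<^sub>\<infinity>h. c h * f h)"
text \<open>Up to a constant depending on \<open>h\<close>, \<open>fl x h\<close> counts the points
  of \<open>\<theta> h + \<int>\<close> that are at most x, and \<open>ce x h\<close> those strictly
  below x. Only differences matter: for x < y, \<open>ce y h - fl x h\<close> counts the points in
  the open interval between them.\<close>

definition fl :: "real \<Rightarrow> 'g \<Rightarrow> real" where "fl x h = of_int \<lfloor>x - \<theta> h\<rfloor>"
definition ce :: "real \<Rightarrow> 'g \<Rightarrow> real" where "ce x h = of_int \<lceil>x - \<theta> h\<rceil> - 1"

text \<open>Right and left continuous versions of the distribution function of the measure that
  puts mass \<open>c g\<close> on \<open>\<theta> g + \<int>\<close>, together with a multiple of Lebesgue measure.\<close>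

definition up :: "real \<Rightarrow> real" where "up x = (1 - mass) * x + wsum (fl x)"
definition lo :: "real \<Rightarrow> real" where "lo x = (1 - mass) * x + wsum (ce x)"
definition jump :: "real \<Rightarrow> real" where "jump x = up x - lo x"

lemma mass_ge: "mass \<ge> 0" unfolding mass_def using c_pos by (intro infsum_nonneg) (simp add: less_imp_le)
lemma mass_lt: "mass < 1" using mass_less by (simp add: mass_def)

lemma wsum_summable:
  assumes "\<And>h. \<bar>f h\<bar> \<le> M"
  shows "(\<lambda>h. c h * f h) summable_on UNIV"
proof -
  have "(\<lambda>h. M * c h) summable_on UNIV" by (rule summable_on_cmult_right[OF c_summable])
  then have "(\<lambda>h. norm (c h * f h)) summable_on UNIV"
  proof (rule Infinite_Sum.abs_summable_on_comparison_test')
    show "norm (c h * f h) \<le> M * c h" for h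
      using assms[of h] c_pos[of h] by (simp add: abs_mult mult.commute[of M])
  qed
  then show ?thesis by (rule abs_summable_summable)
qed

lemma wsum_mono:
  assumes "\<And>h. \<bar>f h\<bar> \<le> M" "\<And>h. \<bar>g h\<bar> \<le> N" "\<And>h. f h \<le> g h"
  shows "wsum f \<le> wsum g"
  unfolding wsum_def using assms(3) c_pos
  by (intro infsum_mono wsum_summable[of f, OF assms(1)] wsum_summable[of g, OF assms(2)] mult_left_mono)
    (auto simp: less_imp_le)

lemma wsum_diff:
  assumes "\<And>h. \<bar>f h\<bar> \<le> M" "\<And>h. \<bar>g h\<bar> \<le> N"
  shows "wsum (\<lambda>h. f h - g h) = wsum f - wsum g"
proof -
  have "wsum (\<lambda>h. f h - g h) = (\<Sum>\<^sub>\<infinity>h. c h * f h + c h * (- g h))"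
    by (simp add: wsum_def algebra_simps)
  also have "\<dots> = wsum f + (\<Sum>\<^sub>\<infinity>h. c h * (- g h))"
    unfolding wsum_def
    by (rule infsum_add[OF wsum_summable[of f, OF assms(1)] wsum_summable[of "\<lambda>h. - g h" N]]) (simp add: assms)
  finally show ?thesis by (simp add: wsum_def infsum_uminus)
qed

lemma wsum_const: "wsum (\<lambda>h. a) = a * mass"
  unfolding wsum_def mass_def by (simp add: infsum_cmult_left')

lemma fl_bounds: "x - 2 \<le> fl x h" "fl x h \<le> x" "\<bar>fl x h\<bar> \<le> \<bar>x\<bar> + 2"
  using theta_range[of h] unfolding fl_def by linarith+

lemma ce_bounds: "x - 2 \<le> ce x h" "ce x h \<le> x" "\<bar>ce x h\<bar> \<le> \<bar>x\<bar> + 2"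
  using theta_range[of h] unfolding ce_def by linarith+

lemma ce_le_fl: "ce x h \<le> fl x h"
  using ceiling_diff_floor_le_1[of "x - \<theta> h"] unfolding fl_def ce_def by linarith

lemma wsum_diff_fl: "wsum (\<lambda>h. fl x h - fl y h) = wsum (fl x) - wsum (fl y)"
  and wsum_diff_ce: "wsum (\<lambda>h. ce x h - ce y h) = wsum (ce x) - wsum (ce y)"
  and wsum_diff_fl_ce: "wsum (\<lambda>h. fl x h - ce y h) = wsum (fl x) - wsum (ce y)"
  and wsum_diff_ce_fl: "wsum (\<lambda>h. ce x h - fl y h) = wsum (ce x) - wsum (fl y)"
  by (rule wsum_diff[OF fl_bounds(3) fl_bounds(3)] wsum_diff[OF ce_bounds(3) ce_bounds(3)]
      wsum_diff[OF fl_bounds(3) ce_bounds(3)] wsum_diff[OF ce_bounds(3) fl_bounds(3)])+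

lemma fl_le_ce: "x < y \<Longrightarrow> fl x h \<le> ce y h"
proof -
  assume "x < y"
  then have "\<lfloor>x - \<theta> h\<rfloor> < \<lceil>y - \<theta> h\<rceil>" by linarith
  then show ?thesis unfolding fl_def ce_def by linarith
qed

lemma lo_le_up: "lo x \<le> up x"
  unfolding lo_def up_def using wsum_mono[OF ce_bounds(3) fl_bounds(3) ce_le_fl] by simp

lemma jump_nonneg: "jump x \<ge> 0" using lo_le_up[of x] by (simp add: jump_def)

text \<open>The atoms strictly between x and y only add to the difference, so the Lebesgue part is a
  lower bound. It makes the intervals [lo x, up x] disjoint and, later, the collapsing map
  Lipschitz.\<close>

lemma up_less_lo:
  assumes "x < y" shows "(1 - mass) * (y - x) \<le> lo y - up x"
proof -
  have "wsum (fl x) \<le> wsum (ce y)" by (rule wsum_mono[OF fl_bounds(3) ce_bounds(3) fl_le_ce[OF assms]])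
  then show ?thesis by (simp add: lo_def up_def algebra_simps)
qed

lemma up_lt_lo: "x < y \<Longrightarrow> up x < lo y"
  using up_less_lo[of x y] mult_pos_pos[of "1 - mass" "y - x"] mass_lt by linarith

text \<open>Representatives in [0,1) keep both counting functions within 2 of x. This normalisation
  is what makes the collapse tend to the identity when the mass tends to 0.\<close>

lemma lo_ge: "x - 2 * mass \<le> lo x"
proof -
  have "wsum (\<lambda>h. x - 2) \<le> wsum (ce x)" using ce_bounds by (intro wsum_mono) auto
  then show ?thesis by (simp add: wsum_const lo_def algebra_simps)
qed

lemma up_le: "up x \<le> x"
proof -
  have "wsum (fl x) \<le> wsum (\<lambda>h. x)" using fl_bounds by (intro wsum_mono) auto
  then show ?thesis by (simp add: wsum_const up_def algebra_simps)
qed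

lemma shift_int:
  assumes "n \<in> \<int>"
  shows "up (x + n) = up x + n" "lo (x + n) = lo x + n" "jump (x + n) = jump x"
proof -
  obtain k where k: "n = of_int k" using assms by (auto elim: Ints_cases)
  have f: "fl (x + n) h - fl x h = n" for h
    using floor_add_int[of "x - \<theta> h" k] by (simp add: fl_def k algebra_simps)
  have g: "ce (x + n) h - ce x h = n" for h
    using ceiling_add_of_int[of "x - \<theta> h" k] by (simp add: ce_def k algebra_simps)
  show 1: "up (x + n) = up x + n"
    using wsum_diff_fl[of "x + n" x] unfolding f by (simp add: wsum_const up_def algebra_simps)
  show 2: "lo (x + n) = lo x + n"
    using wsum_diff_ce[of "x + n" x] unfolding g by (simp add: wsum_const lo_def algebra_simps)
  show "jump (x + n) = jump x" by (simp add: jump_def 1 2)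
qed

section \<open>One-sided continuity of the distribution functions\<close>

lemma wsum_small:
  fixes D :: "real \<Rightarrow> 'g \<Rightarrow> real"
  assumes "\<And>h. \<exists>d>0. \<forall>t. 0 < t \<and> t < d \<longrightarrow> D t h = 0"
    and D: "\<And>t h. 0 < t \<Longrightarrow> t < 1 \<Longrightarrow> 0 \<le> D t h \<and> D t h \<le> 1" and "e > 0"
  shows "\<exists>d>0. d \<le> 1 \<and> (\<forall>t. 0 < t \<and> t < d \<longrightarrow> wsum (D t) < e)"
proof -
  \<comment> \<open>Dominated convergence by hand: outside a finite set \<open>F\<close> carrying
    all but e/2 of the mass the integrand is at most 1, and on \<open>F\<close> it vanishes once t
    is below finitely many thresholds.\<close>
  obtain F where F: "finite F" "dist (sum c F) (infsum c UNIV) \<le> e / 2"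
    using infsum_finite_approximation[OF c_summable, of "e/2"] \<open>e > 0\<close> by auto
  obtain d where d: "\<And>h. d h > 0" "\<And>h t. 0 < t \<Longrightarrow> t < d h \<Longrightarrow> D t h = 0"
  proof -
    have "\<exists>d. \<forall>h. d h > 0 \<and> (\<forall>t. 0 < t \<and> t < d h \<longrightarrow> D t h = 0)"
      using assms(1) by (intro choice) simp
    then show ?thesis using that by blast
  qed
  define m where "m = Min (insert 1 (d ` F))"
  have m: "m > 0" "m \<le> 1" "\<And>h. h \<in> F \<Longrightarrow> m \<le> d h"
    using F d by (auto simp: m_def)
  have "wsum (D t) < e" if t: "0 < t" "t < m" for t
  proof -
    have t1: "t < 1" using t m by simp
    have "wsum (D t) \<le> wsum (\<lambda>h. 1 - (if h \<in> F then 1 else 0))"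
    proof (rule wsum_mono[of _ 1 _ 1])
      show "D t h \<le> 1 - (if h \<in> F then 1 else 0)" for h
        using D[OF t(1) t1, of h] d(2)[of t h] t m(3)[of h] by auto
      show "\<bar>D t h\<bar> \<le> 1" for h using D[OF t(1) t1, of h] by auto
    qed auto
    also have "\<dots> = wsum (\<lambda>h. 1) - wsum (\<lambda>h. if h \<in> F then 1 else 0)"
      by (rule wsum_diff[of _ 1 _ 1]) auto
    also have "wsum (\<lambda>h. if h \<in> F then 1 else 0) = sum c F"
    proof -
      have "wsum (\<lambda>h. if h \<in> F then 1 else 0) = infsum c F"
        unfolding wsum_def by (rule infsum_cong_neutral) auto
      then show ?thesis using F by simp
    qed
    also have "wsum (\<lambda>h. 1) - sum c F \<le> e / 2"
      using F(2) unfolding wsum_const mass_def dist_real_def by linarith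
    finally show ?thesis using \<open>e > 0\<close> by simp
  qed
  then show ?thesis using m by blast
qed

lemma up_right_continuous:
  assumes "e > 0"
  shows "\<exists>d>0. \<forall>y. x < y \<and> y < x + d \<longrightarrow> up y < up x + e"
proof -
  have "\<exists>d>0. d \<le> 1 \<and> (\<forall>t. 0 < t \<and> t < d \<longrightarrow> wsum (\<lambda>h. fl (x + t) h - fl x h) < e / 2)"
  proof (rule wsum_small)
    fix h
    show "\<exists>d>0. \<forall>t. 0 < t \<and> t < d \<longrightarrow> fl (x + t) h - fl x h = 0"
    \<comment> \<open>The distance from x - \<theta> h to the smallest integer strictly above
      it.\<close>
    proof (intro exI[of _ "of_int \<lfloor>x - \<theta> h\<rfloor> + 1 - (x - \<theta> h)"] conjI allI impI)
      fix t assume t: "0 < t \<and> t < of_int \<lfloor>x - \<theta> h\<rfloor> + 1 - (x - \<theta> h)"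
      have "of_int \<lfloor>x - \<theta> h\<rfloor> \<le> x - \<theta> h" by linarith
      then have "\<lfloor>x + t - \<theta> h\<rfloor> = \<lfloor>x - \<theta> h\<rfloor>" using t by (intro floor_unique) linarith+
      then show "fl (x + t) h - fl x h = 0" by (simp add: fl_def)
    qed linarith
  next
    fix t :: real and h assume t: "0 < t" "t < 1"
    have "\<lfloor>x - \<theta> h\<rfloor> \<le> \<lfloor>x + t - \<theta> h\<rfloor>" "\<lfloor>x + t - \<theta> h\<rfloor> \<le> \<lfloor>x - \<theta> h\<rfloor> + 1" using t by linarith+
    then show "0 \<le> fl (x + t) h - fl x h \<and> fl (x + t) h - fl x h \<le> 1" by (simp add: fl_def)
  qed (use assms in simp)
  then obtain d where d: "d > 0" "\<And>t. 0 < t \<Longrightarrow> t < d \<Longrightarrow> wsum (\<lambda>h. fl (x + t) h - fl x h) < e / 2"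
    by blast
  show ?thesis
  proof (intro exI[of _ "min d (e / 2)"] conjI allI impI)
    fix y assume y: "x < y \<and> y < x + min d (e / 2)"
    have "wsum (\<lambda>h. fl y h - fl x h) < e / 2" using d(2)[of "y - x"] y by auto
    then have "wsum (fl y) - wsum (fl x) < e / 2"
      by (simp add: wsum_diff_fl)
    moreover have "(1 - mass) * (y - x) \<le> 1 * (y - x)" using y mass_ge by (intro mult_right_mono) auto
    moreover have "y - x < e / 2" using y by auto
    ultimately have "wsum (fl y) + (1 - mass) * (y - x) < wsum (fl x) + e" by simp
    then show "up y < up x + e" by (simp add: up_def algebra_simps)
  qed (use d assms in simp)
qed

lemma lo_left_continuous:
  assumes "e > 0"
  shows "\<exists>d>0. \<forall>y. x - d < y \<and> y < x \<longrightarrow> lo x - e < lo y"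
proof -
  have "\<exists>d>0. d \<le> 1 \<and> (\<forall>t. 0 < t \<and> t < d \<longrightarrow> wsum (\<lambda>h. ce x h - ce (x - t) h) < e / 2)"
  proof (rule wsum_small)
    fix h
    show "\<exists>d>0. \<forall>t. 0 < t \<and> t < d \<longrightarrow> ce x h - ce (x - t) h = 0"
    \<comment> \<open>The distance from x - \<theta> h to the largest integer strictly below it. At
      an integer value this is 1 and not 0, which is why \<open>ce\<close> is left
      continuous.\<close>
    proof (intro exI[of _ "(x - \<theta> h) - (of_int \<lceil>x - \<theta> h\<rceil> - 1)"] conjI allI impI)
      fix t assume t: "0 < t \<and> t < (x - \<theta> h) - (of_int \<lceil>x - \<theta> h\<rceil> - 1)"
      have "x - \<theta> h \<le> of_int \<lceil>x - \<theta> h\<rceil>" by linarith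
      then have "\<lceil>x - t - \<theta> h\<rceil> = \<lceil>x - \<theta> h\<rceil>" using t by (intro ceiling_unique) linarith+
      then show "ce x h - ce (x - t) h = 0" by (simp add: ce_def)
    qed linarith
  next
    fix t :: real and h assume t: "0 < t" "t < 1"
    have "\<lceil>x - t - \<theta> h\<rceil> \<le> \<lceil>x - \<theta> h\<rceil>" "\<lceil>x - \<theta> h\<rceil> \<le> \<lceil>x - t - \<theta> h\<rceil> + 1" using t by linarith+
    then show "0 \<le> ce x h - ce (x - t) h \<and> ce x h - ce (x - t) h \<le> 1" by (simp add: ce_def)
  qed (use assms in simp)
  then obtain d where d: "d > 0" "\<And>t. 0 < t \<Longrightarrow> t < d \<Longrightarrow> wsum (\<lambda>h. ce x h - ce (x - t) h) < e / 2"
    by blast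
  show ?thesis
  proof (intro exI[of _ "min d (e / 2)"] conjI allI impI)
    fix y assume y: "x - min d (e / 2) < y \<and> y < x"
    have "wsum (\<lambda>h. ce x h - ce y h) < e / 2" using d(2)[of "x - y"] y by auto
    then have "wsum (ce x) - wsum (ce y) < e / 2"
      by (simp add: wsum_diff_ce)
    moreover have "(1 - mass) * (x - y) \<le> 1 * (x - y)" using y mass_ge by (intro mult_right_mono) auto
    moreover have "x - y < e / 2" using y by auto
    ultimately have "wsum (ce x) + (1 - mass) * (x - y) < wsum (ce y) + e" by simp
    then show "lo x - e < lo y" by (simp add: lo_def algebra_simps)
  qed (use d assms in simp)
qed

section \<open>The atoms of the measure\<close>

lemma theta_eqI:
  assumes "x - \<theta> g \<in> \<int>" "x - \<theta> h \<in> \<int>"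
  shows "g = h"
proof -
  have "\<theta> (g - h) = (x - \<theta> h) - (x - \<theta> g) + (\<theta> (g - h) - (\<theta> g - \<theta> h))" by simp
  moreover have "\<theta> (g - h) - (\<theta> g - \<theta> h) \<in> \<int>"
    using Ints_minus[OF theta_add[of "g - h" h]] by (simp add: algebra_simps)
  ultimately have "\<theta> (g - h) \<in> \<int>" using Ints_add[OF Ints_diff[OF assms(2,1)], of "\<theta> (g - h) - (\<theta> g - \<theta> h)"] by simp
  then show ?thesis using theta_inj[of "g - h"] by simp
qed

lemma fl_minus_ce: "fl x h - ce x h = (if x - \<theta> h \<in> \<int> then 1 else 0)"
proof (cases "x - \<theta> h \<in> \<int>")
  case True
  then obtain k where "x - \<theta> h = of_int k" by (auto elim: Ints_cases)
  then show ?thesis by (simp add: fl_def ce_def)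
next
  case False
  then have "x - \<theta> h \<noteq> of_int \<lfloor>x - \<theta> h\<rfloor>" using Ints_of_int by metis
  with False show ?thesis by (simp add: fl_def ce_def ceiling_altdef)
qed

lemma jump_wsum: "jump x = wsum (\<lambda>h. if x - \<theta> h \<in> \<int> then 1 else 0)"
  using wsum_diff_fl_ce[of x x]
  by (simp add: jump_def up_def lo_def fl_minus_ce)

lemma jump_eq:
  assumes "x - \<theta> g \<in> \<int>" shows "jump x = c g"
proof -
  have eq: "x - \<theta> h \<in> \<int> \<longleftrightarrow> h = g" for h
    using assms theta_eqI[OF assms, of h] by blast
  have "jump x = infsum c {g}"
    unfolding jump_wsum wsum_def eq by (rule infsum_cong_neutral) auto
  then show ?thesis by simp
qed

lemma jump_zero:
  assumes "\<And>g. x - \<theta> g \<notin> \<int>" shows "jump x = 0"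
  unfolding jump_wsum using assms by (simp add: wsum_def)

lemma jump_pos_iff: "jump x > 0 \<longleftrightarrow> (\<exists>g. x - \<theta> g \<in> \<int>)"
proof
  assume "jump x > 0" then show "\<exists>g. x - \<theta> g \<in> \<int>" using jump_zero[of x] by force
qed (use jump_eq c_pos in force)

section \<open>The map collapsing the gaps\<close>

definition cl :: "real \<Rightarrow> real" where "cl y = (THE x. lo x \<le> y \<and> y \<le> up x)"

lemma cl_unique:
  assumes "lo x \<le> y" "y \<le> up x" shows "cl y = x"
  unfolding cl_def
proof (rule the_equality)
  fix z assume "lo z \<le> y \<and> y \<le> up z"
  then show "z = x" using assms up_lt_lo[of x z] up_lt_lo[of z x] by linarith
qed (use assms in simp)

text \<open>The intervals [lo x, up x] cover the line. At the supremum of all x with lo x \<le> y,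
  left continuity of \<open>lo\<close> keeps this inequality, and right continuity of
  \<open>up\<close> excludes up x < y, since otherwise slightly larger points would still belong to
  the set.\<close>

lemma cl: "lo (cl y) \<le> y" "y \<le> up (cl y)"
proof -
  define A where "A = {x. lo x \<le> y}"
  have "y \<in> A" using order.trans[OF lo_le_up up_le, of y] by (simp add: A_def)
  have bdd: "bdd_above A"
  proof (rule bdd_aboveI[of _ "y + 2"])
    show "x \<le> y + 2" if "x \<in> A" for x using lo_ge[of x] mass_lt that by (simp add: A_def)
  qed
  define x where "x = Sup A"
  have "lo x \<le> y"
  proof (rule ccontr)
    assume "\<not> lo x \<le> y"
    then obtain d where d: "d > 0" "\<And>z. x - d < z \<Longrightarrow> z < x \<Longrightarrow> y < lo z"
      using lo_left_continuous[of "lo x - y" x] by auto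
    obtain z where "z \<in> A" "x - d < z" using less_cSupD[of A "x - d"] d \<open>y \<in> A\<close> by (auto simp: x_def)
    moreover have "z \<le> x" unfolding x_def using \<open>z \<in> A\<close> bdd by (rule cSup_upper)
    ultimately show False using d(2)[of z] \<open>\<not> lo x \<le> y\<close> by (cases "z = x") (auto simp: A_def)
  qed
  moreover have "y \<le> up x"
  proof (rule ccontr)
    assume "\<not> y \<le> up x"
    then obtain d where d: "d > 0" "\<And>z. x < z \<Longrightarrow> z < x + d \<Longrightarrow> up z < y"
      using up_right_continuous[of "y - up x" x] by auto
    then have "up (x + d / 2) < y" by simp
    then have "x + d / 2 \<in> A" using lo_le_up[of "x + d / 2"] by (simp add: A_def)
    from cSup_upper[OF this bdd] show False using d by (simp add: x_def)
  qed
  ultimately have "lo x \<le> y" "y \<le> up x" .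
  with cl_unique[OF this] show "lo (cl y) \<le> y" "y \<le> up (cl y)" by simp_all
qed

lemma cl_bounds: "y \<le> cl y" "cl y \<le> y + 2 * mass"
  using cl[of y] up_le[of "cl y"] lo_ge[of "cl y"] by linarith+

lemma cl_up [simp]: "cl (up x) = x" and cl_lo [simp]: "cl (lo x) = x"
  using cl_unique lo_le_up by auto

lemma cl_mono:
  assumes "y \<le> z" shows "cl y \<le> cl z"
  using cl[of y] cl[of z] up_lt_lo[of "cl z" "cl y"] assms by linarith

lemma cl_lipschitz:
  assumes "y \<le> z" shows "(1 - mass) * (cl z - cl y) \<le> z - y"
proof (cases "cl y = cl z")
  case False
  then have "cl y < cl z" using cl_mono[OF assms] by simp
  from up_less_lo[OF this] show ?thesis using cl[of y] cl[of z] by linarith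
qed (use assms in simp)

lemma cl_lipschitz_abs: "\<bar>cl z - cl y\<bar> \<le> \<bar>z - y\<bar> / (1 - mass)"
proof -
  have *: "\<bar>cl z - cl y\<bar> \<le> \<bar>z - y\<bar> / (1 - mass)" if "y \<le> z" for y z
    using cl_lipschitz[OF that] cl_mono[OF that] mass_lt that by (simp add: field_simps)
  show ?thesis using *[of y z] *[of z y] by (cases "y \<le> z") (auto simp: abs_minus_commute)
qed

lemma cl_shift: "n \<in> \<int> \<Longrightarrow> cl (y + n) = cl y + n"
  by (rule cl_unique) (use cl[of y] in \<open>simp_all add: shift_int\<close>)

lemma continuous_cl: "isCont cl y"
proof -
  have "continuous_on UNIV cl"
  proof (rule lipschitz_on_continuous_on[of "1 / (1 - mass)"])
    show "(1 / (1 - mass))-lipschitz_on UNIV cl"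
      using cl_lipschitz_abs mass_lt by (intro lipschitz_onI) (auto simp: dist_real_def)
  qed
  then show ?thesis by (simp add: continuous_on_eq_continuous_at)
qed

text \<open>All translations that permute the atoms, and not only the \<open>\<theta> g\<close>:
  this is a genuine subgroup of the reals containing the integers, so periodicity of the blown-up
  translations becomes an instance of their composition law.\<close>

definition transl :: "real set" where "transl = {\<tau>. \<exists>g. \<tau> - \<theta> g \<in> \<int>}"

lemma jump_transl:
  assumes "\<tau> - \<theta> g \<in> \<int>" "x - \<theta> h \<in> \<int>"
  shows "x + \<tau> - \<theta> (h + g) \<in> \<int>"
proof -
  have "x + \<tau> - \<theta> (h + g) = (\<tau> - \<theta> g) + (x - \<theta> h) - (\<theta> (h + g) - \<theta> h - \<theta> g)" by simp
  then show ?thesis using Ints_diff[OF Ints_add[OF assms] theta_add[of h g]] by (simp only:)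
qed

lemma transl_add: "\<sigma> \<in> transl \<Longrightarrow> \<tau> \<in> transl \<Longrightarrow> \<sigma> + \<tau> \<in> transl"
  unfolding transl_def using jump_transl by fast

lemma theta_zero: "\<theta> 0 \<in> \<int>"
  using Ints_minus[OF theta_add[of 0 0]] by simp

lemma transl_Ints: "n \<in> \<int> \<Longrightarrow> n \<in> transl"
  unfolding transl_def using Ints_diff[OF _ theta_zero] by blast

lemma transl_minus:
  assumes "\<tau> \<in> transl" shows "- \<tau> \<in> transl"
proof -
  obtain g where g: "\<tau> - \<theta> g \<in> \<int>" using assms by (auto simp: transl_def)
  have "- \<tau> - \<theta> (- g) = (\<theta> (g + - g) - \<theta> g - \<theta> (- g)) - (\<tau> - \<theta> g) - \<theta> 0" by simp
  then have "- \<tau> - \<theta> (- g) \<in> \<int>" using Ints_diff[OF Ints_diff[OF theta_add[of g "- g"] g] theta_zero] by (simp only:)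
  then show ?thesis by (auto simp: transl_def)
qed

lemma transl_theta: "\<theta> g \<in> transl" by (auto simp: transl_def intro: exI[of _ g])

lemma jump_transl_pos:
  assumes "\<tau> \<in> transl" shows "jump (x + \<tau>) > 0 \<longleftrightarrow> jump x > 0"
proof -
  have *: "jump x > 0 \<Longrightarrow> jump (x + \<tau>) > 0" if "\<tau> \<in> transl" for x \<tau>
    using jump_transl that unfolding jump_pos_iff transl_def by blast
  show ?thesis using *[OF assms, of x] *[OF transl_minus[OF assms], of "x + \<tau>"] by auto
qed

lemma jump_transl_zero:
  assumes "\<tau> \<in> transl" "jump x = 0" shows "jump (x + \<tau>) = 0"
  using jump_transl_pos[OF assms(1), of x] jump_nonneg[of "x + \<tau>"] assms(2) by auto

text \<open>Transfers any relation between neighbouring weights to the lengths of a gap and of its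
  translate.\<close>

lemma jump_pairI:
  assumes "\<And>h. Pr (c h) (c (h + g))" "jump x > 0"
  shows "Pr (jump x) (jump (x + \<theta> g))"
proof -
  obtain h where h: "x - \<theta> h \<in> \<int>" using assms(2) jump_pos_iff by blast
  have "jump (x + \<theta> g) = c (h + g)" by (rule jump_eq[OF jump_transl[OF _ h]]) simp
  then show ?thesis using assms(1) jump_eq[OF h] by simp
qed

section \<open>The blown-up translations and their derivative\<close>

definition T :: "real \<Rightarrow> real \<Rightarrow> real"
  where "T \<tau> y = lo (cl y + \<tau>) + gap_map (jump (cl y)) (jump (cl y + \<tau>)) (y - lo (cl y))"

text \<open>The candidate for the derivative. Outside the gaps both jumps vanish, and the
  conventions for length 0 give the value 1 here and \<open>lo (cl y + \<tau>)\<close> for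
  \<open>T\<close>, so each formula serves on the gaps and off them.\<close>

definition W :: "real \<Rightarrow> real \<Rightarrow> real"
  where "W \<tau> y = gap_deriv (jump (cl y)) (jump (cl y + \<tau>)) (y - lo (cl y))"

lemma T_lo [simp]: "T \<tau> (lo x) = lo (x + \<tau>)"
  by (simp add: T_def)

lemma T_up [simp]: "\<tau> \<in> transl \<Longrightarrow> T \<tau> (up x) = up (x + \<tau>)"
  using jump_transl_zero[of \<tau> x] by (cases "jump x = 0") (auto simp: T_def jump_def[symmetric], auto simp: jump_def)

lemma W_lo [simp]: "W \<tau> (lo x) = 1" and W_up [simp]: "W \<tau> (up x) = 1"
  by (simp_all add: W_def jump_def[symmetric])

lemma W_pos: "\<tau> \<in> transl \<Longrightarrow> W \<tau> y > 0"
  using jump_transl_zero[of \<tau> "cl y"] jump_transl_pos[of \<tau> "cl y"] jump_nonneg[of "cl y"]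
  by (cases "jump (cl y) = 0") (auto simp: W_def intro!: gap_deriv_pos)

lemma gap_coord: "0 \<le> y - lo (cl y)" "y - lo (cl y) \<le> jump (cl y)"
  using cl[of y] by (auto simp: jump_def)

lemma T_range:
  assumes "\<tau> \<in> transl"
  shows "lo (cl y + \<tau>) \<le> T \<tau> y" "T \<tau> y \<le> up (cl y + \<tau>)"
proof -
  define a b u where "a = jump (cl y)" and "b = jump (cl y + \<tau>)" and "u = y - lo (cl y)"
  have u: "0 \<le> u" "u \<le> a" using gap_coord[of y] by (auto simp: u_def a_def)
  have T: "T \<tau> y = lo (cl y + \<tau>) + gap_map a b u" by (simp add: T_def a_def b_def u_def)
  have "0 \<le> gap_map a b u \<and> gap_map a b u \<le> b"
  proof (cases "a = 0")
    case True
    then show ?thesis using jump_transl_zero[OF assms, of "cl y"] by (simp add: a_def b_def)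
  next
    case False
    then have a: "a > 0" "b > 0" using jump_nonneg[of "cl y"] jump_transl_pos[OF assms, of "cl y"] by (auto simp: a_def b_def)
    show ?thesis
      using gap_map_mono[OF a, of 0 u] gap_map_mono[OF a, of u a] u a
      by (cases "u = 0"; cases "u = a") auto
  qed
  then show "lo (cl y + \<tau>) \<le> T \<tau> y" "T \<tau> y \<le> up (cl y + \<tau>)"
    by (auto simp: T b_def jump_def)
qed

lemma cl_T: "\<tau> \<in> transl \<Longrightarrow> cl (T \<tau> y) = cl y + \<tau>"
  by (rule cl_unique[OF T_range])

text \<open>Collapsed coordinates add and Yoccoz maps compose. An admissible translation preserves
  whether a jump is zero, so the three lengths vanish together or are all positive.\<close>

lemma T_comp:
  assumes "\<sigma> \<in> transl" "\<tau> \<in> transl"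
  shows "T \<sigma> (T \<tau> y) = T (\<sigma> + \<tau>) y"
proof -
  define a b d u where "a = jump (cl y)" and "b = jump (cl y + \<tau>)" and "d = jump (cl y + \<tau> + \<sigma>)" and "u = y - lo (cl y)"
  have T1: "T \<sigma> (T \<tau> y) = lo (cl y + \<tau> + \<sigma>) + gap_map b d (gap_map a b u)"
    unfolding T_def[of \<sigma>] cl_T[OF assms(2)] by (simp add: T_def a_def b_def d_def u_def)
  have T2: "T (\<sigma> + \<tau>) y = lo (cl y + \<tau> + \<sigma>) + gap_map a d u"
    by (simp add: T_def a_def d_def u_def add_ac)
  show ?thesis
  proof (cases "a = 0")
    case True
    then have "b = 0" using jump_transl_zero[OF assms(2), of "cl y"] by (simp add: a_def b_def)
    then have "d = 0" using jump_transl_zero[OF assms(1), of "cl y + \<tau>"] by (simp add: d_def b_def)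
    show ?thesis using True \<open>b = 0\<close> \<open>d = 0\<close> by (simp add: T1 T2)
  next
    case False
    then have "a > 0" using jump_nonneg[of "cl y"] by (simp add: a_def)
    then have "b > 0" using jump_transl_pos[OF assms(2), of "cl y"] by (simp add: a_def b_def)
    then have "d > 0" using jump_transl_pos[OF assms(1), of "cl y + \<tau>"] by (simp add: d_def b_def)
    show ?thesis using gap_map_comp[OF \<open>a > 0\<close> \<open>b > 0\<close> \<open>d > 0\<close>] by (simp add: T1 T2)
  qed
qed

lemma T_int: "n \<in> \<int> \<Longrightarrow> T n y = y + n"
  using gap_coord[of y] by (cases "jump (cl y) = 0") (auto simp: T_def shift_int)

text \<open>Composing with an integer translation in either order gives the translation by the same
  sum.\<close>

lemma T_shift:
  assumes "\<tau> \<in> transl" "n \<in> \<int>" shows "T \<tau> (y + n) = T \<tau> y + n"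
  using T_comp[OF assms(1) transl_Ints[OF assms(2)], of y] T_comp[OF transl_Ints[OF assms(2)] assms(1), of y]
  by (simp add: T_int[OF assms(2)] add.commute)

lemma T_mvt_gap:
  assumes "\<tau> \<in> transl" "cl y = cl z" "y < z"
  obtains \<xi> where "y < \<xi>" "\<xi> < z" "cl \<xi> = cl y" "T \<tau> z - T \<tau> y = (z - y) * W \<tau> \<xi>"
proof -
  define x a b where "x = cl y" and "a = jump x" and "b = jump (x + \<tau>)"
  have yz: "lo x \<le> y" "z \<le> up x" using cl[of y] cl[of z] assms by (simp_all add: x_def)
  then have a: "a > 0" using assms(3) by (simp add: a_def jump_def)
  then have b: "b > 0" using jump_transl_pos[OF assms(1), of x] by (simp add: a_def b_def)
  have inside: "cl t = x" if "y \<le> t" "t \<le> z" for t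
    using that yz by (intro cl_unique) auto
  have T: "T \<tau> t = lo (x + \<tau>) + gap_map a b (t - lo x)" if "y \<le> t" "t \<le> z" for t
    using inside[OF that] by (simp add: T_def a_def b_def)
  have W: "W \<tau> t = gap_deriv a b (t - lo x)" if "y \<le> t" "t \<le> z" for t
    using inside[OF that] by (simp add: W_def a_def b_def)
  have "((\<lambda>t. gap_map a b (t - lo x)) has_real_derivative gap_deriv a b (t - lo x)) (at t)" for t
  proof -
    have "((\<lambda>t. t - lo x) has_real_derivative 1) (at t)"
      using DERIV_diff[OF DERIV_ident DERIV_const] by simp
    from DERIV_chain2[OF gap_map_deriv[OF a b] this] show ?thesis by simp
  qed
  then obtain \<xi> where \<xi>: "y < \<xi>" "\<xi> < z"
    "gap_map a b (z - lo x) - gap_map a b (y - lo x) = (z - y) * gap_deriv a b (\<xi> - lo x)"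
    using MVT2[OF assms(3), of "\<lambda>t. gap_map a b (t - lo x)" "\<lambda>t. gap_deriv a b (t - lo x)"] by blast
  have "T \<tau> z - T \<tau> y = (z - y) * W \<tau> \<xi>"
    using \<xi> assms(3) by (simp add: T W)
  with \<xi> inside[of \<xi>] show ?thesis by (intro that[of \<xi>]) (simp_all add: x_def)
qed

text \<open>Between two gaps the increments of \<open>lo\<close> and \<open>up\<close> on both sides are compared term by term:
  each gap contributes the mean of \<open>W\<close> over it.\<close>

lemma T_mean_jumps:
  assumes \<tau>: "\<tau> \<in> transl" and "x < x'"
    and b: "\<And>t. up x \<le> t \<Longrightarrow> t \<le> lo x' \<Longrightarrow> m \<le> W \<tau> t \<and> W \<tau> t \<le> M"
  shows "m * (lo x' - up x) \<le> lo (x' + \<tau>) - up (x + \<tau>)"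
    and "lo (x' + \<tau>) - up (x + \<tau>) \<le> M * (lo x' - up x)"
proof -
  obtain g where g: "\<tau> - \<theta> g \<in> \<int>" using \<tau> by (auto simp: transl_def)
  \<comment> \<open>For each class \<open>h\<close> of atoms, \<open>N h\<close> is the number of
    its points strictly between x and x', and \<open>N' h\<close> the number strictly between the
    translated endpoints.\<close>
  define N N' where "N = (\<lambda>h. ce x' h - fl x h)" and "N' = (\<lambda>h. ce (x' + \<tau>) h - fl (x + \<tau>) h)"
  have lt: "up x < lo x'" using up_lt_lo[OF \<open>x < x'\<close>] .
  \<comment> \<open>The bounds apply at the gap end \<open>up x\<close>, where \<open>W\<close> is
    1. Having 1 between m and M settles the Lebesgue part, which the translation preserves.\<close>
  have m1: "m \<le> 1" "1 \<le> M" using b[of "up x"] lt \<tau> by simp_all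
  have N: "N h \<ge> 0" for h using fl_le_ce[OF \<open>x < x'\<close>, of h] by (simp add: N_def)
  have bd: "\<bar>N h\<bar> \<le> \<bar>x\<bar> + \<bar>x'\<bar> + 4" for h
    unfolding N_def using ce_bounds(3)[of x' h] fl_bounds(3)[of x h] by linarith
  have bd': "\<bar>N' h\<bar> \<le> \<bar>x + \<tau>\<bar> + \<bar>x' + \<tau>\<bar> + 4" for h
    unfolding N'_def using ce_bounds(3)[of "x' + \<tau>" h] fl_bounds(3)[of "x + \<tau>" h] by linarith
  \<comment> \<open>Translation by \<open>\<tau>\<close> carries the atoms of class h to those of
    class h + g; after reindexing, the same counts are therefore weighted by
    \<open>c (h + g)\<close> instead of \<open>c h\<close>.\<close>
  have NN: "N' (h + g) = N h" for h
  proof -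
    have "\<theta> (h + g) - \<theta> h - \<theta> g - (\<tau> - \<theta> g) \<in> \<int>" using theta_add[of h g] g by (rule Ints_diff)
    then obtain k where k: "\<theta> (h + g) - \<theta> h - \<theta> g - (\<tau> - \<theta> g) = of_int k" by (rule Ints_cases)
    have 1: "v + \<tau> - \<theta> (h + g) = v - \<theta> h - of_int k" for v using k by simp
    show ?thesis unfolding N_def N'_def fl_def ce_def 1 by simp
  qed
  have bij: "bij_betw (\<lambda>h. h + g) UNIV UNIV"
    by (intro bij_betwI[of _ _ _ "\<lambda>h. h - g"]) auto
  have w': "wsum N' = (\<Sum>\<^sub>\<infinity>h. c (h + g) * N h)"
    unfolding wsum_def NN[symmetric] by (rule infsum_reindex_bij_betw[OF bij, symmetric])
  have s': "(\<lambda>h. c (h + g) * N h) summable_on UNIV"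
    unfolding NN[symmetric] using summable_on_reindex_bij_betw[OF bij, of "\<lambda>h. c h * N' h"]
      wsum_summable[of N', OF bd'] by simp
  have s: "(\<lambda>h. c h * N h) summable_on UNIV" by (rule wsum_summable[OF bd])
  have L: "lo x' - up x = (1 - mass) * (x' - x) + wsum N"
    unfolding N_def wsum_diff_ce_fl by (simp add: lo_def up_def algebra_simps)
  have R: "lo (x' + \<tau>) - up (x + \<tau>) = (1 - mass) * (x' - x) + wsum N'"
    unfolding N'_def wsum_diff_ce_fl by (simp add: lo_def up_def algebra_simps)
  have gapwise: "m * (c h * N h) \<le> c (h + g) * N h \<and> c (h + g) * N h \<le> M * (c h * N h)" for h
  proof (cases "N h = 0")
    case False
    \<comment> \<open>The first atom of class \<open>h\<close> to the right of x. A positive count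
      places it left of x', so its whole gap lies where the bounds on \<open>W\<close> hold; all
      gaps of one class have the same length, so one of them suffices.\<close>
    define z where "z = \<theta> h + (of_int \<lfloor>x - \<theta> h\<rfloor> + 1)"
    have "N h > 0" using False N[of h] by simp
    then have "\<lfloor>x - \<theta> h\<rfloor> + 1 \<le> \<lceil>x' - \<theta> h\<rceil> - 1" by (simp add: N_def ce_def fl_def)
    then have z: "x < z" "z < x'" unfolding z_def by linarith+
    have zh: "z - \<theta> h \<in> \<int>" by (simp add: z_def)
    have c: "up z - lo z = c h" "up (z + \<tau>) - lo (z + \<tau>) = c (h + g)"
      using jump_eq[OF zh] jump_eq[OF jump_transl[OF g zh]] by (simp_all add: jump_def)
    have "lo z < up z" using c(1) c_pos[of h] by simp
    then obtain \<xi> where \<xi>: "lo z < \<xi>" "\<xi> < up z" "T \<tau> (up z) - T \<tau> (lo z) = (up z - lo z) * W \<tau> \<xi>"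
      using T_mvt_gap[OF \<tau>, of "lo z" "up z"] by auto
    then have "c (h + g) = c h * W \<tau> \<xi>" using c \<tau> by simp
    moreover have "m \<le> W \<tau> \<xi> \<and> W \<tau> \<xi> \<le> M"
      using up_lt_lo[OF z(1)] up_lt_lo[OF z(2)] \<xi> by (intro b) auto
    moreover have "c h * N h \<ge> 0" using N c_pos[of h] by simp
    ultimately show ?thesis
      using mult_right_mono[of m "W \<tau> \<xi>" "c h * N h"] mult_right_mono[of "W \<tau> \<xi>" M "c h * N h"]
      by (simp add: mult_ac)
  qed simp
  have "m * wsum N = (\<Sum>\<^sub>\<infinity>h. m * (c h * N h))" by (simp add: wsum_def infsum_cmult_right')
  also have "\<dots> \<le> wsum N'"
    unfolding w' using gapwise by (intro infsum_mono summable_on_cmult_right s s') auto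
  finally have lower: "m * wsum N \<le> wsum N'" .
  have "wsum N' \<le> (\<Sum>\<^sub>\<infinity>h. M * (c h * N h))"
    unfolding w' using gapwise by (intro infsum_mono summable_on_cmult_right s s') auto
  also have "\<dots> = M * wsum N" by (simp add: wsum_def infsum_cmult_right')
  finally have upper: "wsum N' \<le> M * wsum N" .
  have pos: "(1 - mass) * (x' - x) \<ge> 0" using mass_lt \<open>x < x'\<close> by simp
  show "m * (lo x' - up x) \<le> lo (x' + \<tau>) - up (x + \<tau>)"
    unfolding L R distrib_left using mult_right_mono[OF m1(1) pos] lower by simp
  show "lo (x' + \<tau>) - up (x + \<tau>) \<le> M * (lo x' - up x)"
    unfolding L R distrib_left using mult_right_mono[OF m1(2) pos] upper by simp
qed

text \<open>The interval is cut at \<open>up (cl y)\<close> and \<open>lo (cl z)\<close>: each outer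
  piece has a single collapsed value and is covered by the ordinary mean value theorem, and the
  middle piece by the termwise comparison.\<close>

lemma T_mean:
  assumes \<tau>: "\<tau> \<in> transl" and "y \<le> z"
    and b: "\<And>t. y \<le> t \<Longrightarrow> t \<le> z \<Longrightarrow> m \<le> W \<tau> t \<and> W \<tau> t \<le> M"
  shows "m * (z - y) \<le> T \<tau> z - T \<tau> y \<and> T \<tau> z - T \<tau> y \<le> M * (z - y)"
proof -
  have same: "m * (z' - y') \<le> T \<tau> z' - T \<tau> y' \<and> T \<tau> z' - T \<tau> y' \<le> M * (z' - y')"
    if "cl y' = cl z'" "y \<le> y'" "y' \<le> z'" "z' \<le> z" for y' z'
  proof (cases "y' = z'")
    case False
    then have "y' < z'" using that by simp
    from T_mvt_gap[OF \<tau> that(1) this] obtain \<xi> where \<xi>: "y' < \<xi>" "\<xi> < z'"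
      "T \<tau> z' - T \<tau> y' = (z' - y') * W \<tau> \<xi>" by blast
    have "m \<le> W \<tau> \<xi> \<and> W \<tau> \<xi> \<le> M" using \<xi> that by (intro b) auto
    then show ?thesis unfolding \<xi>(3) using \<open>y' < z'\<close>
      by (simp add: mult.commute mult_left_mono)
  qed simp
  show ?thesis
  proof (cases "cl y = cl z")
    case True
    then show ?thesis using same[of y z] \<open>y \<le> z\<close> by simp
  next
    case False
    then have lt: "cl y < cl z" using cl_mono[OF \<open>y \<le> z\<close>] by simp
    note ul = up_lt_lo[OF lt] cl[of y] cl[of z]
    have 1: "m * (up (cl y) - y) \<le> up (cl y + \<tau>) - T \<tau> y \<and> up (cl y + \<tau>) - T \<tau> y \<le> M * (up (cl y) - y)"
      using same[of y "up (cl y)"] ul \<tau> by simp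
    have 2: "m * (lo (cl z) - up (cl y)) \<le> lo (cl z + \<tau>) - up (cl y + \<tau>)"
        "lo (cl z + \<tau>) - up (cl y + \<tau>) \<le> M * (lo (cl z) - up (cl y))"
    proof -
      have "m \<le> W \<tau> t \<and> W \<tau> t \<le> M" if "up (cl y) \<le> t" "t \<le> lo (cl z)" for t
        using that ul by (intro b) auto
      note T_mean_jumps[OF \<tau> lt this]
      then show "m * (lo (cl z) - up (cl y)) \<le> lo (cl z + \<tau>) - up (cl y + \<tau>)"
        "lo (cl z + \<tau>) - up (cl y + \<tau>) \<le> M * (lo (cl z) - up (cl y))" by blast+
    qed
    have 3: "m * (z - lo (cl z)) \<le> T \<tau> z - lo (cl z + \<tau>) \<and> T \<tau> z - lo (cl z + \<tau>) \<le> M * (z - lo (cl z))"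
      using same[of "lo (cl z)" z] ul by simp
    have dec: "k * (z - y) = k * (up (cl y) - y) + k * (lo (cl z) - up (cl y)) + k * (z - lo (cl z))" for k
      by (simp add: algebra_simps)
    show ?thesis unfolding dec using 1 2 3 by linarith
  qed
qed

text \<open>Near y continuity confines \<open>W\<close> to an interval of radius e/2 about its value
  at y, and the mean inequality carries these bounds over to the difference quotients, even where
  gaps accumulate.\<close>

lemma T_deriv:
  assumes \<tau>: "\<tau> \<in> transl" and cont: "isCont (W \<tau>) y"
  shows "(T \<tau> has_real_derivative W \<tau> y) (at y)"
  unfolding has_field_derivative_iff
proof (rule tendstoI)
  fix e :: real assume "e > 0"
  then obtain d where d: "d > 0" "\<And>t. \<bar>t - y\<bar> < d \<Longrightarrow> \<bar>W \<tau> t - W \<tau> y\<bar> < e / 2"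
    using cont unfolding continuous_at_eps_delta by (metis dist_real_def half_gt_zero)
  have bound: "\<bar>T \<tau> z' - T \<tau> y' - W \<tau> y * (z' - y')\<bar> \<le> e / 2 * (z' - y')"
    if "y' \<le> z'" "\<bar>y' - y\<bar> < d" "\<bar>z' - y\<bar> < d" for y' z'
  proof -
    have "W \<tau> y - e / 2 \<le> W \<tau> t \<and> W \<tau> t \<le> W \<tau> y + e / 2" if "y' \<le> t" "t \<le> z'" for t
    proof -
      have "\<bar>t - y\<bar> < d" using that \<open>\<bar>y' - y\<bar> < d\<close> \<open>\<bar>z' - y\<bar> < d\<close> by linarith
      from d(2)[OF this] show ?thesis by linarith
    qed
    from T_mean[OF \<tau> that(1) this]
    show ?thesis unfolding left_diff_distrib distrib_right by linarith
  qed
  have "dist ((T \<tau> z - T \<tau> y) / (z - y)) (W \<tau> y) < e" if "z \<noteq> y" "dist z y < d" for z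
  proof -
    have zd: "\<bar>z - y\<bar> < d" using that by (simp add: dist_real_def)
    have "\<bar>T \<tau> z - T \<tau> y - W \<tau> y * (z - y)\<bar> \<le> e / 2 * \<bar>z - y\<bar>"
    proof (cases "y \<le> z")
      case True
      then show ?thesis using bound[of y z] zd d(1) by simp
    next
      case False
      have "T \<tau> z - T \<tau> y - W \<tau> y * (z - y) = - (T \<tau> y - T \<tau> z - W \<tau> y * (y - z))"
        by (simp add: algebra_simps)
      then show ?thesis using False bound[of z y] zd d(1) by (simp only: abs_minus_cancel) simp
    qed
    also have "\<dots> < e * \<bar>z - y\<bar>" using that \<open>e > 0\<close> by simp
    finally have "\<bar>T \<tau> z - T \<tau> y - W \<tau> y * (z - y)\<bar> / \<bar>z - y\<bar> < e"
      using that by (simp add: field_simps)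
    moreover have "(T \<tau> z - T \<tau> y) / (z - y) - W \<tau> y = (T \<tau> z - T \<tau> y - W \<tau> y * (z - y)) / (z - y)"
      using that by (simp add: field_simps)
    ultimately show ?thesis by (simp add: dist_real_def abs_divide)
  qed
  then show "\<forall>\<^sub>F z in at y. dist ((T \<tau> z - T \<tau> y) / (z - y)) (W \<tau> y) < e"
    unfolding eventually_at using d(1) by blast
qed

lemma W_near_one:
  assumes "\<tau> \<in> transl" "B \<ge> 1" "\<delta> \<ge> 0"
    and "\<And>x. jump x > 0 \<Longrightarrow> (jump x / jump (x + \<tau>))\<^sup>2 \<ge> 1 / B \<and> \<bar>(jump x / jump (x + \<tau>))\<^sup>2 - 1\<bar> \<le> \<delta>"
  shows "\<bar>W \<tau> y - 1\<bar> \<le> B * \<delta>"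
proof (cases "jump (cl y) > 0")
  case True
  from assms(4)[OF this] have "(jump (cl y) / jump (cl y + \<tau>))\<^sup>2 \<ge> 1 / B"
    and *: "\<bar>(jump (cl y) / jump (cl y + \<tau>))\<^sup>2 - 1\<bar> \<le> \<delta>" by auto
  from gap_deriv_near_one[OF assms(2) this(1)]
  have "\<bar>W \<tau> y - 1\<bar> \<le> B * \<bar>(jump (cl y) / jump (cl y + \<tau>))\<^sup>2 - 1\<bar>" by (simp add: W_def)
  also have "\<dots> \<le> B * \<delta>" using * assms(2) by (intro mult_left_mono) auto
  finally show ?thesis .
next
  case False
  then have "jump (cl y) = 0" using jump_nonneg[of "cl y"] by simp
  then show ?thesis using jump_transl_zero[OF assms(1)] assms(2,3) by (simp add: W_def)
qed

text \<open>In a gap of length a the Lipschitz constant is O(\<alpha> a / a), and for s = |y - z|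
  \<le> a this is at most a multiple of \<alpha> s / s. Points with different collapse are compared
  through the gap ends \<open>up (cl y)\<close> and \<open>lo (cl z)\<close>, where \<open>W\<close>
  is 1; this doubles the constant.\<close>

lemma W_modulus:
  fixes \<alpha> :: "real \<Rightarrow> real"
  assumes "\<tau> \<in> transl" "B \<ge> 1" "K \<ge> 0"
    and ratio: "\<And>x. jump x > 0 \<Longrightarrow> (jump x / jump (x + \<tau>))\<^sup>2 \<ge> 1 / B \<and>
        \<bar>(jump x / jump (x + \<tau>))\<^sup>2 - 1\<bar> \<le> K * \<alpha> (jump x)"
    and mono: "\<And>s t. 0 \<le> s \<Longrightarrow> s \<le> t \<Longrightarrow> \<alpha> s \<le> \<alpha> t" and zero: "\<alpha> 0 = 0"
    and star: "\<And>s t. 0 < s \<Longrightarrow> s \<le> t \<Longrightarrow> \<alpha> t / t \<le> \<alpha> s / s"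
  shows "\<bar>W \<tau> y - W \<tau> z\<bar> \<le> 4 * pi * B\<^sup>2 * K * \<alpha> \<bar>y - z\<bar>"
proof -
  define L where "L = 2 * pi * B\<^sup>2 * K"
  have L: "L \<ge> 0" using assms(3) by (simp add: L_def)
  have same: "\<bar>W \<tau> y - W \<tau> z\<bar> \<le> L * \<alpha> \<bar>y - z\<bar>" if eq: "cl y = cl z" for y z
  proof (cases "y = z")
    case False
    define a b where "a = jump (cl y)" and "b = jump (cl y + \<tau>)"
    have yz: "\<bar>y - z\<bar> \<le> a" using gap_coord[of y] gap_coord[of z] eq by (auto simp: a_def)
    then have a: "a > 0" using False by simp
    have r: "(a / b)\<^sup>2 \<ge> 1 / B" "\<bar>(a / b)\<^sup>2 - 1\<bar> \<le> K * \<alpha> a" using ratio[of "cl y"] a by (auto simp: a_def b_def)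
    have "\<bar>W \<tau> y - W \<tau> z\<bar> \<le> 2 * pi * B\<^sup>2 * \<bar>(a / b)\<^sup>2 - 1\<bar> / a * \<bar>y - z\<bar>"
      using gap_deriv_lipschitz[OF assms(2) r(1) a, of "y - lo (cl y)" "z - lo (cl y)"]
      by (simp add: W_def eq a_def b_def)
    also have "\<dots> \<le> 2 * pi * B\<^sup>2 * (K * \<alpha> a) / a * \<bar>y - z\<bar>"
      using r(2) a by (intro mult_right_mono divide_right_mono mult_left_mono) auto
    also have "\<dots> = L * ((\<alpha> a / a) * \<bar>y - z\<bar>)" by (simp add: L_def)
    also have "\<dots> \<le> L * ((\<alpha> \<bar>y - z\<bar> / \<bar>y - z\<bar>) * \<bar>y - z\<bar>)"
      using star[of "\<bar>y - z\<bar>" a] False yz L by (intro mult_left_mono mult_right_mono) auto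
    also have "\<dots> = L * \<alpha> \<bar>y - z\<bar>" using False by simp
    finally show ?thesis .
  qed (simp add: zero)
  have main: "\<bar>W \<tau> y - W \<tau> z\<bar> \<le> 2 * L * \<alpha> \<bar>y - z\<bar>" if "y \<le> z" for y z
  proof (cases "cl y = cl z")
    case True
    have "\<alpha> \<bar>y - z\<bar> \<ge> 0" using mono[of 0 "\<bar>y - z\<bar>"] zero by simp
    then have "L * \<alpha> \<bar>y - z\<bar> \<ge> 0" using L by simp
    then show ?thesis using same[OF True] by simp
  next
    case False
    then have lt: "cl y < cl z" using cl_mono[OF that] by simp
    note ul = up_lt_lo[OF lt] cl[of y] cl[of z]
    have "\<bar>W \<tau> y - 1\<bar> \<le> L * \<alpha> \<bar>y - up (cl y)\<bar>" using same[of y "up (cl y)"] assms(1) by simp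
    also have "\<dots> \<le> L * \<alpha> \<bar>y - z\<bar>" using ul L by (intro mult_left_mono mono) auto
    finally have 1: "\<bar>W \<tau> y - 1\<bar> \<le> L * \<alpha> \<bar>y - z\<bar>" .
    have "\<bar>W \<tau> z - 1\<bar> \<le> L * \<alpha> \<bar>z - lo (cl z)\<bar>" using same[of z "lo (cl z)"] by simp
    also have "\<dots> \<le> L * \<alpha> \<bar>y - z\<bar>" using ul L by (intro mult_left_mono mono) auto
    finally have 2: "\<bar>W \<tau> z - 1\<bar> \<le> L * \<alpha> \<bar>y - z\<bar>" .
    show ?thesis using 1 2 by linarith
  qed
  have "\<bar>W \<tau> y - W \<tau> z\<bar> \<le> 2 * L * \<alpha> \<bar>y - z\<bar>"
    using main[of y z] main[of z y] by (cases "y \<le> z") (auto simp: abs_minus_commute)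
  then show ?thesis by (simp add: L_def)
qed

section \<open>The complement of the gaps as a minimal set\<close>

definition core :: "real set" where "core = range lo \<union> range up"

lemma core_iff: "y \<in> core \<longleftrightarrow> y = lo (cl y) \<or> y = up (cl y)"
  unfolding core_def by force

lemma gap_not_core: "lo x < y \<Longrightarrow> y < up x \<Longrightarrow> y \<notin> core"
  using cl_unique[of x y] by (auto simp: core_iff)

lemma closed_core: "closed core"
proof -
  have "- core = (\<Union>x. {lo x<..<up x})"
  proof (intro equalityI subsetI)
    fix y assume "y \<in> - core"
    then have "lo (cl y) < y" "y < up (cl y)" using cl[of y] by (auto simp: core_iff)
    then show "y \<in> (\<Union>x. {lo x<..<up x})" by auto
  qed (use gap_not_core in auto)
  then show ?thesis by (simp add: closed_def open_UN)
qed

lemma core_shift: "y \<in> core \<Longrightarrow> n \<in> \<int> \<Longrightarrow> y + n \<in> core"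
  by (simp add: core_iff cl_shift shift_int)

lemma T_core: "\<tau> \<in> transl \<Longrightarrow> y \<in> core \<Longrightarrow> T \<tau> y \<in> core"
  unfolding core_def by auto

text \<open>One-sided continuity and strict monotonicity: values of \<open>lo\<close> accumulate at
  \<open>lo x\<close> from the left, values of \<open>up\<close> at \<open>up x\<close> from the
  right.\<close>

lemma core_islimpt:
  assumes "y \<in> core" shows "y islimpt core"
  unfolding islimpt_approachable
proof (intro allI impI)
  fix e :: real assume e: "e > 0"
  from assms consider x where "y = lo x" | x where "y = up x" by (auto simp: core_def)
  then show "\<exists>z\<in>core. z \<noteq> y \<and> dist z y < e"
  proof cases
    case 1
    obtain d where "d > 0" "\<And>z. x - d < z \<Longrightarrow> z < x \<Longrightarrow> lo x - e < lo z"
      using lo_left_continuous[OF e, of x] by blast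
    then have "lo x - e < lo (x - d/2)" "lo (x - d/2) < lo x"
      using lo_le_up[of "x - d/2"] up_lt_lo[of "x - d/2" x] by auto
    then show ?thesis using 1 by (intro bexI[of _ "lo (x - d/2)"]) (auto simp: core_def dist_real_def)
  next
    case 2
    obtain d where "d > 0" "\<And>z. x < z \<Longrightarrow> z < x + d \<Longrightarrow> up z < up x + e"
      using up_right_continuous[OF e, of x] by blast
    then have "up (x + d/2) < up x + e" "up x < up (x + d/2)"
      using lo_le_up[of "x + d/2"] up_lt_lo[of x "x + d/2"] by auto
    then show ?thesis using 2 by (intro bexI[of _ "up (x + d/2)"]) (auto simp: core_def dist_real_def)
  qed
qed

text \<open>Points with the same collapse bound an interval inside one gap; otherwise density of the
  orbit puts a whole gap between them.\<close>

lemma not_core_between: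
  assumes "a < b" shows "\<exists>t. a < t \<and> t < b \<and> t \<notin> core"
proof (cases "cl a = cl b")
  case True
  then show ?thesis using assms cl[of a] cl[of b]
    by (intro exI[of _ "(a + b) / 2"] conjI gap_not_core[of "cl a"]) auto
next
  case False
  then have "cl a < cl b" using cl_mono[of a b] assms by simp
  then obtain g n where n: "n \<in> \<int>" "cl a < \<theta> g + n" "\<theta> g + n < cl b" using theta_dense by blast
  define z where "z = \<theta> g + n"
  have "jump z > 0" unfolding jump_pos_iff using n(1) by (intro exI[of _ g]) (simp add: z_def)
  then have "lo z < up z" by (simp add: jump_def)
  moreover have "a < lo z" "up z < b"
    using up_lt_lo[of "cl a" z] up_lt_lo[of z "cl b"] n cl[of a] cl[of b] by (auto simp: z_def)
  ultimately show ?thesis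
    by (intro exI[of _ "(lo z + up z) / 2"] conjI gap_not_core[of z]) auto
qed

lemma ex_transl_between:
  assumes "a < b" obtains \<tau> where "\<tau> \<in> transl" "a < \<tau>" "\<tau> < b"
proof -
  obtain g n where "n \<in> \<int>" "a < \<theta> g + n" "\<theta> g + n < b" using theta_dense[OF assms] by blast
  then show ?thesis using that[of "\<theta> g + n"] transl_add[OF transl_theta transl_Ints] by blast
qed

text \<open>Any starting point y works, inside a gap or not. If \<open>cl y + \<tau>\<close> lies
  just left of x, then \<open>T \<tau> y\<close> is squeezed between the values of \<open>lo\<close>
  and \<open>up\<close> there, hence just below \<open>lo x\<close>; approaching from the right
  reaches \<open>up x\<close>.\<close>

lemma core_minimal:
  assumes "closed L" "L \<noteq> {}" and inv: "\<And>\<tau> y. \<tau> \<in> transl \<Longrightarrow> y \<in> L \<Longrightarrow> T \<tau> y \<in> L"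
  shows "core \<subseteq> L"
proof
  fix k assume k: "k \<in> core"
  obtain y where y: "y \<in> L" using assms(2) by blast
  have "\<exists>t\<in>L. dist t k < e" if e: "e > 0" for e
  proof -
    from k consider x where "k = lo x" | x where "k = up x" by (auto simp: core_def)
    then show ?thesis
    proof cases
      case 1
      obtain d where d: "d > 0" "\<And>z. x - d < z \<Longrightarrow> z < x \<Longrightarrow> lo x - e < lo z"
        using lo_left_continuous[OF e, of x] by blast
      obtain \<tau> where \<tau>: "\<tau> \<in> transl" "x - d - cl y < \<tau>" "\<tau> < x - cl y"
        using ex_transl_between[of "x - d - cl y" "x - cl y"] d(1) by auto
      have "lo x - e < T \<tau> y" "T \<tau> y < lo x"
        using T_range[OF \<tau>(1), of y] d(2)[of "cl y + \<tau>"] up_lt_lo[of "cl y + \<tau>" x] \<tau> by auto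
      then show ?thesis using 1 inv[OF \<tau>(1) y] by (intro bexI[of _ "T \<tau> y"]) (auto simp: dist_real_def)
    next
      case 2
      obtain d where d: "d > 0" "\<And>z. x < z \<Longrightarrow> z < x + d \<Longrightarrow> up z < up x + e"
        using up_right_continuous[OF e, of x] by blast
      obtain \<tau> where \<tau>: "\<tau> \<in> transl" "x - cl y < \<tau>" "\<tau> < x + d - cl y"
        using ex_transl_between[of "x - cl y" "x + d - cl y"] d(1) by auto
      have "up x < T \<tau> y" "T \<tau> y < up x + e"
        using T_range[OF \<tau>(1), of y] d(2)[of "cl y + \<tau>"] up_lt_lo[of x "cl y + \<tau>"] \<tau> by auto
      then show ?thesis using 2 inv[OF \<tau>(1) y] by (intro bexI[of _ "T \<tau> y"]) (auto simp: dist_real_def)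
    qed
  qed
  then show "k \<in> L" using closed_approachable[OF assms(1), of k] by simp
qed

end

section \<open>Concave moduli and summable weights\<close>

lemma concave_modulus_mono_weak:
  assumes "concave_modulus \<alpha>" "0 \<le> s" "s \<le> t"
  shows "\<alpha> s \<le> \<alpha> t"
proof (rule ccontr)
  assume "\<not> \<alpha> s \<le> \<alpha> t"
  then have lt: "\<alpha> t < \<alpha> s" by simp
  have conc: "concave_on {0..} \<alpha>" using assms(1) by (simp add: concave_modulus_def)
  have pos: "\<alpha> x \<ge> 0" if "x \<ge> 0" for x
    using assms(1) that by (auto simp: concave_modulus_def homeomorphism_def)
  have st: "s < t" using lt assms(3) by (cases "s = t") auto
  have as: "\<alpha> s > 0" using lt pos[of t] assms(2,3) by linarith
  \<comment> \<open>With z below, t = (1 - u) s + u z. This u makes (1 - u) \<alpha> s the midpoint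
    of \<alpha> s and \<alpha> t, which exceeds \<alpha> t; together with \<alpha> z \<ge> 0 this
    contradicts concavity.\<close>
  define u where "u = (\<alpha> s - \<alpha> t) / (2 * \<alpha> s)"
  have u: "0 < u" "u < 1" using lt as pos[of t] assms(2,3) by (auto simp: u_def field_simps)
  define z where "z = s + (t - s) / u"
  have z: "z \<ge> 0" using st assms(2) u by (simp add: z_def)
  have "(1 - u) *\<^sub>R s + u *\<^sub>R z = t" using u by (simp add: z_def field_simps)
  moreover have "\<alpha> ((1 - u) *\<^sub>R s + u *\<^sub>R z) \<ge> (1 - u) * \<alpha> s + u * \<alpha> z"
    using concave_onD[OF conc, of u s z] u z assms(2) by simp
  moreover have "u * \<alpha> z \<ge> 0" using u pos[OF z] by simp
  moreover have "(1 - u) * \<alpha> s > \<alpha> t" using as lt by (simp add: u_def field_simps)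
  ultimately show False by simp
qed

lemma concave_modulus_strict:
  assumes "concave_modulus \<alpha>" "0 \<le> s" "s < t"
  shows "\<alpha> s < \<alpha> t"
proof -
  obtain \<gamma> where "homeomorphism {0..} {0..} \<alpha> \<gamma>" using assms(1) by (auto simp: concave_modulus_def)
  then have "\<gamma> (\<alpha> s) = s" "\<gamma> (\<alpha> t) = t" using assms by (auto simp: homeomorphism_def)
  then have "\<alpha> s \<noteq> \<alpha> t" using assms(3) by auto
  then show ?thesis using concave_modulus_mono_weak[OF assms(1,2), of t] assms(3) by simp
qed

lemma concave_modulus_surj:
  assumes "concave_modulus \<alpha>"
  shows "\<alpha> ` {0..} = {0..}"
  using assms by (auto simp: concave_modulus_def homeomorphism_def)

lemma concave_modulus_zero:
  assumes "concave_modulus \<alpha>" shows "\<alpha> 0 = 0"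
proof -
  have "(0::real) \<in> \<alpha> ` {0..}" using concave_modulus_surj[OF assms] by simp
  then obtain s where "s \<ge> 0" "\<alpha> s = 0" by auto
  moreover have "\<alpha> 0 \<in> {0..}" using concave_modulus_surj[OF assms] by blast
  ultimately show ?thesis using concave_modulus_mono_weak[OF assms, of 0 s] by simp
qed

text \<open>Compare with the chord from the origin, where the modulus vanishes.\<close>

lemma concave_modulus_star:
  assumes "concave_modulus \<alpha>" "0 < s" "s \<le> t"
  shows "\<alpha> t / t \<le> \<alpha> s / s"
proof -
  have conc: "concave_on {0..} \<alpha>" using assms(1) by (simp add: concave_modulus_def)
  have "\<alpha> ((1 - s / t) *\<^sub>R 0 + (s / t) *\<^sub>R t) \<ge> (1 - s / t) * \<alpha> 0 + (s / t) * \<alpha> t"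
    using concave_onD[OF conc, of "s / t" 0 t] assms by simp
  then have "s / t * \<alpha> t \<le> \<alpha> s" using assms by (simp add: concave_modulus_zero[OF assms(1)])
  then show ?thesis using assms by (simp add: field_simps)
qed

lemma concave_modulus_pos: "concave_modulus \<alpha> \<Longrightarrow> 0 < t \<Longrightarrow> 0 < \<alpha> t"
  using concave_modulus_strict[of \<alpha> 0 t] concave_modulus_zero[of \<alpha>] by simp

lemma modulus_inverse:
  assumes "concave_modulus \<alpha>" "t \<ge> 0"
  shows "inv_into {0..} \<alpha> t \<ge> 0" "\<alpha> (inv_into {0..} \<alpha> t) = t"
proof -
  have t: "t \<in> \<alpha> ` {0..}" using concave_modulus_surj[OF assms(1)] assms(2) by simp
  show "inv_into {0..} \<alpha> t \<ge> 0" using inv_into_into[OF t] by simp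
  show "\<alpha> (inv_into {0..} \<alpha> t) = t" by (rule f_inv_into_f[OF t])
qed

lemma modulus_inverse_less_iff:
  assumes "concave_modulus \<alpha>" "0 \<le> t" "0 \<le> s"
  shows "inv_into {0..} \<alpha> t < s \<longleftrightarrow> t < \<alpha> s"
proof -
  have "inv_into {0..} \<alpha> t < s \<longleftrightarrow> \<alpha> (inv_into {0..} \<alpha> t) < \<alpha> s"
    using concave_modulus_strict[OF assms(1) modulus_inverse(1)[OF assms(1,2)], of s]
      concave_modulus_mono_weak[OF assms(1,3), of "inv_into {0..} \<alpha> t"] by (meson not_le)
  then show ?thesis by (simp add: modulus_inverse[OF assms(1,2)])
qed

lemma modulus_inverse_mono:
  assumes "concave_modulus \<alpha>" "0 \<le> s" "s \<le> t"
  shows "inv_into {0..} \<alpha> s \<le> inv_into {0..} \<alpha> t"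
proof -
  have t: "0 \<le> t" using assms by simp
  have "\<not> t < \<alpha> (inv_into {0..} \<alpha> s)" using assms by (simp add: modulus_inverse)
  then show ?thesis
    using modulus_inverse_less_iff[OF assms(1) t modulus_inverse(1)[OF assms(1,2)]] by simp
qed

lemma modulus_inverse_pos:
  assumes "concave_modulus \<alpha>" "0 < t"
  shows "0 < inv_into {0..} \<alpha> t"
proof -
  have "inv_into {0..} \<alpha> t \<noteq> 0"
    using modulus_inverse(2)[OF assms(1), of t] concave_modulus_zero[OF assms(1)] assms(2) by force
  then show ?thesis using modulus_inverse(1)[OF assms(1), of t] assms(2) by simp
qed

text \<open>The bound on \<open>\<alpha> t / (t \<alpha>' t)\<close> says that \<open>ln \<circ> \<alpha>\<inverse> \<circ> exp\<close> is Lipschitz.\<close>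

lemma modulus_inverse_log_lipschitz:
  assumes \<alpha>: "concave_modulus \<alpha>" and diff: "\<alpha> differentiable_on {0<..}"
    and bdd: "bdd_above ((\<lambda>t. \<alpha> t / (t * deriv \<alpha> t)) ` {0<..})"
  obtains C where "C > 0" "\<And>p q. 0 < p \<Longrightarrow> p \<le> q \<Longrightarrow>
      ln (inv_into {0..} \<alpha> q) - ln (inv_into {0..} \<alpha> p) \<le> C * (ln q - ln p)"
proof -
  obtain C0 where C0: "\<And>t. t > 0 \<Longrightarrow> \<alpha> t / (t * deriv \<alpha> t) \<le> C0"
    using bdd by (auto simp: bdd_above_def)
  define C where "C = max 1 C0"
  have C: "C > 0" by (simp add: C_def)
  have conv: "convex_on {0..} (\<lambda>x. - \<alpha> x)"
    using \<alpha> by (simp add: concave_modulus_def concave_on_def)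
  have D: "(\<alpha> has_real_derivative deriv \<alpha> t) (at t)" if "t > 0" for t
  proof -
    have "\<alpha> differentiable at t"
      using diff that by (auto simp: differentiable_on_def at_within_open[OF _ open_greaterThan])
    then show ?thesis
      using DERIV_deriv_iff_real_differentiable by blast
  qed
  \<comment> \<open>Positivity of the derivative allows the bound on \<alpha> t / (t \<alpha>' t) to
    be inverted. The tangent at t lies above the graph, while \<alpha> increases strictly from t to
    t + 1.\<close>
  have D0: "deriv \<alpha> t > 0" if "t > 0" for t
  proof -
    have "((\<lambda>x. - \<alpha> x) has_real_derivative - deriv \<alpha> t) (at t within {0..})"
      using D[OF that] by (intro DERIV_minus) (rule has_field_derivative_at_within)
    from convex_on_imp_above_tangent[OF conv _ _ _ this, of "t + 1"] that
    have "\<alpha> (t + 1) - \<alpha> t \<le> deriv \<alpha> t" by simp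
    then show ?thesis using concave_modulus_strict[OF \<alpha>, of t "t + 1"] that by simp
  qed
  \<comment> \<open>The bound says precisely that C ln (\<alpha> t) - ln t has a nonnegative
    derivative; the claim follows by inserting values of the inverse.\<close>
  have main: "ln t - ln s \<le> C * (ln (\<alpha> t) - ln (\<alpha> s))" if "0 < s" "s \<le> t" for s t
  proof -
    have "C * ln (\<alpha> s) - ln s \<le> C * ln (\<alpha> t) - ln t"
    proof (rule DERIV_nonneg_imp_nondecreasing[OF that(2)])
      fix x assume "s \<le> x" "x \<le> t"
      then have x: "x > 0" using that by simp
      have ax: "\<alpha> x > 0" using concave_modulus_pos[OF \<alpha> x] .
      have "((\<lambda>x. ln (\<alpha> x)) has_real_derivative deriv \<alpha> x / \<alpha> x) (at x)"
        using DERIV_chain2[OF DERIV_ln D[OF x]] ax by (simp add: field_simps)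
      from DERIV_diff[OF DERIV_cmult[OF this, of C] DERIV_ln[OF x]]
      have d: "((\<lambda>x. C * ln (\<alpha> x) - ln x) has_real_derivative (C * (deriv \<alpha> x / \<alpha> x) - inverse x)) (at x)" .
      have "\<alpha> x / (x * deriv \<alpha> x) \<le> C" using C0[OF x] by (simp add: C_def)
      then have "1 / x \<le> C * (deriv \<alpha> x / \<alpha> x)" using x ax D0[OF x] by (simp add: field_simps)
      then show "\<exists>y. ((\<lambda>x. C * ln (\<alpha> x) - ln x) has_real_derivative y) (at x) \<and> 0 \<le> y"
        using d by (intro exI conjI) (auto simp: inverse_eq_divide)
    qed
    then show ?thesis by (simp add: right_diff_distrib)
  qed
  have "ln (inv_into {0..} \<alpha> q) - ln (inv_into {0..} \<alpha> p) \<le> C * (ln q - ln p)" if "0 < p" "p \<le> q" for p q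
    using main[OF modulus_inverse_pos[OF \<alpha> that(1)] modulus_inverse_mono[OF \<alpha> _ that(2)]] that
    by (simp add: modulus_inverse(2)[OF \<alpha>])
  with C show ?thesis by (rule that)
qed

section \<open>Counting lattice points and summing the weights\<close>

definition l1 :: "int ^ 'd::finite \<Rightarrow> real" where "l1 h = (\<Sum>i\<in>UNIV. \<bar>real_of_int (h $ i)\<bar>)"

lemma l1_nonneg: "l1 h \<ge> 0" unfolding l1_def by (intro sum_nonneg) simp

lemma l1_add: "l1 (h + g) \<le> l1 h + l1 g"
  unfolding l1_def sum.distrib[symmetric] by (intro sum_mono) simp

lemma l1_minus: "l1 (- h) = l1 h" unfolding l1_def by simp

lemma l1_diff: "\<bar>l1 (h + g) - l1 h\<bar> \<le> l1 g"
  using l1_add[of h g] l1_add[of "h + g" "- g"] l1_minus[of g] by simp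

lemma card_l1_ball:
  assumes "x \<ge> 0"
  shows "finite {h :: int ^ 'd::finite. l1 h \<le> x}"
    and "real (card {h :: int ^ 'd. l1 h \<le> x}) \<le> (2 * x + 1) ^ CARD('d)"
proof -
  define n where "n = \<lfloor>x\<rfloor>"
  have n: "n \<ge> 0" "of_int n \<le> x" using assms by (simp_all add: n_def)
  define A :: "('d \<Rightarrow> int) set" where "A = PiE UNIV (\<lambda>_. {-n..n})"
  have sub: "{h :: int ^ 'd. l1 h \<le> x} \<subseteq> vec_lambda ` A"
  proof
    fix h :: "int ^ 'd" assume "h \<in> {h. l1 h \<le> x}"
    then have h: "l1 h \<le> x" by simp
    have "h $ i \<in> {-n..n}" for i
    proof -
      have "\<bar>real_of_int (h $ i)\<bar> \<le> l1 h" unfolding l1_def by (rule member_le_sum) auto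
      then have "real_of_int \<bar>h $ i\<bar> \<le> x" using h by simp
      then have "\<bar>h $ i\<bar> \<le> n" unfolding n_def by (simp add: le_floor_iff)
      then show ?thesis by auto
    qed
    then show "h \<in> vec_lambda ` A" by (intro image_eqI[of _ _ "vec_nth h"]) (auto simp: A_def)
  qed
  have finA: "finite A" unfolding A_def by (intro finite_PiE) auto
  show fin: "finite {h :: int ^ 'd. l1 h \<le> x}" using sub finA finite_subset by blast
  have "card {h :: int ^ 'd. l1 h \<le> x} \<le> card (vec_lambda ` A)" using sub finA by (intro card_mono) auto
  also have "\<dots> \<le> card A" by (rule card_image_le[OF finA])
  also have "card A = nat (2 * n + 1) ^ CARD('d)"
    unfolding A_def by (simp add: card_PiE algebra_simps)
  finally have "real (card {h :: int ^ 'd. l1 h \<le> x}) \<le> real (nat (2 * n + 1) ^ CARD('d))"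
    by simp
  also have "\<dots> = (2 * real_of_int n + 1) ^ CARD('d)" using n(1) by simp
  also have "\<dots> \<le> (2 * x + 1) ^ CARD('d)" using n by (intro power_mono) auto
  finally show "real (card {h :: int ^ 'd. l1 h \<le> x}) \<le> (2 * x + 1) ^ CARD('d)" .
qed

text \<open>Each weight is an average over a dyadic interval around its argument, and at most
  \<open>O(t\<^sup>-\<^sup>d)\<close> of these intervals contain \<open>t\<close>.\<close>

lemma weights_summable:
  fixes \<beta> :: "real \<Rightarrow> real"
  assumes int: "set_integrable lborel {0<..1} (\<lambda>t. \<beta> t / t ^ (CARD('d) + 1))"
    and mono: "\<And>s t. 0 \<le> s \<Longrightarrow> s \<le> t \<Longrightarrow> \<beta> s \<le> \<beta> t" and nonneg: "\<And>t. 0 \<le> t \<Longrightarrow> 0 \<le> \<beta> t"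
  shows "(\<lambda>h :: int ^ 'd::finite. \<beta> (1 / (2 + l1 h))) summable_on UNIV"
proof (rule nonneg_bdd_above_summable_on)
  show "0 \<le> \<beta> (1 / (2 + l1 h))" for h :: "int ^ 'd" using nonneg l1_nonneg[of h] by simp
  define u :: "int ^ 'd \<Rightarrow> real" where "u = (\<lambda>h. 2 + l1 h)"
  have u: "u h \<ge> 2" for h using l1_nonneg[of h] by (simp add: u_def)
  define d where "d = CARD('d)"
  \<comment> \<open>For t \<le> 1 at most (4/t + 1)^d \<le> (5/t)^d intervals contain t, and each of
    them contributes at most (2/t) \<beta> t.\<close>
  define K :: real where "K = 2 * 5 ^ d"
  define R where "R = (\<lambda>t. indicator {0<..1} t *\<^sub>R (K * (\<beta> t / t ^ (d + 1))))"
  \<comment> \<open>A box of height u \<beta> (1/u) over an interval of length 1/u, so its integral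
    is \<beta> (1/u). As u \<ge> 2, the interval lies in (0,1].\<close>
  define L where "L = (\<lambda>h t. indicator {1 / u h..2 / u h} t * (u h * \<beta> (1 / u h)))"
  have intR: "integrable lborel R"
    using set_integrable_mult_right[of K, OF int] unfolding set_integrable_def R_def d_def by simp
  have intL: "integrable lborel (L h)" and valL: "integral\<^sup>L lborel (L h) = \<beta> (1 / u h)" for h
  proof -
    have i: "integrable lborel (indicator {1 / u h..2 / u h} :: real \<Rightarrow> real)"
      by (rule integrable_real_indicator) (auto simp: emeasure_lborel_Icc_eq)
    then show "integrable lborel (L h)" unfolding L_def by simp
    have "measure lborel {1 / u h..2 / u h} = 1 / u h"
      using u[of h] by (simp add: divide_right_mono diff_divide_distrib[symmetric])
    then show "integral\<^sup>L lborel (L h) = \<beta> (1 / u h)"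
      unfolding L_def using u[of h] by simp
  qed
  have pointwise: "(\<Sum>h\<in>F. L h t) \<le> R t" if F: "finite F" for F t
  proof (cases "0 < t \<and> t \<le> 1")
    case False
    have "L h t = 0" for h
    proof -
      have "t \<notin> {1 / u h..2 / u h}"
      proof
        assume *: "t \<in> {1 / u h..2 / u h}"
        have "0 < 1 / u h" "2 / u h \<le> 1" using u[of h] by simp_all
        with * have "0 < t \<and> t \<le> 1" by (meson atLeastAtMost_iff less_le_trans order_trans)
        with False show False by simp
      qed
      then show ?thesis by (simp add: L_def)
    qed
    then show ?thesis using False by (simp add: R_def)
  next
    case True
    define A where "A = {h :: int ^ 'd. l1 h \<le> 2 / t}"
    have bt: "\<beta> t \<ge> 0" using nonneg True by simp
    have A: "finite A" "real (card A) \<le> (2 * (2 / t) + 1) ^ d"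
      unfolding A_def d_def using True by (intro card_l1_ball; simp)+
    have zero: "L h t = 0" if "h \<notin> A" for h
    proof -
      have "t \<notin> {1 / u h..2 / u h}"
      proof
        assume "t \<in> {1 / u h..2 / u h}"
        then have "t \<le> 2 / u h" by simp
        then have "u h \<le> 2 / t" using True u[of h] by (simp add: field_simps)
        then show False using that by (simp add: A_def u_def)
      qed
      then show ?thesis by (simp add: L_def)
    qed
    have each: "L h t \<le> 2 / t * \<beta> t" for h
    proof (cases "t \<in> {1 / u h..2 / u h}")
      case t: True
      have "u h \<le> 2 / t" using t True u[of h] by (simp add: field_simps)
      moreover have "\<beta> (1 / u h) \<le> \<beta> t" using t u[of h] by (intro mono) auto
      ultimately have "u h * \<beta> (1 / u h) \<le> 2 / t * \<beta> t"
        using u[of h] bt True by (intro mult_mono nonneg) auto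
      then show ?thesis using t by (simp add: L_def)
    qed (use bt True in \<open>simp add: L_def\<close>)
    have "(\<Sum>h\<in>F. L h t) = (\<Sum>h\<in>F \<inter> A. L h t)"
      using F zero by (intro sum.mono_neutral_right) auto
    also have "\<dots> \<le> real (card (F \<inter> A)) * (2 / t * \<beta> t)"
      by (rule sum_bounded_above) (rule each)
    also have "\<dots> \<le> real (card A) * (2 / t * \<beta> t)"
      using A(1) bt True by (intro mult_right_mono) (auto intro!: card_mono)
    also have "\<dots> \<le> (5 / t) ^ d * (2 / t * \<beta> t)"
    proof (intro mult_right_mono)
      have "(2 * (2 / t) + 1) ^ d \<le> (5 / t) ^ d" using True by (intro power_mono) (auto simp: field_simps)
      with A(2) show "real (card A) \<le> (5 / t) ^ d" by linarith
    qed (use bt True in auto)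
    also have "\<dots> = R t" using True by (simp add: R_def K_def power_divide mult_ac)
    finally show ?thesis .
  qed
  show "bdd_above (sum (\<lambda>h :: int ^ 'd. \<beta> (1 / (2 + l1 h))) ` {F. F \<subseteq> UNIV \<and> finite F})"
  proof (rule bdd_aboveI2)
    fix F :: "(int ^ 'd) set" assume "F \<in> {F. F \<subseteq> UNIV \<and> finite F}"
    then have F: "finite F" by simp
    have "sum (\<lambda>h. \<beta> (1 / (2 + l1 h))) F = (\<Sum>h\<in>F. integral\<^sup>L lborel (L h))"
      by (simp add: valL u_def)
    also have "\<dots> = integral\<^sup>L lborel (\<lambda>t. \<Sum>h\<in>F. L h t)"
      by (rule Bochner_Integration.integral_sum[symmetric]) (rule intL)
    also have "\<dots> \<le> integral\<^sup>L lborel R"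
      by (rule integral_mono) (auto intro!: intR intL pointwise F)
    finally show "sum (\<lambda>h. \<beta> (1 / (2 + l1 h))) F \<le> integral\<^sup>L lborel R" .
  qed
qed

text \<open>The summand 2 keeps the averaging interval from 1/u to 2/u inside the unit interval.
  \<open>k\<close> is the approximation parameter: as it grows, the total length and the deviation
  of the length ratios from 1 both tend to 0.\<close>

definition weight :: "(real \<Rightarrow> real) \<Rightarrow> nat \<Rightarrow> int ^ 'd::finite \<Rightarrow> real"
  where "weight \<alpha> k h = inv_into {0..} \<alpha> (1 / (2 + real k + l1 h))"

lemma weight_pos: "concave_modulus \<alpha> \<Longrightarrow> weight \<alpha> k h > 0"
  unfolding weight_def using l1_nonneg[of h] by (intro modulus_inverse_pos) auto

lemma modulus_weight: "concave_modulus \<alpha> \<Longrightarrow> \<alpha> (weight \<alpha> k h) = 1 / (2 + real k + l1 h)"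
  unfolding weight_def using l1_nonneg[of h] by (intro modulus_inverse) auto

text \<open>The bound is relative to \<open>u\<close> even when \<open>v\<close> is the smaller
  number: v \<ge> 1 gives u \<le> v + m \<le> v (m + 1), so passing from 1/v to 1/u costs only the
  factor m + 1.\<close>

lemma ln_ratio_le:
  fixes u v m :: real
  assumes "u \<ge> 1" "v \<ge> 1" "\<bar>u - v\<bar> \<le> m"
  shows "\<bar>ln u - ln v\<bar> \<le> m * (m + 1) / u"
proof -
  have m: "m \<ge> 0" using assms(3) by simp
  have 1: "ln u - ln v \<le> m * (m + 1) / u"
  proof -
    have "u \<le> v + m" using assms(3) by simp
    also have "\<dots> \<le> v * (m + 1)" using mult_right_mono[of 1 v m] assms(2) m by (simp add: algebra_simps)
    finally have uv: "u \<le> v * (m + 1)" .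
    have "ln u - ln v = ln (u / v)" using assms by (simp add: ln_div)
    also have "\<dots> \<le> u / v - 1" using assms by (intro ln_le_minus_one) simp
    also have "\<dots> = (u - v) / v" using assms by (simp add: field_simps)
    also have "\<dots> \<le> m / v" using assms by (intro divide_right_mono) auto
    also have "\<dots> = m * (1 / v)" by simp
    also have "\<dots> \<le> m * ((m + 1) / u)"
      using uv assms m by (intro mult_left_mono) (auto simp: field_simps)
    finally show ?thesis by simp
  qed
  have 2: "ln v - ln u \<le> m * (m + 1) / u"
  proof -
    have "ln v - ln u = ln (v / u)" using assms by (simp add: ln_div)
    also have "\<dots> \<le> v / u - 1" using assms by (intro ln_le_minus_one) simp
    also have "\<dots> = (v - u) / u" using assms by (simp add: field_simps)
    also have "\<dots> \<le> m / u" using assms by (intro divide_right_mono) auto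
    also have "\<dots> \<le> m * (m + 1) / u"
      using mult_left_mono[of 1 "m + 1" m] assms m by (intro divide_right_mono) auto
    finally show ?thesis .
  qed
  show ?thesis using 1 2 by (simp add: abs_le_iff)
qed

lemma exp_near_one:
  fixes x E s :: real
  assumes "\<bar>x\<bar> \<le> E * s" "0 \<le> s" "s \<le> 1" "0 \<le> E"
  shows "\<bar>exp x - 1\<bar> \<le> E * exp E * s"
proof -
  have E: "\<bar>x\<bar> \<le> E" using assms mult_left_mono[of s 1 E] by linarith
  have "exp x - 1 \<le> E * exp E * s"
  proof -
    have "1 - x \<le> exp (- x)" using exp_ge_add_one_self[of "- x"] by simp
    then have "(1 - x) * exp x \<le> exp (- x) * exp x" by (intro mult_right_mono) auto
    then have "exp x - 1 \<le> x * exp x" by (simp add: exp_minus algebra_simps)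
    also have "\<dots> \<le> \<bar>x\<bar> * exp E" using E by (intro mult_mono) auto
    also have "\<dots> \<le> (E * s) * exp E" using assms(1) by (intro mult_right_mono) auto
    finally show ?thesis by (simp add: mult_ac)
  qed
  moreover have "1 - exp x \<le> E * exp E * s"
  proof -
    have "1 - exp x \<le> \<bar>x\<bar>" using exp_ge_add_one_self[of x] by linarith
    also have "\<dots> \<le> E * s * 1" using assms(1) by simp
    also have "\<dots> \<le> E * s * exp E" using assms by (intro mult_left_mono) auto
    finally show ?thesis by (simp add: mult_ac)
  qed
  ultimately show ?thesis by (simp add: abs_le_iff)
qed

text \<open>With u = 2 + k + l1 h, translating h by g changes ln u by O(1/u). The logarithmic
  Lipschitz bound gives the same order for the logarithm of the ratio of weights, and exponentiation
  preserves it. The error is a multiple of 1/u, which is \<alpha> of the weight itself.\<close>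

lemma weight_ratio:
  fixes g :: "int ^ 'd::finite"
  assumes \<alpha>: "concave_modulus \<alpha>" and "\<alpha> differentiable_on {0<..}"
    and "bdd_above ((\<lambda>t. \<alpha> t / (t * deriv \<alpha> t)) ` {0<..})"
  obtains B where "B \<ge> 1"
    "\<And>k h. (weight \<alpha> k h / weight \<alpha> k (h + g))\<^sup>2 \<ge> 1 / B"
    "\<And>k h. \<bar>(weight \<alpha> k h / weight \<alpha> k (h + g))\<^sup>2 - 1\<bar> \<le> B / (2 + real k + l1 h)"
proof -
  obtain C where C: "C > 0" "\<And>p q. 0 < p \<Longrightarrow> p \<le> q \<Longrightarrow>
      ln (inv_into {0..} \<alpha> q) - ln (inv_into {0..} \<alpha> p) \<le> C * (ln q - ln p)"
    using modulus_inverse_log_lipschitz[OF assms] by blast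
  have C': "\<bar>ln (inv_into {0..} \<alpha> q) - ln (inv_into {0..} \<alpha> p)\<bar> \<le> C * \<bar>ln q - ln p\<bar>"
    if "0 < p" "0 < q" for p q
  proof -
    have *: "\<bar>ln (inv_into {0..} \<alpha> q) - ln (inv_into {0..} \<alpha> p)\<bar> \<le> C * \<bar>ln q - ln p\<bar>"
      if "0 < p" "p \<le> q" for p q
    proof -
      have "ln (inv_into {0..} \<alpha> p) \<le> ln (inv_into {0..} \<alpha> q)"
        using that modulus_inverse_pos[OF \<alpha>] modulus_inverse_mono[OF \<alpha>] by simp
      moreover have "ln p \<le> ln q" using that by simp
      ultimately show ?thesis using C(2)[OF that] by simp
    qed
    show ?thesis using *[of p q] *[of q p] that by (cases "p \<le> q") (auto simp: abs_minus_commute)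
  qed
  define m where "m = l1 g"
  have m: "m \<ge> 0" using l1_nonneg by (simp add: m_def)
  define E where "E = 2 * C * (m * (m + 1))"
  have E: "E \<ge> 0" using C(1) m by (simp add: E_def)
  \<comment> \<open>Large enough for both purposes: it dominates exp E, for the lower bound on the
    squared ratio, and E exp E, for the deviation from 1. The 2 in \<open>E\<close> comes from the
    square.\<close>
  define B where "B = (E + 1) * exp E"
  have expE: "exp E \<ge> 1" using E by simp
  have B: "B \<ge> 1" "B \<ge> exp E" "B \<ge> E * exp E"
  proof -
    have "1 * exp E \<le> B" unfolding B_def using E by (intro mult_right_mono) auto
    then show "B \<ge> exp E" by simp
    with expE show "B \<ge> 1" by (rule order_trans)
    show "B \<ge> E * exp E" by (simp add: B_def distrib_right)
  qed
  have key: "1 / B \<le> (weight \<alpha> k h / weight \<alpha> k (h + g))\<^sup>2 \<and>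
     \<bar>(weight \<alpha> k h / weight \<alpha> k (h + g))\<^sup>2 - 1\<bar> \<le> B / (2 + real k + l1 h)" for k h
  proof -
    define u v where "u = 2 + real k + l1 h" and "v = 2 + real k + l1 (h + g)"
    have uv: "u \<ge> 2" "v \<ge> 2" using l1_nonneg[of h] l1_nonneg[of "h + g"] by (auto simp: u_def v_def)
    have "\<bar>u - v\<bar> \<le> m" using l1_diff[of h g] by (simp add: u_def v_def m_def)
    then have lnuv: "\<bar>ln u - ln v\<bar> \<le> m * (m + 1) / u" using uv by (intro ln_ratio_le) auto
    define x where "x = 2 * (ln (weight \<alpha> k h) - ln (weight \<alpha> k (h + g)))"
    have "\<bar>ln (weight \<alpha> k h) - ln (weight \<alpha> k (h + g))\<bar> \<le> C * \<bar>ln (1 / u) - ln (1 / v)\<bar>"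
      unfolding weight_def u_def[symmetric] v_def[symmetric] using uv by (intro C') auto
    also have "\<bar>ln (1 / u) - ln (1 / v)\<bar> = \<bar>ln u - ln v\<bar>" using uv by (simp add: ln_div)
    also have "C * \<bar>ln u - ln v\<bar> \<le> C * (m * (m + 1) / u)" using lnuv C(1) by (intro mult_left_mono) auto
    finally have x: "\<bar>x\<bar> \<le> E * (1 / u)" by (simp add: x_def E_def abs_mult)
    have r: "(weight \<alpha> k h / weight \<alpha> k (h + g))\<^sup>2 = exp x"
      using weight_pos[OF \<alpha>, of k h] weight_pos[OF \<alpha>, of k "h + g"]
      by (simp add: x_def exp_diff power_divide exp_double)
    have u1: "0 \<le> 1 / u" "1 / u \<le> 1" using uv by simp_all
    have "\<bar>exp x - 1\<bar> \<le> E * exp E * (1 / u)" by (rule exp_near_one[OF x u1 E])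
    also have "\<dots> \<le> B * (1 / u)" using B(3) u1 by (intro mult_right_mono) auto
    finally have 1: "\<bar>exp x - 1\<bar> \<le> B / u" by simp
    have "E * (1 / u) \<le> E * 1" using u1 E by (intro mult_left_mono) auto
    then have "- E \<le> x" using x by linarith
    then have "exp (- E) \<le> exp x" by simp
    moreover have "1 / B \<le> 1 / exp E" using B by (intro divide_left_mono) auto
    ultimately have "1 / B \<le> exp x" by (simp add: exp_minus inverse_eq_divide)
    with 1 show ?thesis by (simp add: r u_def)
  qed
  show ?thesis using key B(1) by (intro that[of B]) auto
qed

lemma weight_antimono:
  assumes "concave_modulus \<alpha>" "k \<le> l" shows "weight \<alpha> l h \<le> weight \<alpha> k h"
  unfolding weight_def using assms l1_nonneg[of h]
  by (intro modulus_inverse_mono divide_left_mono) auto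

lemma weight_summable:
  assumes \<alpha>: "concave_modulus \<alpha>"
    and int: "set_integrable lborel {0<..1} (\<lambda>t. inv_into {0..} \<alpha> t / t ^ (CARD('d) + 1))"
  shows "weight \<alpha> k summable_on (UNIV :: (int ^ 'd::finite) set)"
proof (rule summable_on_comparison_test)
  show "(\<lambda>h :: int ^ 'd. inv_into {0..} \<alpha> (1 / (2 + l1 h))) summable_on UNIV"
    by (rule weights_summable[OF int]) (auto intro: modulus_inverse_mono[OF \<alpha>] modulus_inverse[OF \<alpha>])
  show "weight \<alpha> k h \<le> inv_into {0..} \<alpha> (1 / (2 + l1 h))" for h :: "int ^ 'd"
    using weight_antimono[OF \<alpha>, of 0 k h] by (simp add: weight_def)
  show "0 \<le> weight \<alpha> k h" for h :: "int ^ 'd" using weight_pos[OF \<alpha>, of k h] by simp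
qed

text \<open>Dominated convergence with the weights for k = 0 as majorant: a finite set carries all
  but e/3 of their sum, and on it every weight is at most \<open>\<delta>\<close> once k is
  large.\<close>

lemma weight_mass_small:
  assumes \<alpha>: "concave_modulus \<alpha>"
    and int: "set_integrable lborel {0<..1} (\<lambda>t. inv_into {0..} \<alpha> t / t ^ (CARD('d) + 1))"
    and "e > 0"
  shows "\<exists>k0. \<forall>k\<ge>k0. infsum (weight \<alpha> k) (UNIV :: (int ^ 'd::finite) set) < e"
proof -
  let ?w = "weight \<alpha> :: nat \<Rightarrow> int ^ 'd \<Rightarrow> real"
  note summ = weight_summable[OF \<alpha> int]
  obtain F where F: "finite F" "dist (sum (?w 0) F) (infsum (?w 0) UNIV) \<le> e / 3"
    using infsum_finite_approximation[OF summ[of 0], of "e/3"] \<open>e > 0\<close> by auto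
  define \<delta> where "\<delta> = e / (3 * (real (card F) + 1))"
  have \<delta>: "\<delta> > 0" using \<open>e > 0\<close> by (simp add: \<delta>_def)
  have card\<delta>: "real (card F) * \<delta> \<le> e / 3"
    using \<open>e > 0\<close> by (simp add: \<delta>_def field_simps)
  obtain k0 :: nat where k0: "1 / \<alpha> \<delta> < real k0" using reals_Archimedean2 by blast
  have small: "?w k h \<le> \<delta>" if "k \<ge> k0" for k h
  proof -
    have ad: "\<alpha> \<delta> > 0" using concave_modulus_pos[OF \<alpha> \<delta>] .
    have "1 / \<alpha> \<delta> < 2 + real k + l1 h" using k0 that l1_nonneg[of h] by linarith
    then have "1 / (2 + real k + l1 h) < \<alpha> \<delta>"
      using ad l1_nonneg[of h] by (simp add: field_simps)
    then have "?w k h < \<delta>"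
      unfolding weight_def using modulus_inverse_less_iff[OF \<alpha>] l1_nonneg[of h] \<delta> by simp
    then show ?thesis by simp
  qed
  have "infsum (?w k) UNIV \<le> 2 * e / 3" if k: "k \<ge> k0" for k
  proof (rule infsum_le_finite_sums[OF summ])
    fix G :: "(int ^ 'd) set" assume G: "finite G"
    have "sum (?w k) G \<le> sum (?w k) (F \<union> (G - F))"
      using F G weight_pos[OF \<alpha>] by (intro sum_mono2) (auto intro: less_imp_le)
    also have "\<dots> = sum (?w k) F + sum (?w k) (G - F)"
      using F G by (intro sum.union_disjoint) auto
    also have "\<dots> \<le> real (card F) * \<delta> + sum (?w 0) (G - F)"
      using small[OF k] weight_antimono[OF \<alpha>, of 0 k]
      by (intro add_mono sum_bounded_above sum_mono) auto
    also have "sum (?w 0) (G - F) \<le> infsum (?w 0) UNIV - sum (?w 0) F"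
    proof -
      have "sum (?w 0) F + sum (?w 0) (G - F) = sum (?w 0) (F \<union> (G - F))"
        using F G by (intro sum.union_disjoint[symmetric]) auto
      also have "\<dots> \<le> infsum (?w 0) UNIV"
        using F G weight_pos[OF \<alpha>] by (intro finite_sum_le_infsum[OF summ]) (auto intro: less_imp_le)
      finally show ?thesis by simp
    qed
    finally show "sum (?w k) G \<le> 2 * e / 3"
      using F(2) card\<delta> unfolding dist_real_def by linarith
  qed
  then show ?thesis using \<open>e > 0\<close> by (intro exI[of _ k0]) (force intro: le_less_trans)
qed

text \<open>One cyclic subgroup suffices. A rational angle would have a positive multiple that is an
  integer, against injectivity; so the angle is irrational and its multiples are dense modulo
  1.\<close>

lemma multiples_dense:
  fixes \<theta> :: "int ^ 'd::finite \<Rightarrow> real"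
  assumes add: "\<And>g h. \<theta> (g + h) - \<theta> g - \<theta> h \<in> \<int>" and inj: "\<And>g. \<theta> g \<in> \<int> \<Longrightarrow> g = 0"
    and "a < b"
  shows "\<exists>g. \<exists>n\<in>\<int>. a < \<theta> g + n \<and> \<theta> g + n < b"
proof -
  \<comment> \<open>The all-ones vector is nonzero in every dimension, and its n-th multiple is
    simply \<open>vec n\<close>.\<close>
  define e :: "int ^ 'd" where "e = vec 1"
  define t where "t = \<theta> e"
  have mult: "\<theta> (vec (int n)) - real n * t \<in> \<int>" for n
  proof (induction n)
    case 0
    then show ?case using Ints_minus[OF add[of 0 0]] by (simp add: vec_0)
  next
    case (Suc n)
    have "vec (int (Suc n)) = vec (int n) + e" by (simp add: e_def vec_eq_iff)
    then have "\<theta> (vec (int (Suc n))) - real (Suc n) * t =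
        (\<theta> (vec (int n) + e) - \<theta> (vec (int n)) - \<theta> e) + (\<theta> (vec (int n)) - real n * t)"
      by (simp add: t_def algebra_simps)
    then show ?case using Ints_add[OF add[of "vec (int n)" e] Suc] by simp
  qed
  have "t \<notin> \<rat>"
  proof
    assume "t \<in> \<rat>"
    then obtain p q where pq: "t = of_int p / of_int q" "q > 0" by (metis Rats_cases')
    have "real (nat q) * t = of_int p" using pq by simp
    then have "\<theta> (vec (int (nat q))) \<in> \<int>"
      using Ints_add[OF mult[of "nat q"], of "of_int p"] by simp
    then have "vec (int (nat q)) = (0 :: int ^ 'd)" by (rule inj)
    then show False using pq(2) by (simp add: vec_eq_iff)
  qed
  moreover have "(b - a) / 2 > 0" using \<open>a < b\<close> by simp
  ultimately obtain h k where k: "k > 0" "\<bar>of_int k * t - of_int h - (a + b) / 2\<bar> < (b - a) / 2"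
    by (rule sequence_of_fractional_parts_is_dense)
  define n where "n = - (\<theta> (vec k) - of_int k * t) - of_int h"
  have "\<theta> (vec k) - of_int k * t \<in> \<int>" using mult[of "nat k"] k(1) by simp
  then have "n \<in> \<int>" unfolding n_def by (rule Ints_diff[OF Ints_minus Ints_of_int])
  moreover have "\<theta> (vec k) + n = of_int k * t - of_int h" by (simp add: n_def)
  moreover have "a < of_int k * t - of_int h" "of_int k * t - of_int h < b"
    using k(2) unfolding abs_less_iff by argo+
  ultimately show ?thesis by (intro exI[of _ "vec k"] bexI[of _ n]) simp_all
qed

section \<open>Cantor sets in the line\<close>

text \<open>On the line empty interior amounts to total disconnectedness, so these are the
  hypotheses of Brouwer's characterisation of the Cantor set.\<close>

definition cantorian :: "real set \<Rightarrow> bool"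
  where "cantorian S \<longleftrightarrow> compact S \<and> S \<noteq> {} \<and> (\<forall>x\<in>S. x islimpt S) \<and> interior S = {}"

text \<open>The two descriptions by \<open>U\<close> and \<open>U'\<close> make the half relatively
  clopen: the closed one gives compactness, the open one preserves limit points.\<close>

lemma cantorian_half:
  assumes "cantorian S" "open U" "closed U'" "S \<inter> U = S \<inter> U'" "S \<inter> U \<noteq> {}"
  shows "cantorian (S \<inter> U)"
  unfolding cantorian_def
proof (intro conjI ballI)
  show "compact (S \<inter> U)" using compact_Int_closed[of S U'] assms(1,3,4) by (simp add: cantorian_def)
  show "interior (S \<inter> U) = {}"
    using assms(1) interior_mono[of "S \<inter> U" S] by (auto simp: cantorian_def)
  show "x islimpt (S \<inter> U)" if "x \<in> S \<inter> U" for x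
    unfolding islimpt_def
  proof (intro allI impI)
    fix V assume "x \<in> V" "open V"
    then have "x \<in> V \<inter> U" "open (V \<inter> U)" using that assms(2) by auto
    moreover have "x islimpt S" using that assms(1) by (auto simp: cantorian_def)
    ultimately show "\<exists>y\<in>S \<inter> U. y \<in> V \<and> y \<noteq> x" unfolding islimpt_def by blast
  qed
qed (fact assms(5))

definition splits :: "real \<Rightarrow> real set \<Rightarrow> bool"
  where "splits t S \<longleftrightarrow> t \<notin> S \<and> cantorian (S \<inter> {..<t}) \<and> cantorian (S \<inter> {t<..}) \<and>
    (\<forall>x\<in>S. \<forall>y\<in>S. (x < t \<longleftrightarrow> y < t) \<longrightarrow> \<bar>x - y\<bar> \<le> 2/3 * diameter S)"

text \<open>Empty interior provides a missing point in the middle third between the extreme points;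
  each side of it then spans at most two thirds of the diameter.\<close>

lemma ex_splits:
  assumes S: "cantorian S"
  shows "\<exists>t. splits t S"
proof -
  have cS: "compact S" and ne: "S \<noteq> {}" using S by (auto simp: cantorian_def)
  obtain l where l: "l \<in> S" "\<And>x. x \<in> S \<Longrightarrow> l \<le> x" using compact_attains_inf[OF cS ne] by blast
  obtain u where u: "u \<in> S" "\<And>x. x \<in> S \<Longrightarrow> x \<le> u" using compact_attains_sup[OF cS ne] by blast
  have "l islimpt S" using S l by (auto simp: cantorian_def)
  then obtain z where "z \<in> S" "z \<noteq> l" unfolding islimpt_def by (metis UNIV_I open_UNIV)
  then have lu: "l < u" using l u by (meson le_less_trans not_le order.antisym)
  have diam: "u - l \<le> diameter S"
    using diameter_bounded_bound[OF compact_imp_bounded[OF cS] u(1) l(1)] lu by (simp add: dist_real_def)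
  define a b where "a = l + (u - l) / 3" and "b = u - (u - l) / 3"
  have "\<not> {a<..<b} \<subseteq> S"
  proof
    assume "{a<..<b} \<subseteq> S"
    then have "{a<..<b} \<subseteq> interior S" by (simp add: interior_maximal)
    then have "{a<..<b} = {}" using S by (simp add: cantorian_def)
    moreover have "(a + b) / 2 \<in> {a<..<b}" using lu by (simp add: a_def b_def field_simps)
    ultimately show False by blast
  qed
  then obtain t where t: "a < t" "t < b" "t \<notin> S" by (meson greaterThanLessThan_iff subsetI)
  have "l < a" "b < u" using lu by (simp_all add: a_def b_def)
  then have lt: "l < t" "t < u" using t by simp_all
  have "cantorian (S \<inter> {..<t})"
    by (rule cantorian_half[OF S, of _ "{..t}"]) (use t lt l(1) in \<open>auto simp: order_le_less\<close>)
  moreover have "cantorian (S \<inter> {t<..})"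
    by (rule cantorian_half[OF S, of _ "{t..}"]) (use t lt u(1) in \<open>auto simp: order_le_less\<close>)
  moreover have "\<bar>x - y\<bar> \<le> 2/3 * diameter S" if "x \<in> S" "y \<in> S" "x < t \<longleftrightarrow> y < t" for x y
  proof -
    have "\<bar>x - y\<bar> \<le> 2/3 * (u - l)"
      using l(2)[OF that(1)] l(2)[OF that(2)] u(2)[OF that(1)] u(2)[OF that(2)] t that(3)
      unfolding a_def b_def by argo
    also have "\<dots> \<le> 2/3 * diameter S" using diam by simp
    finally show ?thesis .
  qed
  ultimately show ?thesis using t by (auto simp: splits_def)
qed

definition split_pt :: "real set \<Rightarrow> real" where "split_pt S = (SOME t. splits t S)"

lemma splits_split_pt: "cantorian S \<Longrightarrow> splits (split_pt S) S"
  unfolding split_pt_def by (rule someI_ex[OF ex_splits])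

text \<open>A binary tree of relatively clopen pieces; the sequence is an itinerary, with True
  standing for the right half.\<close>

fun piece :: "real set \<Rightarrow> (nat \<Rightarrow> bool) \<Rightarrow> nat \<Rightarrow> real set" where
  "piece S f 0 = S"
| "piece S f (Suc n) = piece S f n \<inter>
    (if f n then {split_pt (piece S f n)<..} else {..<split_pt (piece S f n)})"

lemma cantorian_piece: "cantorian S \<Longrightarrow> cantorian (piece S f n)"
proof (induction n)
  case (Suc n)
  then show ?case using splits_split_pt[of "piece S f n"] by (auto simp: splits_def)
qed simp

lemma piece_Suc_subset: "piece S f (Suc n) \<subseteq> piece S f n"
  by auto

lemma piece_subset: "piece S f n \<subseteq> S"
  by (induction n) auto

lemma piece_antimono: "m \<le> n \<Longrightarrow> piece S f n \<subseteq> piece S f m"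
  using lift_Suc_antimono_le[of "piece S f" m n] piece_Suc_subset by blast

lemma piece_cong: "(\<And>i. i < n \<Longrightarrow> f i = g i) \<Longrightarrow> piece S f n = piece S g n"
  by (induction n) auto

lemma diameter_piece:
  assumes S: "cantorian S"
  shows "diameter (piece S f n) \<le> (2/3)^n * diameter S"
proof (induction n)
  case (Suc n)
  define X where "X = piece S f n"
  have X: "splits (split_pt X) X" unfolding X_def by (intro splits_split_pt cantorian_piece S)
  have "cantorian X" using X_def S cantorian_piece by blast
  then have "diameter X \<ge> 0"
    by (simp add: cantorian_def compact_imp_bounded diameter_ge_0)
  then have "diameter (piece S f (Suc n)) \<le> 2/3 * diameter X"
    using X by (intro diameter_le) (auto simp: splits_def X_def[symmetric] split: if_splits)
  also have "\<dots> \<le> 2/3 * ((2/3)^n * diameter S)" using Suc by (simp add: X_def)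
  finally show ?case by simp
qed simp

lemma piece_eq_imp_eq:
  assumes S: "cantorian S" and "\<And>n. x \<in> piece S f n" "\<And>n. y \<in> piece S f n"
  shows "x = y"
proof -
  have "\<bar>x - y\<bar> \<le> (2/3)^n * diameter S" for n
  proof -
    have "bounded (piece S f n)" using cantorian_piece[OF S] by (simp add: cantorian_def compact_imp_bounded)
    from diameter_bounded_bound[OF this assms(2,3)] diameter_piece[OF S, of f n]
    show ?thesis by (simp add: dist_real_def)
  qed
  moreover have "(\<lambda>n. (2/3::real)^n * diameter S) \<longlonglongrightarrow> 0 * diameter S"
    by (intro tendsto_mult tendsto_const LIMSEQ_realpow_zero) auto
  ultimately have "\<bar>x - y\<bar> \<le> 0 * diameter S"
    by (intro LIMSEQ_le_const) auto
  then show ?thesis by simp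
qed

definition branch_pt :: "real set \<Rightarrow> (nat \<Rightarrow> bool) \<Rightarrow> real"
  where "branch_pt S f = (SOME x. \<forall>n. x \<in> piece S f n)"

lemma branch_pt:
  assumes S: "cantorian S"
  shows "branch_pt S f \<in> piece S f n"
proof -
  have "(\<Inter>n. piece S f n) \<noteq> {}"
    using compact_nest[of "piece S f"] cantorian_piece[OF S] piece_antimono[of _ _ S f]
    by (simp add: cantorian_def)
  then have "\<exists>x. \<forall>n. x \<in> piece S f n" by auto
  from someI_ex[OF this] show ?thesis by (simp add: branch_pt_def)
qed

text \<open>Points and itineraries correspond bijectively, since the two halves of a piece are
  disjoint and diameters shrink like (2/3)^n. Cylinder sets are open, which makes
  \<open>branch_pt\<close> continuous; pieces are relatively open in \<open>S\<close>, which makes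
  the coding continuous.\<close>

lemma cantorian_homeomorphic:
  assumes S: "cantorian S"
  shows "S homeomorphic (UNIV :: (nat \<Rightarrow> bool) set)"
proof -
  have inj: "f = g" if "x \<in> S" and x: "\<And>n. x \<in> piece S f n" "\<And>n. x \<in> piece S g n" for x f g
  proof (rule ccontr)
    assume "f \<noteq> g"
    then have ex: "\<exists>n. f n \<noteq> g n" by (simp add: fun_eq_iff)
    define n where "n = (LEAST n. f n \<noteq> g n)"
    have n: "f n \<noteq> g n" "\<And>i. i < n \<Longrightarrow> f i = g i"
      unfolding n_def using LeastI_ex[OF ex] not_less_Least by blast+
    then have "piece S f n = piece S g n" by (intro piece_cong) auto
    then show False using x[of "Suc n"] n(1) by (auto split: if_splits)
  qed
  have surj: "\<exists>f. \<forall>n. x \<in> piece S f n" if "x \<in> S" for x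
  proof -
    \<comment> \<open>\<open>X\<close> tracks the piece around x by asking x itself which side to
      take. This avoids a circular definition, because \<open>piece\<close> needs the whole
      itinerary as an argument.\<close>
    define X where "X = rec_nat S (\<lambda>n A. A \<inter> (if x > split_pt A then {split_pt A<..} else {..<split_pt A}))"
    define f where "f = (\<lambda>n. x > split_pt (X n))"
    have f: "f n \<longleftrightarrow> x > split_pt (X n)" for n by (simp add: f_def)
    have X: "X n = piece S f n" for n
    proof (induction n)
      case (Suc n)
      have "X (Suc n) = X n \<inter> (if f n then {split_pt (X n)<..} else {..<split_pt (X n)})"
        by (simp add: X_def f)
      then show ?case using Suc by simp
    qed (simp add: X_def)
    have "x \<in> piece S f n" for n
    proof (induction n)
      case (Suc n)
      then have "x \<noteq> split_pt (piece S f n)"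
        using splits_split_pt[OF cantorian_piece[OF S, of f n]] by (auto simp: splits_def)
      then show ?case using Suc f[of n] X[of n] by (auto split: if_splits)
    qed (use that in simp)
    then show ?thesis by blast
  qed
  have "bij_betw (branch_pt S) UNIV S"
    unfolding bij_betw_def
  proof
    show "inj (branch_pt S)"
    proof (rule injI)
      fix f g assume eq: "branch_pt S f = branch_pt S g"
      have "branch_pt S f \<in> S" using branch_pt[OF S, of f 0] by simp
      then show "f = g" using branch_pt[OF S, of f] branch_pt[OF S, of g] unfolding eq by (rule inj)
    qed
    show "range (branch_pt S) = S"
    proof (intro equalityI subsetI)
      fix x assume "x \<in> S"
      then obtain f where "\<And>n. x \<in> piece S f n" using surj by blast
      then have "x = branch_pt S f" by (rule piece_eq_imp_eq[OF S]) (rule branch_pt[OF S])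
      then show "x \<in> range (branch_pt S)" by blast
    qed (use branch_pt[OF S, of _ 0] in auto)
  qed
  then have bij: "range (branch_pt S) = S" and injb: "inj (branch_pt S)"
    by (auto simp: bij_betw_def)
  define code where "code = inv (branch_pt S)"
  have code: "branch_pt S (code x) = x" if "x \<in> S" for x
    using that bij by (simp add: code_def f_inv_into_f)
  have code': "code (branch_pt S f) = f" for f by (simp add: code_def injb)
  have mem: "x \<in> piece S (code x) n" if "x \<in> S" for x n
    using branch_pt[OF S, of "code x" n] code[OF that] by simp
  have "continuous_on UNIV (branch_pt S)"
    unfolding continuous_on_def
  proof (intro ballI tendstoI)
    fix f :: "nat \<Rightarrow> bool" and e :: real assume "e > 0"
    have "(\<lambda>n. (2/3::real)^n * diameter S) \<longlonglongrightarrow> 0 * diameter S"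
      by (intro tendsto_mult tendsto_const LIMSEQ_realpow_zero) auto
    then have "eventually (\<lambda>n. (2/3::real)^n * diameter S < e) sequentially"
      using \<open>e > 0\<close> by (intro order_tendstoD) auto
    then obtain n where n: "(2/3::real)^n * diameter S < e" by (auto simp: eventually_sequentially)
    have "open {g. \<forall>i\<in>{..<n}. g i = f i}"
    proof -
      have "finite {i. {b. i < n \<longrightarrow> b = f i} \<noteq> UNIV}"
        by (rule finite_subset[of _ "{..<n}"]) auto
      then have "open (PiE UNIV (\<lambda>i. {b. i < n \<longrightarrow> b = f i}))"
        by (intro open_PiE open_discrete) simp
      moreover have "PiE UNIV (\<lambda>i. {b. i < n \<longrightarrow> b = f i}) = {g. \<forall>i\<in>{..<n}. g i = f i}"
        by (simp add: set_eq_iff PiE_UNIV_domain Pi_iff Ball_def)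
      ultimately show ?thesis by simp
    qed
    moreover have "dist (branch_pt S g) (branch_pt S f) < e" if "\<forall>i\<in>{..<n}. g i = f i" for g
    proof -
      have "piece S g n = piece S f n" using that by (intro piece_cong) auto
      then have "branch_pt S g \<in> piece S f n" using branch_pt[OF S, of g n] by simp
      moreover have "bounded (piece S f n)"
        using cantorian_piece[OF S] by (simp add: cantorian_def compact_imp_bounded)
      ultimately have "dist (branch_pt S g) (branch_pt S f) \<le> diameter (piece S f n)"
        using diameter_bounded_bound branch_pt[OF S] by blast
      with diameter_piece[OF S, of f n] n show ?thesis by linarith
    qed
    ultimately show "eventually (\<lambda>g. dist (branch_pt S g) (branch_pt S f) < e) (at f within UNIV)"
      unfolding eventually_at_topological
      by (intro exI[of _ "{g. \<forall>i\<in>{..<n}. g i = f i}"]) auto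
  qed
  moreover have "continuous_on S code"
  proof (intro continuous_on_coordinatewise_then_product)
    fix n
    show "continuous_on S (\<lambda>x. code x n)"
      unfolding continuous_on_def
    proof (intro ballI)
      fix x assume x: "x \<in> S"
      have op: "\<exists>V. open V \<and> S \<inter> V = piece S f m" for f m
      proof (induction m)
        case (Suc m)
        then obtain V where "open V" "S \<inter> V = piece S f m" by blast
        then show ?case
          by (intro exI[of _ "V \<inter> (if f m then {split_pt (piece S f m)<..} else {..<split_pt (piece S f m)})"]) auto
      qed (use open_UNIV in auto)
      obtain V where V: "open V" "S \<inter> V = piece S (code x) (Suc n)" using op by blast
      \<comment> \<open>A piece of level n + 1 determines the first n + 1 digits of all its points,
        by induction: once the earlier digits agree, both itineraries are split at the same
        point.\<close>
      have same: "code y i = code x i" if "i \<le> n" "y \<in> piece S (code x) (Suc n)" for y i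
        using that(1)
      proof (induction i rule: less_induct)
        case (less i)
        have yS: "y \<in> S" using that piece_subset by blast
        have "piece S (code y) i = piece S (code x) i" using less by (intro piece_cong) auto
        moreover have "y \<in> piece S (code x) (Suc i)"
          using piece_antimono[of "Suc i" "Suc n" S "code x"] less(2) that(2) by auto
        ultimately show ?case using mem[OF yS, of "Suc i"] by (auto split: if_splits)
      qed
      show "((\<lambda>x. code x n) \<longlongrightarrow> code x n) (at x within S)"
      proof (rule tendsto_eventually)
        show "\<forall>\<^sub>F y in at x within S. code y n = code x n"
          unfolding eventually_at_topological
          using V mem[OF x, of "Suc n"] same[of n] x by (intro exI[of _ V]) blast
      qed
    qed
  qed
  ultimately show ?thesis
    unfolding homeomorphic_def homeomorphism_def
  proof (intro exI[of _ code] exI[of _ "branch_pt S"] conjI)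
    show "code ` S = UNIV"
    proof (intro equalityI subsetI)
      fix f :: "nat \<Rightarrow> bool"
      show "f \<in> code ` S" using code'[of f] bij by (metis image_eqI rangeI)
    qed simp
  qed (simp_all add: code code' bij)
qed

section \<open>Circle maps and their lifts\<close>

definition circle_map :: "(real \<Rightarrow> real) \<Rightarrow> circle \<Rightarrow> circle"
  where "circle_map F p = abs_circle (F (rep_circle p))"

definition degree_one :: "(real \<Rightarrow> real) \<Rightarrow> bool"
  where "degree_one F \<longleftrightarrow> (\<forall>x. \<forall>n\<in>\<int>. F (x + n) = F x + n)"

lemma degree_oneD: "degree_one F \<Longrightarrow> n \<in> \<int> \<Longrightarrow> F (x + n) = F x + n"
  by (simp add: degree_one_def)

lemma degree_oneI:
  assumes "\<And>x. F (x + 1) = F x + 1" shows "degree_one F"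
proof -
  have nat: "F (x + real n) = F x + real n" for x n
  proof (induction n)
    case (Suc n)
    have "F (x + real (Suc n)) = F ((x + real n) + 1)" by (simp add: algebra_simps)
    then show ?case by (simp add: assms Suc)
  qed simp
  show ?thesis unfolding degree_one_def
  proof (intro allI ballI)
    fix x n :: real assume "n \<in> \<int>"
    then obtain k where k: "n = of_int k" by (rule Ints_cases)
    show "F (x + n) = F x + n"
    proof (cases "k \<ge> 0")
      case True
      then show ?thesis using nat[of x "nat k"] k by simp
    next
      case False
      then show ?thesis using nat[of "x + n" "nat (- k)"] k by simp
    qed
  qed
qed

lemma abs_rep_circle [simp]: "abs_circle (rep_circle p) = p"
  by (rule Quotient_abs_rep[OF Quotient_circle])

lemma abs_circle_add_Ints: "n \<in> \<int> \<Longrightarrow> abs_circle (x + n) = abs_circle x"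
  by (simp add: abs_circle_eq_iff)

lemma circle_map_abs:
  assumes "degree_one F" shows "circle_map F (abs_circle x) = abs_circle (F x)"
proof -
  define n where "n = rep_circle (abs_circle x) - x"
  have n: "n \<in> \<int>" unfolding n_def using abs_circle_eq_iff[of "rep_circle (abs_circle x)" x] by simp
  have "rep_circle (abs_circle x) = x + n" by (simp add: n_def)
  then show ?thesis using n by (simp add: circle_map_def degree_oneD[OF assms] abs_circle_add_Ints)
qed

lemma circle_map_comp:
  assumes "degree_one F"
  shows "circle_map F \<circ> circle_map G = circle_map (\<lambda>x. F (G x))"
proof
  fix p
  have "circle_map F (abs_circle (G (rep_circle p))) = abs_circle (F (G (rep_circle p)))"
    by (rule circle_map_abs[OF assms])
  then show "(circle_map F \<circ> circle_map G) p = circle_map (\<lambda>x. F (G x)) p"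
    by (simp add: circle_map_def[of G] circle_map_def[of "\<lambda>x. F (G x)"])
qed

lemma circle_map_ident: "(\<And>x. F x = x) \<Longrightarrow> circle_map F = id"
  by (simp add: circle_map_def fun_eq_iff)

lemma circle_eqI:
  assumes "\<And>x. f (abs_circle x) = g (abs_circle x)" shows "f = g"
proof
  fix p show "f p = g p" using assms[of "rep_circle p"] by simp
qed

lemma circle_map_unique:
  assumes "lift_of F f" "degree_one F" shows "circle_map F = f"
  by (rule circle_eqI) (use assms in \<open>simp add: lift_of_def circle_map_abs\<close>)

lemma lift_of_circle_map:
  assumes "continuous_on UNIV F" "degree_one F" shows "lift_of F (circle_map F)"
  using assms by (simp add: lift_of_def circle_map_abs)

lemma dist_abs_circle: "dist (abs_circle x) (abs_circle y) = infdist (x - y) \<int>"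
  by (rule dist_circle.abs_eq)

lemma dist_abs_circle_le: "dist (abs_circle x) (abs_circle y) \<le> \<bar>x - y\<bar>"
  using infdist_le[of 0 "\<int>" "x - y"] by (simp add: dist_abs_circle)

text \<open>The distance to the closed set of integers is attained. Estimates for lifts in terms of
  |x - y| thereby become estimates on the circle.\<close>

lemma circle_reps_dist:
  obtains x y where "p = abs_circle x" "q = abs_circle y" "\<bar>x - y\<bar> = dist p q"
proof -
  define x y where "x = rep_circle p" and "y = rep_circle q"
  have "closed (\<int> :: real set)" "(\<int> :: real set) \<noteq> {}" by (simp, use Ints_0 in blast)
  then obtain n where n: "n \<in> \<int>" "infdist (x - y) \<int> = dist (x - y) n"
    using infdist_attains_inf[of "\<int>" "x - y"] by auto
  have "\<bar>x - (y + n)\<bar> = dist (abs_circle x) (abs_circle y)"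
    using n(2) by (simp add: dist_abs_circle dist_real_def algebra_simps)
  then show ?thesis
    using n(1) by (intro that[of x "y + n"]) (simp_all add: abs_circle_add_Ints x_def y_def)
qed

lemma continuous_abs_circle: "continuous_on A abs_circle"
proof (rule lipschitz_on_continuous_on[of 1])
  show "1-lipschitz_on A abs_circle"
    by (intro lipschitz_onI) (auto simp: dist_abs_circle_le dist_real_def)
qed

lemma shift_to_unit:
  fixes x t :: real obtains n where "n \<in> \<int>" "t \<le> x + n" "x + n < t + 1"
proof -
  show ?thesis
    by (rule that[of "- of_int \<lfloor>x - t\<rfloor>"]) (simp_all, linarith+)
qed

lemma periodic_bounded:
  fixes f :: "real \<Rightarrow> real"
  assumes "continuous_on UNIV f" and per: "\<And>x n. n \<in> \<int> \<Longrightarrow> f (x + n) = f x"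
  obtains m M where "m \<in> range f" "M \<in> range f" "\<And>x. m \<le> f x" "\<And>x. f x \<le> M"
proof -
  have c: "continuous_on {0..1} f" using assms(1) continuous_on_subset by blast
  obtain a where a: "a \<in> {0..1}" "\<And>y. y \<in> {0..1} \<Longrightarrow> f a \<le> f y"
    using continuous_attains_inf[OF compact_Icc _ c] by auto
  obtain b where b: "b \<in> {0..1}" "\<And>y. y \<in> {0..1} \<Longrightarrow> f y \<le> f b"
    using continuous_attains_sup[OF compact_Icc _ c] by auto
  have "f a \<le> f x \<and> f x \<le> f b" for x
  proof -
    obtain n where n: "n \<in> \<int>" "0 \<le> x + n" "x + n < 0 + 1" by (rule shift_to_unit)
    then show ?thesis using a(2)[of "x + n"] b(2)[of "x + n"] per[OF n(1), of x] by simp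
  qed
  then show ?thesis by (intro that[of "f a" "f b"]) auto
qed

lemma periodic_uniformly_continuous:
  fixes f :: "real \<Rightarrow> real"
  assumes "continuous_on UNIV f" and per: "\<And>x n. n \<in> \<int> \<Longrightarrow> f (x + n) = f x" and "e > 0"
  obtains d where "d > 0" "\<And>x y. \<bar>x - y\<bar> < d \<Longrightarrow> \<bar>f x - f y\<bar> < e"
proof -
  have "continuous_on {-1..2} f" using assms(1) continuous_on_subset by blast
  then have "uniformly_continuous_on {-1..2} f" by (rule compact_uniformly_continuous) simp
  then obtain d where d: "d > 0"
    "\<And>x y. x \<in> {-1..2} \<Longrightarrow> y \<in> {-1..2} \<Longrightarrow> dist y x < d \<Longrightarrow> dist (f y) (f x) < e"
    using \<open>e > 0\<close> unfolding uniformly_continuous_on_def by blast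
  have "\<bar>f x - f y\<bar> < e" if "\<bar>x - y\<bar> < min d 1" for x y
  proof -
    obtain n where n: "n \<in> \<int>" "0 \<le> x + n" "x + n < 0 + 1" by (rule shift_to_unit)
    have "\<bar>f (x + n) - f (y + n)\<bar> < e"
      using d(2)[of "y + n" "x + n"] n that by (auto simp: dist_real_def abs_less_iff)
    then show ?thesis by (simp add: per[OF n(1)])
  qed
  then show ?thesis using d(1) by (intro that[of "min d 1"]) auto
qed

text \<open>Surjectivity needs the intermediate value theorem on one period only, after an integer
  shift of the target value; a positive derivative gives injectivity.\<close>

lemma degree_one_inverse:
  assumes deg: "degree_one F" and D: "\<And>x. (F has_real_derivative f x) (at x)" and pos: "\<And>x. f x > 0"
  obtains G where "\<And>x. F (G x) = x" "\<And>x. G (F x) = x"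
proof -
  have inc: "F x < F y" if "x < y" for x y
    using DERIV_pos_imp_increasing[OF that, of F] D pos by blast
  have "\<exists>x. F x = y" for y
  proof -
    obtain n where n: "n \<in> \<int>" "F 0 \<le> y + n" "y + n < F 0 + 1" by (rule shift_to_unit)
    have "F (0 + 1) = F 0 + 1" by (rule degree_oneD[OF deg]) simp
    then have F1: "F 1 = F 0 + 1" by simp
    have "\<exists>x\<ge>0. x \<le> 1 \<and> F x = y + n"
      using n F1 D by (intro IVT) (auto intro: DERIV_isCont)
    then obtain x where "F x = y + n" by blast
    then have "F (x + - n) = y" using degree_oneD[OF deg Ints_minus[OF n(1)], of x] by simp
    then show ?thesis by blast
  qed
  then have "\<exists>G. \<forall>y. F (G y) = y" by (intro choice allI)
  then obtain G where G: "\<And>y. F (G y) = y" by blast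
  moreover have "G (F x) = x" for x
    using inc[of "G (F x)" x] inc[of x "G (F x)"] G[of "F x"] by (cases "G (F x)" x rule: linorder_cases) auto
  ultimately show ?thesis by (rule that)
qed

lemma inverse_deriv:
  assumes D: "\<And>x. (F has_real_derivative f x) (at x)" and pos: "\<And>x. f x > 0"
    and FG: "\<And>x. F (G x) = x" and GF: "\<And>x. G (F x) = x"
  shows "(G has_real_derivative inverse (f (G x))) (at x)"
proof -
  have "isCont G (F (G x))"
    by (rule isCont_inverse_function[of 1]) (simp_all add: GF DERIV_isCont[OF D])
  then have "isCont G x" by (simp add: FG)
  moreover have "f (G x) \<noteq> 0" using pos[of "G x"] by simp
  ultimately show ?thesis
    by (intro DERIV_inverse_function[OF D, of G x "x - 1" "x + 1"]) (simp_all add: FG)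
qed

lemma degree_one_inverse_degree:
  assumes "degree_one F" and FG: "\<And>x. F (G x) = x" and GF: "\<And>x. G (F x) = x"
  shows "degree_one G"
  unfolding degree_one_def
proof (intro allI ballI)
  fix x n :: real assume n: "n \<in> \<int>"
  have "F (G x + n) = x + n" using degree_oneD[OF assms(1) n] FG by simp
  then show "G (x + n) = G x + n" using GF[of "G x + n"] by simp
qed

lemma C1I:
  assumes "\<And>x. (F has_real_derivative f x) (at x)" "continuous_on UNIV f"
  shows "F C1_differentiable_on UNIV"
  unfolding C1_differentiable_on_def
  using assms by (auto simp: has_real_derivative_iff_has_vector_derivative)

lemma deriv_continuous_on:
  "(\<And>x. (F has_real_derivative f x) (at x)) \<Longrightarrow> continuous_on A F"
  by (meson DERIV_isCont continuous_at_imp_continuous_on)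

lemma Diff1_circle_map:
  assumes deg: "degree_one F" and D: "\<And>x. (F has_real_derivative f x) (at x)"
    and cont: "continuous_on UNIV f" and pos: "\<And>x. f x > 0"
  shows "circle_map F \<in> Diff1" and "circle_deriv (circle_map F) (abs_circle x) = f x"
proof -
  obtain G where FG: "\<And>x. F (G x) = x" and GF: "\<And>x. G (F x) = x"
    using degree_one_inverse[OF deg D pos] by blast
  have degG: "degree_one G" by (rule degree_one_inverse_degree[OF deg FG GF])
  have DG: "(G has_real_derivative inverse (f (G x))) (at x)" for x
    by (rule inverse_deriv[OF D pos FG GF])
  have lF: "lift_of F (circle_map F)" by (rule lift_of_circle_map[OF deriv_continuous_on[OF D] deg])
  have lG: "lift_of G (circle_map G)" by (rule lift_of_circle_map[OF deriv_continuous_on[OF DG] degG])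
  have 1: "circle_map F \<circ> circle_map G = id" "circle_map G \<circ> circle_map F = id"
    unfolding circle_map_comp[OF deg] circle_map_comp[OF degG] by (rule circle_map_ident; simp add: FG GF)+
  have bij: "bij (circle_map F)" using 1 o_bij by blast
  have inv: "inv (circle_map F) = circle_map G" by (rule inv_unique_comp[OF 1])
  have deriv: "circle_deriv (circle_map F) (abs_circle x) = f x" for x
    by (rule circle_deriv_lift[OF lF D])
  have fG: "continuous_on UNIV (\<lambda>x. inverse (f (G x)))"
  proof (intro continuous_intros ballI)
    show "continuous_on UNIV (\<lambda>x. f (G x))"
      by (rule continuous_on_compose2[OF cont deriv_continuous_on[OF DG]]) simp
    show "f (G x) \<noteq> 0" for x using pos[of "G x"] by simp
  qed
  have "circle_deriv (circle_map F) p > 0" for p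
    using deriv[of "rep_circle p"] pos by simp
  moreover have "C1_circle (circle_map F)" unfolding C1_circle_def using lF C1I[OF D cont] by blast
  moreover have "C1_circle (circle_map G)" unfolding C1_circle_def using lG C1I[OF DG fG] by blast
  ultimately show "circle_map F \<in> Diff1" unfolding Diff1_def using bij inv by simp
  show "circle_deriv (circle_map F) (abs_circle x) = f x" by (rule deriv)
qed

text \<open>The increment of an increasing lift over a period is an integer, at least 1. Hence H x +
  1 is attained at some y in (x, x + 1]; injectivity on the circle makes y - x a nonzero integer, so
  y = x + 1 and the increment is exactly 1.\<close>

lemma Diff1_lift:
  assumes h: "h \<in> Diff1"
  obtains H H' where "degree_one H" "\<And>x. (H has_real_derivative H' x) (at x)"
    "continuous_on UNIV H'" "\<And>x. H' x > 0" "circle_map H = h"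
proof -
  have "C1_circle h" and inj: "inj h" and dpos: "\<And>p. circle_deriv h p > 0"
    using h by (auto simp: Diff1_def bij_is_inj)
  then obtain H where lift: "lift_of H h" and "H C1_differentiable_on UNIV" by (auto simp: C1_circle_def)
  then obtain H' where D: "\<And>x. (H has_real_derivative H' x) (at x)" and cont: "continuous_on UNIV H'"
    unfolding C1_differentiable_on_def has_real_derivative_iff_has_vector_derivative by auto
  have pos: "H' x > 0" for x
    using circle_deriv_lift[OF lift D, of x] dpos[of "abs_circle x"] by simp
  have inc: "H x < H y" if "x < y" for x y
    using DERIV_pos_imp_increasing[OF that, of H] D pos by blast
  have habs: "h (abs_circle x) = abs_circle (H x)" for x using lift by (simp add: lift_of_def)
  have step: "H (x + 1) = H x + 1" for x
  proof -
    have "abs_circle (H (x + 1)) = abs_circle (H x)"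
      using abs_circle_add_Ints[of 1 x] by (simp add: habs[symmetric])
    then have "H (x + 1) - H x \<in> \<int>" by (simp add: abs_circle_eq_iff)
    moreover have "H (x + 1) - H x > 0" using inc[of x "x + 1"] by simp
    ultimately have ge: "H x + 1 \<le> H (x + 1)"
      using Ints_nonzero_abs_ge1[of "H (x + 1) - H x"] by simp
    have "\<exists>y\<ge>x. y \<le> x + 1 \<and> H y = H x + 1"
      using ge D by (intro IVT) (auto intro: DERIV_isCont)
    then obtain y where y: "x \<le> y" "y \<le> x + 1" "H y = H x + 1" by blast
    have "abs_circle (H y) = abs_circle (H x)" unfolding y(3) by (rule abs_circle_add_Ints) simp
    then have "abs_circle y = abs_circle x" using inj by (simp add: habs[symmetric] inj_eq)
    then have "y - x \<in> \<int>" by (simp add: abs_circle_eq_iff)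
    moreover have "y \<noteq> x" using y(3) by auto
    ultimately have "\<bar>y - x\<bar> \<ge> 1" by (intro Ints_nonzero_abs_ge1) auto
    then have "y = x + 1" using y by simp
    then show ?thesis using y(3) by simp
  qed
  have deg: "degree_one H" by (rule degree_oneI) (rule step)
  show ?thesis by (rule that[OF deg D cont pos circle_map_unique[OF lift deg]])
qed

text \<open>Cutting the circle at a point outside the periodic set \<open>C\<close> leaves a compact
  subset of an open interval of length 1, on which the projection is injective; there the criterion
  on the line applies. Minimality is checked on preimages under the projection.\<close>

lemma exceptional_circle_map:
  fixes F :: "'g \<Rightarrow> real \<Rightarrow> real"
  assumes deg: "\<And>g. degree_one (F g)"
    and C: "closed C" "C \<noteq> {}" "\<And>y n. y \<in> C \<Longrightarrow> n \<in> \<int> \<Longrightarrow> y + n \<in> C"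
    and inv: "\<And>g y. y \<in> C \<Longrightarrow> F g y \<in> C"
    and lim: "\<And>y. y \<in> C \<Longrightarrow> y islimpt C"
    and gaps: "\<And>a b. a < b \<Longrightarrow> \<exists>t. a < t \<and> t < b \<and> t \<notin> C"
    and minimal: "\<And>L. closed L \<Longrightarrow> L \<noteq> {} \<Longrightarrow> (\<And>y n. y \<in> L \<Longrightarrow> n \<in> \<int> \<Longrightarrow> y + n \<in> L) \<Longrightarrow>
      (\<And>g y. y \<in> L \<Longrightarrow> F g y \<in> L) \<Longrightarrow> C \<subseteq> L"
  shows "exceptional (\<lambda>g. circle_map (F g))"
proof -
  define K where "K = abs_circle ` C"
  obtain t where t: "t \<notin> C" using gaps[of 0 1] by auto
  define S where "S = C \<inter> {t..t + 1}"
  have t1: "t + 1 \<notin> C" using C(3)[of "t + 1" "- 1"] t by auto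
  have S_inner: "S = C \<inter> {t<..<t + 1}"
    unfolding S_def using t t1 by (auto simp: order_le_less)
  have compS: "compact S" unfolding S_def using C(1) by (simp add: closed_Int_compact)
  have K: "K = abs_circle ` S"
  proof
    show "K \<subseteq> abs_circle ` S"
    proof
      fix p assume "p \<in> K"
      then obtain y where y: "y \<in> C" "p = abs_circle y" by (auto simp: K_def)
      obtain n where n: "n \<in> \<int>" "t \<le> y + n" "y + n < t + 1" by (rule shift_to_unit)
      then have "y + n \<in> S" using C(3)[OF y(1) n(1)] by (simp add: S_def)
      then show "p \<in> abs_circle ` S" using y(2) abs_circle_add_Ints[OF n(1), of y] by (intro image_eqI[of _ _ "y + n"]) simp_all
    qed
  qed (auto simp: K_def S_def)
  have injS: "inj_on abs_circle S"
  proof (rule inj_onI)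
    fix x y assume xy: "x \<in> S" "y \<in> S" "abs_circle x = abs_circle y"
    then have "x - y \<in> \<int>" by (simp add: abs_circle_eq_iff)
    moreover have "\<bar>x - y\<bar> < 1" using xy(1,2) by (auto simp: S_inner abs_less_iff)
    ultimately show "x = y" using Ints_nonzero_abs_ge1[of "x - y"] by force
  qed
  have neK: "K \<noteq> {}" using C(2) by (simp add: K_def)
  have "cantorian S"
    unfolding cantorian_def
  proof (intro conjI ballI)
    show "S \<noteq> {}" using neK K by auto
    show "interior S = {}"
    proof (rule ccontr)
      assume "interior S \<noteq> {}"
      then obtain x where "x \<in> interior S" by blast
      then obtain e where e: "e > 0" "ball x e \<subseteq> S" by (auto simp: mem_interior)
      obtain u where u: "x < u" "u < x + e" "u \<notin> C" using gaps[of x "x + e"] e(1) by auto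
      then have "u \<in> ball x e" by (simp add: dist_real_def)
      then show False using e(2) u(3) by (auto simp: S_def)
    qed
    show "x islimpt S" if "x \<in> S" for x
      unfolding islimpt_def
    proof (intro allI impI)
      fix V assume "x \<in> V" "open V"
      then have "x \<in> V \<inter> {t<..<t + 1}" "open (V \<inter> {t<..<t + 1})" using that by (auto simp: S_inner)
      moreover have "x islimpt C" using that lim by (simp add: S_def)
      ultimately obtain y where "y \<in> C" "y \<in> V \<inter> {t<..<t + 1}" "y \<noteq> x" unfolding islimpt_def by blast
      then show "\<exists>y\<in>S. y \<in> V \<and> y \<noteq> x" by (auto simp: S_inner)
    qed
  qed (rule compS)
  then have "S homeomorphic (UNIV :: (nat \<Rightarrow> bool) set)" by (rule cantorian_homeomorphic)
  moreover have "S homeomorphic K"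
    by (rule homeomorphic_compact[OF compS continuous_abs_circle K[symmetric] injS])
  ultimately have homeo: "K homeomorphic (UNIV :: (nat \<Rightarrow> bool) set)"
    by (rule homeomorphic_trans[OF iffD1[OF homeomorphic_sym], rotated])
  have "closed K"
    unfolding K using compact_continuous_image[OF continuous_abs_circle compS] by (rule compact_imp_closed)
  moreover have "circle_map (F g) ` K \<subseteq> K" for g
    using inv[of _ g] by (auto simp: K_def circle_map_abs[OF deg])
  ultimately have nci: "nonempty_closed_invariant (\<lambda>g. circle_map (F g)) K"
    using neK by (simp add: nonempty_closed_invariant_def)
  have "L = K" if L: "nonempty_closed_invariant (\<lambda>g. circle_map (F g)) L" "L \<subseteq> K" for L
  proof -
    define L' where "L' = abs_circle -` L"
    have "closed L'"
      unfolding L'_def using L(1) continuous_abs_circle[of UNIV]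
      by (intro closed_vimage) (auto simp: nonempty_closed_invariant_def)
    moreover have "L' \<noteq> {}"
    proof -
      obtain p where "p \<in> L" using L(1) by (auto simp: nonempty_closed_invariant_def)
      then have "rep_circle p \<in> L'" by (simp add: L'_def)
      then show ?thesis by blast
    qed
    moreover have "y + n \<in> L'" if "y \<in> L'" "n \<in> \<int>" for y n
      using that by (simp add: L'_def abs_circle_add_Ints)
    moreover have "F g y \<in> L'" if "y \<in> L'" for g y
    proof -
      have "circle_map (F g) (abs_circle y) \<in> L"
        using that L(1) by (auto simp: L'_def nonempty_closed_invariant_def)
      then show ?thesis by (simp add: L'_def circle_map_abs[OF deg])
    qed
    ultimately have "C \<subseteq> L'" by (rule minimal)
    then show "L = K" using L(2) by (auto simp: K_def L'_def)
  qed
  then have "minimal_set (\<lambda>g. circle_map (F g)) K" using nci by (simp add: minimal_set_def)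
  with homeo show ?thesis unfolding exceptional_def by blast
qed

section \<open>Conjugating the blown-up translations\<close>

text \<open>A translation read in the original coordinate: \<open>H\<close> will be a lift of the
  conjugacy and \<open>Q\<close> its inverse, so these maps lift the original action. In the next
  definition \<open>k\<close> is the derivative of \<open>Q\<close>.\<close>

definition conj_shift :: "(real \<Rightarrow> real) \<Rightarrow> (real \<Rightarrow> real) \<Rightarrow> real \<Rightarrow> real \<Rightarrow> real"
  where "conj_shift Q H \<tau> x = Q (H x + \<tau>)"

definition conj_shift_deriv :: "(real \<Rightarrow> real) \<Rightarrow> (real \<Rightarrow> real) \<Rightarrow> real \<Rightarrow> real \<Rightarrow> real"
  where "conj_shift_deriv k H \<tau> x = k (H x + \<tau>) / k (H x)"

locale line_conj =
  fixes Q H k :: "real \<Rightarrow> real"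
  assumes Q_deg: "degree_one Q" and Q_deriv: "\<And>x. (Q has_real_derivative k x) (at x)"
    and k_cont: "continuous_on UNIV k" and k_pos: "\<And>x. k x > 0"
    and QH: "\<And>x. Q (H x) = x" and HQ: "\<And>x. H (Q x) = x"
begin

lemma H_deg: "degree_one H"
  by (rule degree_one_inverse_degree[OF Q_deg QH HQ])

lemma H_deriv: "(H has_real_derivative inverse (k (H x))) (at x)"
  by (rule inverse_deriv[OF Q_deriv k_pos QH HQ])

lemma H_cont: "continuous_on UNIV H"
  by (rule deriv_continuous_on[OF H_deriv])

lemma k_periodic:
  assumes "n \<in> \<int>" shows "k (x + n) = k x"
proof -
  have "((\<lambda>x. Q (x + n)) has_real_derivative k (x + n)) (at x)"
    using Q_deriv[of "x + n"] by (simp only: DERIV_shift)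
  moreover have "((\<lambda>x. Q (x + n)) has_real_derivative k x) (at x)"
    using DERIV_add[OF Q_deriv[of x] DERIV_const[of n]] by (simp add: degree_oneD[OF Q_deg assms])
  ultimately show ?thesis by (rule DERIV_unique)
qed

lemma k_bounds:
  obtains m M where "m > 0" "M > 0" "\<And>x. m \<le> k x" "\<And>x. k x \<le> M"
proof (rule periodic_bounded[of k])
  fix m M assume "m \<in> range k" "M \<in> range k" and le: "\<And>x. m \<le> k x" "\<And>x. k x \<le> M"
  then have "m > 0" "M > 0" using k_pos by auto
  then show thesis by (rule that[OF _ _ le])
qed (simp_all add: k_cont k_periodic)

abbreviation Phi where "Phi \<equiv> conj_shift Q H"
abbreviation Phi' where "Phi' \<equiv> conj_shift_deriv k H"

lemma Phi_deriv: "(Phi \<tau> has_real_derivative Phi' \<tau> x) (at x)"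
proof -
  have "((\<lambda>x. H x + \<tau>) has_real_derivative inverse (k (H x))) (at x)"
    using DERIV_add[OF H_deriv DERIV_const] by simp
  from DERIV_chain2[OF Q_deriv this] show ?thesis
    by (simp add: conj_shift_def[abs_def] conj_shift_deriv_def divide_inverse)
qed

lemma Phi_deg: "degree_one (Phi \<tau>)"
  unfolding degree_one_def conj_shift_def
proof (intro allI ballI)
  fix x n :: real assume n: "n \<in> \<int>"
  have eq: "H (x + n) + \<tau> = (H x + \<tau>) + n" using degree_oneD[OF H_deg n] by simp
  show "Q (H (x + n) + \<tau>) = Q (H x + \<tau>) + n" unfolding eq by (rule degree_oneD[OF Q_deg n])
qed

lemma Phi'_cont: "continuous_on UNIV (Phi' \<tau>)"
proof -
  have 1: "continuous_on UNIV (\<lambda>x. k (H x + \<tau>))"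
    by (rule continuous_on_compose2[OF k_cont]) (auto intro!: continuous_intros H_cont)
  have 2: "continuous_on UNIV (\<lambda>x. k (H x))"
    by (rule continuous_on_compose2[OF k_cont H_cont]) simp
  have "k (H x) \<noteq> 0" for x using k_pos[of "H x"] by simp
  then show ?thesis unfolding conj_shift_deriv_def[abs_def] by (intro continuous_on_divide 1 2) auto
qed

lemma Phi'_pos: "Phi' \<tau> x > 0"
  by (simp add: conj_shift_deriv_def k_pos)

lemma Phi'_periodic:
  assumes "n \<in> \<int>" shows "Phi' \<tau> (x + n) = Phi' \<tau> x"
proof -
  have "H (x + n) + \<tau> = (H x + \<tau>) + n" using degree_oneD[OF H_deg assms] by simp
  then have 1: "k (H (x + n) + \<tau>) = k (H x + \<tau>)" by (simp only: k_periodic[OF assms])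
  have 2: "k (H (x + n)) = k (H x)" by (simp only: degree_oneD[OF H_deg assms] k_periodic[OF assms])
  show ?thesis unfolding conj_shift_deriv_def 1 2 ..
qed

lemma Phi'_bounded: obtains M where "M > 0" "\<And>x. Phi' \<tau> x \<le> M"
proof (rule periodic_bounded[of "Phi' \<tau>"])
  fix m M assume "M \<in> range (Phi' \<tau>)" and le: "\<And>x. Phi' \<tau> x \<le> M"
  then have "M > 0" using Phi'_pos by auto
  then show thesis by (rule that[OF _ le])
qed (simp_all add: Phi'_cont Phi'_periodic)

lemma Phi'_unif:
  assumes "e > 0" obtains d where "d > 0" "\<And>x y. \<bar>x - y\<bar> < d \<Longrightarrow> \<bar>Phi' \<tau> x - Phi' \<tau> y\<bar> < e"
proof (rule periodic_uniformly_continuous[of "Phi' \<tau>" e])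
  fix d assume d: "d > 0" "\<And>x y. \<bar>x - y\<bar> < d \<Longrightarrow> \<bar>Phi' \<tau> x - Phi' \<tau> y\<bar> < e"
  show thesis by (rule that[OF d])
qed (simp_all add: Phi'_cont Phi'_periodic assms)

lemma Phi_lipschitz:
  obtains M where "M > 0" "\<And>x y. \<bar>Phi \<tau> x - Phi \<tau> y\<bar> \<le> M * \<bar>x - y\<bar>"
proof -
  obtain M where M: "M > 0" "\<And>x. Phi' \<tau> x \<le> M" using Phi'_bounded by blast
  have "norm (Phi \<tau> x - Phi \<tau> y) \<le> M * norm (x - y)" for x y
  proof (rule field_differentiable_bound[of UNIV "Phi \<tau>" "Phi' \<tau>"])
    show "norm (Phi' \<tau> z) \<le> M" for z using M(2)[of z] Phi'_pos[of \<tau> z] by simp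
  qed (auto intro: Phi_deriv)
  then show ?thesis using M(1) by (intro that[of M]) auto
qed

lemma Q_lipschitz:
  obtains M where "M > 0" "\<And>x y. \<bar>Q x - Q y\<bar> \<le> M * \<bar>x - y\<bar>"
proof -
  obtain m M where "m > 0" and M: "M > 0" and "\<And>x. m \<le> k x" and kM: "\<And>x. k x \<le> M" by (rule k_bounds) blast
  have "norm (Q x - Q y) \<le> M * norm (x - y)" for x y
  proof (rule field_differentiable_bound[of UNIV Q k])
    show "norm (k z) \<le> M" for z using kM[of z] k_pos[of z] by simp
  qed (auto intro: Q_deriv)
  then show ?thesis using M by (intro that[of M]) auto
qed

end

text \<open>Below, \<open>P\<close> lifts the conjugacy \<open>Q\<close> to the blown-up circles and \<open>q\<close> is the collapsing map
  on the side of the original action.\<close>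

locale conj_blowup = blowup \<theta> c + line_conj Q H k
  for \<theta> :: "'g::ab_group_add \<Rightarrow> real" and c :: "'g \<Rightarrow> real" and Q H k :: "real \<Rightarrow> real"
begin

section \<open>The conjugacy lifted to the blown-up circles\<close>

definition P0 :: "real \<Rightarrow> real" where "P0 = (SOME F. \<forall>y. (F has_real_derivative k (cl y)) (at y))"

lemma kcl_cont: "continuous_on UNIV (\<lambda>y. k (cl y))"
  by (rule continuous_on_compose2[OF k_cont]) (auto intro: continuous_at_imp_continuous_on continuous_cl)

lemma P0_deriv: "(P0 has_real_derivative k (cl y)) (at y)"
proof -
  have "\<exists>F. \<forall>y :: real. - \<infinity> < ereal y \<longrightarrow> ereal y < \<infinity> \<longrightarrow> (F has_vector_derivative k (cl y)) (at y)"
    using kcl_cont by (intro einterval_antiderivative) (auto simp: continuous_on_eq_continuous_at)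
  then have "\<exists>F. \<forall>y. (F has_real_derivative k (cl y)) (at y)"
    by (simp add: has_real_derivative_iff_has_vector_derivative)
  from someI_ex[OF this] show ?thesis by (simp add: P0_def)
qed

text \<open>Composition with the collapse changes the mean of \<open>k\<close> over a period, so the
  antiderivative need not gain 1. Division by \<open>Z\<close> makes \<open>P\<close> a map of
  degree one and cancels in quotients of derivatives.\<close>

definition Z :: real where "Z = P0 1 - P0 0"
definition P :: "real \<Rightarrow> real" where "P y = Q 0 + (P0 y - P0 0) / Z"
definition p :: "real \<Rightarrow> real" where "p y = k (cl y) / Z"

lemma P0_increasing: "x < y \<Longrightarrow> P0 x < P0 y"
  using DERIV_pos_imp_increasing[of x y P0] P0_deriv k_pos by blast

lemma Z_pos: "Z > 0" using P0_increasing[of 0 1] by (simp add: Z_def)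

lemma P_deriv: "(P has_real_derivative p y) (at y)"
proof -
  have "((\<lambda>y. P0 y - P0 0) has_real_derivative k (cl y)) (at y)"
    using DERIV_diff[OF P0_deriv DERIV_const] by simp
  from DERIV_add[OF DERIV_const DERIV_cdivide[OF this, of Z], of "Q 0"]
  show ?thesis by (simp add: P_def[abs_def] p_def)
qed

lemma p_pos: "p y > 0" by (simp add: p_def k_pos Z_pos)

lemma P_deg: "degree_one P"
proof (rule degree_oneI)
  fix x
  have "((\<lambda>y. P0 (y + 1) - P0 y) has_real_derivative 0) (at y)" for y
  proof -
    have "((\<lambda>y. P0 (y + 1)) has_real_derivative k (cl (y + 1))) (at y)"
      using P0_deriv[of "y + 1"] by (simp only: DERIV_shift)
    from DERIV_diff[OF this P0_deriv[of y]] show ?thesis by (simp add: cl_shift k_periodic)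
  qed
  then have "P0 (x + 1) - P0 x = P0 (0 + 1) - P0 0"
    using DERIV_isconst_all[of "\<lambda>y. P0 (y + 1) - P0 y"] by blast
  then have "P0 (x + 1) = P0 x + Z" by (simp add: Z_def)
  then show "P (x + 1) = P x + 1" using Z_pos by (simp add: P_def field_simps)
qed

definition R :: "real \<Rightarrow> real" where "R = (SOME G. (\<forall>x. P (G x) = x) \<and> (\<forall>x. G (P x) = x))"

lemma PR [simp]: "P (R x) = x" and RP [simp]: "R (P x) = x"
proof -
  have "\<exists>G. (\<forall>x. P (G x) = x) \<and> (\<forall>x. G (P x) = x)"
  proof (rule degree_one_inverse[of P p])
    fix G assume "\<And>x. P (G x) = x" "\<And>x. G (P x) = x"
    then show ?thesis by blast
  qed (rule P_deg P_deriv p_pos)+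
  from someI_ex[OF this] show "P (R x) = x" "R (P x) = x" by (simp_all add: R_def)
qed

lemma R_deriv: "(R has_real_derivative inverse (p (R x))) (at x)"
  by (rule inverse_deriv[OF P_deriv p_pos PR RP])

lemma R_deg: "degree_one R"
  by (rule degree_one_inverse_degree[OF P_deg PR RP])

lemma P_increasing: "x < y \<Longrightarrow> P x < P y"
  using DERIV_pos_imp_increasing[of x y P] P_deriv p_pos by blast

lemma R_increasing:
  assumes "x < y" shows "R x < R y"
proof (rule ccontr)
  assume "\<not> R x < R y"
  then have "P (R y) \<le> P (R x)" using P_increasing[of "R y" "R x"] by (cases "R x = R y") auto
  with assms show False by simp
qed

lemma P_cont: "continuous_on A P" and R_cont: "continuous_on A R"
  by (rule deriv_continuous_on[OF P_deriv] deriv_continuous_on[OF R_deriv])+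

section \<open>The new action in the original coordinate\<close>

definition q :: "real \<Rightarrow> real" where "q z = Q (cl (R z))"
definition N :: "real \<Rightarrow> real \<Rightarrow> real" where "N \<tau> z = P (T \<tau> (R z))"
definition N' :: "real \<Rightarrow> real \<Rightarrow> real" where "N' \<tau> z = Phi' \<tau> (q z) * W \<tau> (R z)"

lemma N_deg: "\<tau> \<in> transl \<Longrightarrow> degree_one (N \<tau>)"
  unfolding degree_one_def N_def
  by (simp add: degree_oneD[OF R_deg] T_shift degree_oneD[OF P_deg])

lemma N_deriv:
  assumes "\<tau> \<in> transl" "\<And>y. isCont (W \<tau>) y"
  shows "(N \<tau> has_real_derivative N' \<tau> z) (at z)"
proof -
  note DERIV_chain2[OF P_deriv DERIV_chain2[OF T_deriv[OF assms] R_deriv]]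
  from this[of z] have "(N \<tau> has_real_derivative p (T \<tau> (R z)) * (W \<tau> (R z) * inverse (p (R z)))) (at z)"
    by (simp add: N_def[abs_def])
  \<comment> \<open>The collapse turns \<open>T\<close> into a translation and
    \<open>H (q z) = cl (R z)\<close>; hence the quotient of the two values of \<open>p\<close> is
    the derivative of the old map at \<open>q z\<close>, and \<open>k\<close> enters through this
    quotient alone.\<close>
  moreover have "p (T \<tau> (R z)) * (W \<tau> (R z) * inverse (p (R z))) = N' \<tau> z"
    using Z_pos by (simp add: p_def N'_def q_def conj_shift_deriv_def HQ cl_T[OF assms(1)] field_simps)
  ultimately show ?thesis by simp
qed

lemma N'_pos: "\<tau> \<in> transl \<Longrightarrow> N' \<tau> z > 0"
  by (simp add: N'_def Phi'_pos W_pos)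

lemma q_cont: "continuous_on UNIV q"
proof -
  have "continuous_on UNIV (\<lambda>z. cl (R z))"
    by (rule continuous_on_compose2[OF _ R_cont, of UNIV])
      (auto intro: continuous_at_imp_continuous_on continuous_cl)
  then show ?thesis unfolding q_def[abs_def]
    by (rule continuous_on_compose2[OF deriv_continuous_on[OF Q_deriv, of UNIV]]) simp
qed

lemma N'_cont: "(\<And>y. isCont (W \<tau>) y) \<Longrightarrow> continuous_on UNIV (N' \<tau>)"
  unfolding N'_def[abs_def]
  by (intro continuous_on_mult continuous_on_compose2[OF Phi'_cont q_cont]
      continuous_on_compose2[OF _ R_cont, of UNIV "W \<tau>"]) (auto intro: continuous_at_imp_continuous_on)

lemma q_N: "\<tau> \<in> transl \<Longrightarrow> q (N \<tau> z) = Phi \<tau> (q z)"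
  by (simp add: q_def N_def cl_T conj_shift_def HQ)

lemma N_comp: "\<sigma> \<in> transl \<Longrightarrow> \<tau> \<in> transl \<Longrightarrow> N \<sigma> (N \<tau> z) = N (\<sigma> + \<tau>) z"
  by (simp add: N_def T_comp)

lemma N_shift:
  assumes "\<tau> \<in> transl" "n \<in> \<int>" shows "N (\<tau> + n) z = N \<tau> z + n"
  unfolding N_def T_comp[OF assms(1) transl_Ints[OF assms(2)], symmetric] T_int[OF assms(2)] T_shift[OF assms]
  by (rule degree_oneD[OF P_deg assms(2)])

definition new_action :: "'g \<Rightarrow> circle \<Rightarrow> circle" where "new_action g = circle_map (N (\<theta> g))"

text \<open>The representatives \<open>\<theta>\<close> are additive up to an integer, which the
  projection to the circle forgets.\<close>

lemma new_action_add: "new_action (g + h) = new_action g \<circ> new_action h"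
proof (rule circle_eqI)
  fix x
  define n where "n = \<theta> (g + h) - \<theta> g - \<theta> h"
  have n: "n \<in> \<int>" unfolding n_def by (rule theta_add)
  have tr: "\<theta> g + \<theta> h \<in> transl" by (intro transl_add transl_theta)
  have "\<theta> (g + h) = (\<theta> g + \<theta> h) + n" by (simp add: n_def)
  then have "N (\<theta> (g + h)) x = N (\<theta> g) (N (\<theta> h) x) + n"
    by (simp only: N_shift[OF tr n] N_comp[OF transl_theta transl_theta])
  then show "new_action (g + h) (abs_circle x) = (new_action g \<circ> new_action h) (abs_circle x)"
    by (simp add: new_action_def circle_map_abs[OF N_deg[OF transl_theta]] abs_circle_add_Ints[OF n])
qed

lemma exceptional_new_action: "exceptional new_action"
proof -
  define C where "C = R -` core"
  have PC: "P y \<in> C \<longleftrightarrow> y \<in> core" for y by (simp add: C_def)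
  have "exceptional (\<lambda>g. circle_map (N (\<theta> g)))"
  proof (rule exceptional_circle_map)
    show "degree_one (N (\<theta> g))" for g by (rule N_deg[OF transl_theta])
    show "closed C" unfolding C_def by (rule closed_vimage[OF closed_core R_cont])
    show "C \<noteq> {}" using PC[of "lo 0"] by (auto simp: core_def)
    show "y + n \<in> C" if "y \<in> C" "n \<in> \<int>" for y n
      using that by (simp add: C_def degree_oneD[OF R_deg] core_shift)
    show "N (\<theta> g) y \<in> C" if "y \<in> C" for g y
      using that T_core[OF transl_theta] by (simp add: N_def C_def)
    show "y islimpt C" if "y \<in> C" for y
      unfolding islimpt_def
    proof (intro allI impI)
      fix V assume V: "y \<in> V" "open V"
      have "R y islimpt core" using that by (intro core_islimpt) (simp add: C_def)
      moreover have "open (P -` V)" using V(2) P_cont by (rule open_vimage)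
      moreover have "R y \<in> P -` V" using V(1) by simp
      ultimately obtain u where u: "u \<in> core" "u \<in> P -` V" "u \<noteq> R y" unfolding islimpt_def by blast
      have "P u \<noteq> y" using u(3) by auto
      then show "\<exists>z\<in>C. z \<in> V \<and> z \<noteq> y" using u(1,2) PC by (intro bexI[of _ "P u"]) auto
    qed
    show "\<exists>t. a < t \<and> t < b \<and> t \<notin> C" if "a < b" for a b
    proof -
      have "R a < R b" using that by (rule R_increasing)
      then obtain t where "R a < t" "t < R b" "t \<notin> core" using not_core_between by blast
      then show ?thesis using P_increasing[of "R a" t] P_increasing[of t "R b"] PC by (intro exI[of _ "P t"]) auto
    qed
  next
    fix L assume L: "closed L" "L \<noteq> {}" "\<And>y n. y \<in> L \<Longrightarrow> n \<in> \<int> \<Longrightarrow> y + n \<in> L"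
      "\<And>g y. y \<in> L \<Longrightarrow> N (\<theta> g) y \<in> L"
    have "core \<subseteq> P -` L"
    proof (rule core_minimal)
      show "closed (P -` L)" by (rule closed_vimage[OF L(1) P_cont])
      show "P -` L \<noteq> {}"
      proof -
        obtain y where "y \<in> L" using L(2) by blast
        then have "R y \<in> P -` L" by simp
        then show ?thesis by blast
      qed
      show "T \<tau> y \<in> P -` L" if "\<tau> \<in> transl" "y \<in> P -` L" for \<tau> y
      proof -
        \<comment> \<open>\<open>L\<close> is known to be invariant under the maps for
          \<open>\<theta> g\<close> only; the integer by which \<open>\<tau>\<close> differs from
          one of them is absorbed by the periodicity of \<open>L\<close>.\<close>
        obtain g where g: "\<tau> - \<theta> g \<in> \<int>" using \<open>\<tau> \<in> transl\<close> by (auto simp: transl_def)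
        have "N (\<theta> g + (\<tau> - \<theta> g)) (P y) = N (\<theta> g) (P y) + (\<tau> - \<theta> g)" by (rule N_shift[OF transl_theta g])
        then have "P (T \<tau> y) = N (\<theta> g) (P y) + (\<tau> - \<theta> g)" by (simp add: N_def)
        then show ?thesis using L(3)[OF L(4) g] that(2) by simp
      qed
    qed
    then have "P (R y) \<in> L" if "y \<in> C" for y using that unfolding C_def by blast
    then show "C \<subseteq> L" by auto
  qed
  then show ?thesis unfolding new_action_def[abs_def] .
qed

text \<open>The derivatives of \<open>P0\<close> and \<open>Q\<close> differ by at most \<epsilon>,
  so over one period their increments, and in particular \<open>Z\<close> and 1, differ by at most
  \<epsilon>; normalising by \<open>Z\<close> adds another \<epsilon>. The collapse moves points by
  at most 2 mass, which \<open>Q\<close> stretches by at most \<open>M\<close>.\<close>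

lemma q_near:
  assumes k: "\<And>x y. \<bar>x - y\<bar> \<le> 2 * mass \<Longrightarrow> \<bar>k x - k y\<bar> \<le> \<epsilon>"
    and M: "\<And>x y. \<bar>Q x - Q y\<bar> \<le> M * \<bar>x - y\<bar>" "M > 0"
  shows "\<bar>q z - z\<bar> \<le> 2 * \<epsilon> + 2 * M * mass"
proof -
  have kcl: "\<bar>k (cl y) - k y\<bar> \<le> \<epsilon>" for y using cl_bounds[of y] by (intro k) auto
  have diff: "\<bar>(P0 y - P0 0) - (Q y - Q 0)\<bar> \<le> \<epsilon>" if "0 \<le> y" "y \<le> 1" for y
  proof -
    have "norm ((P0 y - Q y) - (P0 0 - Q 0)) \<le> \<epsilon> * norm (y - 0)"
    proof (rule field_differentiable_bound[of UNIV "\<lambda>y. P0 y - Q y" "\<lambda>y. k (cl y) - k y"])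
      show "((\<lambda>y. P0 y - Q y) has_field_derivative k (cl z) - k z) (at z within UNIV)" for z
        using DERIV_diff[OF P0_deriv Q_deriv] by simp
      show "norm (k (cl z) - k z) \<le> \<epsilon>" for z using kcl by simp
    qed auto
    also have "\<dots> \<le> \<epsilon> * 1" using that kcl[of 0] by (intro mult_left_mono) auto
    finally show ?thesis by simp
  qed
  have "Q (0 + 1) = Q 0 + 1" by (rule degree_oneD[OF Q_deg]) simp
  then have "\<bar>Z - 1\<bar> \<le> \<epsilon>" using diff[of 1] by (simp add: Z_def)
  have PQ: "\<bar>P y - Q y\<bar> \<le> 2 * \<epsilon>" if y: "0 \<le> y" "y \<le> 1" for y
  proof -
    define A where "A = P0 y - P0 0"
    have A: "0 \<le> A" "A \<le> Z"
      using P0_increasing[of 0 y] P0_increasing[of y 1] y by (cases "y = 0"; cases "y = 1"; simp add: A_def Z_def)+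
    have "A / Z - A = (A / Z) * (1 - Z)" using Z_pos by (simp add: field_simps)
    then have "\<bar>A / Z - A\<bar> = (A / Z) * \<bar>1 - Z\<bar>" using A Z_pos by (simp add: abs_mult)
    also have "\<dots> \<le> 1 * \<epsilon>" using A Z_pos \<open>\<bar>Z - 1\<bar> \<le> \<epsilon>\<close> by (intro mult_mono) auto
    finally have "\<bar>A / Z - A\<bar> \<le> \<epsilon>" by simp
    moreover have "P y - Q y = (A / Z - A) + (A - (Q y - Q 0))" by (simp add: P_def A_def)
    ultimately show ?thesis using diff[OF y] unfolding A_def by linarith
  qed
  have PQ': "\<bar>P y - Q y\<bar> \<le> 2 * \<epsilon>" for y
  proof -
    obtain n where n: "n \<in> \<int>" "0 \<le> y + n" "y + n < 0 + 1" by (rule shift_to_unit)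
    then show ?thesis using PQ[of "y + n"] by (simp add: degree_oneD[OF P_deg] degree_oneD[OF Q_deg])
  qed
  define y where "y = R z"
  have "\<bar>Q (cl y) - Q y\<bar> \<le> M * \<bar>cl y - y\<bar>" by (rule M)
  also have "\<dots> \<le> M * (2 * mass)" using cl_bounds[of y] M(2) by (intro mult_left_mono) auto
  finally have "\<bar>Q (cl y) - Q y\<bar> \<le> 2 * M * mass" by simp
  moreover have "q z - z = (Q (cl y) - Q y) - (P y - Q y)" by (simp add: q_def y_def)
  ultimately show ?thesis using PQ'[of y] by linarith
qed

lemma R_lipschitz: obtains \<Lambda> where "\<Lambda> > 0" "\<And>x y. \<bar>R x - R y\<bar> \<le> \<Lambda> * \<bar>x - y\<bar>"
proof -
  obtain m M where m: "m > 0" and "M > 0" and mk: "\<And>x. m \<le> k x" and "\<And>x. k x \<le> M" by (rule k_bounds) blast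
  have "norm (R x - R y) \<le> (Z / m) * norm (x - y)" for x y
  proof (rule field_differentiable_bound[of UNIV R "\<lambda>x. inverse (p (R x))"])
    show "norm (inverse (p (R z))) \<le> Z / m" for z
      using m mk[of "cl (R z)"] k_pos[of "cl (R z)"] Z_pos by (simp add: p_def frac_le)
  qed (auto intro: R_deriv)
  then show ?thesis using m Z_pos by (intro that[of "Z / m"]) auto
qed

lemma q_lipschitz: obtains \<Lambda> where "\<Lambda> > 0" "\<And>x y. \<bar>q x - q y\<bar> \<le> \<Lambda> * \<bar>x - y\<bar>"
proof -
  obtain A where A: "A > 0" "\<And>x y. \<bar>R x - R y\<bar> \<le> A * \<bar>x - y\<bar>" using R_lipschitz by blast
  obtain B where B: "B > 0" "\<And>x y. \<bar>Q x - Q y\<bar> \<le> B * \<bar>x - y\<bar>" using Q_lipschitz by blast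
  have "\<bar>q x - q y\<bar> \<le> B * (A / (1 - mass)) * \<bar>x - y\<bar>" for x y
  proof -
    have "\<bar>q x - q y\<bar> \<le> B * \<bar>cl (R x) - cl (R y)\<bar>" unfolding q_def by (rule B)
    also have "\<dots> \<le> B * (\<bar>R x - R y\<bar> / (1 - mass))" using B by (intro mult_left_mono cl_lipschitz_abs) auto
    also have "\<dots> \<le> B * ((A * \<bar>x - y\<bar>) / (1 - mass))"
      using A B mass_lt by (intro mult_left_mono divide_right_mono) auto
    finally show ?thesis by (simp add: mult_ac)
  qed
  then show ?thesis using A B mass_lt by (intro that[of "B * (A / (1 - mass))"]) auto
qed

end

section \<open>Moduli of continuity under Lipschitz changes of variable\<close>

lemma concave_modulus_scale:
  assumes "concave_modulus \<alpha>" "t \<ge> 0" "\<Lambda> > 0"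
  shows "\<alpha> (\<Lambda> * t) \<le> (1 + \<Lambda>) * \<alpha> t"
proof (cases "t = 0")
  case False
  then have t: "t > 0" using assms by simp
  then have at: "\<alpha> t > 0" by (rule concave_modulus_pos[OF assms(1)])
  show ?thesis
  proof (cases "\<Lambda> \<le> 1")
    case True
    have "\<alpha> (\<Lambda> * t) \<le> \<alpha> t"
      using assms True t by (intro concave_modulus_mono_weak[OF assms(1)]) (auto simp: mult_le_cancel_right1)
    also have "\<dots> \<le> (1 + \<Lambda>) * \<alpha> t" using at assms(3) by simp
    finally show ?thesis .
  next
    case False
    then have "t \<le> \<Lambda> * t" using t by simp
    from concave_modulus_star[OF assms(1) t this] have "\<alpha> (\<Lambda> * t) \<le> \<Lambda> * \<alpha> t"
      using t assms(3) by (simp add: field_simps)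
    also have "\<dots> \<le> (1 + \<Lambda>) * \<alpha> t" using at by simp
    finally show ?thesis .
  qed
qed (simp add: concave_modulus_zero[OF assms(1)])

lemma concave_modulus_abs_le:
  assumes "concave_modulus \<alpha>" "\<Lambda> > 0" "\<bar>x\<bar> \<le> \<Lambda> * \<bar>y\<bar>"
  shows "\<alpha> \<bar>x\<bar> \<le> (1 + \<Lambda>) * \<alpha> \<bar>y\<bar>"
  using concave_modulus_mono_weak[OF assms(1) _ assms(3)] concave_modulus_scale[OF assms(1) _ assms(2), of "\<bar>y\<bar>"]
  by simp

lemma modulus_isCont:
  fixes f :: "real \<Rightarrow> real"
  assumes \<alpha>: "concave_modulus \<alpha>" and f: "\<And>y z. \<bar>f y - f z\<bar> \<le> C * \<alpha> \<bar>y - z\<bar>"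
  shows "isCont f y"
  unfolding continuous_at_eps_delta
proof (intro allI impI)
  fix e :: real assume e: "e > 0"
  define u where "u = e / (\<bar>C\<bar> + 1)"
  have u: "u > 0" using e by (simp add: u_def)
  have "dist (f z) (f y) < e" if "dist z y < inv_into {0..} \<alpha> u" for z
  proof -
    have a: "0 \<le> \<alpha> \<bar>z - y\<bar>"
      using concave_modulus_mono_weak[OF \<alpha>, of 0 "\<bar>z - y\<bar>"] concave_modulus_zero[OF \<alpha>] by simp
    have "\<alpha> \<bar>z - y\<bar> < \<alpha> (inv_into {0..} \<alpha> u)"
      using that by (intro concave_modulus_strict[OF \<alpha>]) (auto simp: dist_real_def)
    then have au: "\<alpha> \<bar>z - y\<bar> < u" using modulus_inverse(2)[OF \<alpha>, of u] u by simp
    have "\<bar>f z - f y\<bar> \<le> C * \<alpha> \<bar>z - y\<bar>" by (rule f)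
    also have "\<dots> \<le> (\<bar>C\<bar> + 1) * \<alpha> \<bar>z - y\<bar>" using a by (intro mult_right_mono) auto
    also have "\<dots> < (\<bar>C\<bar> + 1) * u" using au by (intro mult_strict_left_mono) auto
    also have "\<dots> = e" by (simp add: u_def)
    finally show ?thesis by (simp add: dist_real_def)
  qed
  then show "\<exists>d>0. \<forall>z. dist z y < d \<longrightarrow> dist (f z) (f y) < e"
    using modulus_inverse_pos[OF \<alpha> u] by blast
qed

lemma modulus_continuousI:
  assumes \<alpha>: "concave_modulus \<alpha>" and "\<And>p q. \<bar>g p - g q\<bar> \<le> C * \<alpha> (dist p q)"
  shows "modulus_continuous \<alpha> g"
  unfolding modulus_continuous_def
proof (rule bdd_aboveI)
  fix r assume "r \<in> {\<bar>g p - g q\<bar> / \<alpha> (dist p q) | p q. p \<noteq> q}"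
  then obtain p q where r: "r = \<bar>g p - g q\<bar> / \<alpha> (dist p q)" "p \<noteq> q" by blast
  have "\<alpha> (dist p q) > 0" using r(2) by (intro concave_modulus_pos[OF \<alpha>]) simp
  then show "r \<le> C" using assms(2)[of p q] by (simp add: r field_simps)
qed

lemma modulus_continuousD:
  assumes \<alpha>: "concave_modulus \<alpha>" and g: "modulus_continuous \<alpha> g"
  obtains C where "C \<ge> 0" "\<And>p q. \<bar>g p - g q\<bar> \<le> C * \<alpha> (dist p q)"
proof -
  obtain C where C: "\<And>r. r \<in> {\<bar>g p - g q\<bar> / \<alpha> (dist p q) | p q. p \<noteq> q} \<Longrightarrow> r \<le> C"
    using g unfolding modulus_continuous_def bdd_above_def by blast
  have "\<bar>g p - g q\<bar> \<le> \<bar>C\<bar> * \<alpha> (dist p q)" for p q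
  proof (cases "p = q")
    case False
    then have a: "\<alpha> (dist p q) > 0" by (intro concave_modulus_pos[OF \<alpha>]) simp
    have "\<bar>g p - g q\<bar> / \<alpha> (dist p q) \<le> C" using False by (intro C) blast
    then have "\<bar>g p - g q\<bar> \<le> C * \<alpha> (dist p q)" using a by (simp add: field_simps)
    also have "\<dots> \<le> \<bar>C\<bar> * \<alpha> (dist p q)" using a by (intro mult_right_mono) auto
    finally show ?thesis .
  qed (simp add: concave_modulus_zero[OF \<alpha>])
  then show ?thesis by (intro that[of "\<bar>C\<bar>"]) auto
qed

context conj_blowup
begin

lemma W_le:
  assumes "\<tau> \<in> transl" "B \<ge> 1" "\<And>x. jump x > 0 \<Longrightarrow> (jump x / jump (x + \<tau>))\<^sup>2 \<ge> 1 / B"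
  shows "W \<tau> y \<le> B"
proof (cases "jump (cl y) > 0")
  case True
  then show ?thesis unfolding W_def by (intro gap_deriv_le assms)
next
  case False
  then have "jump (cl y) = 0" using jump_nonneg[of "cl y"] by simp
  then show ?thesis using jump_transl_zero[OF assms(1)] assms(2) by (simp add: W_def)
qed

text \<open>The Lipschitz maps \<open>q\<close> and \<open>R\<close> enlarge an \<alpha>-bound only
  by a constant factor, and the product estimate combines the \<alpha>-bounds of the two factors
  with their upper bounds \<open>M\<close> and \<open>B\<close>.\<close>

lemma new_action_regular:
  assumes \<alpha>: "concave_modulus \<alpha>" and B: "B \<ge> 1"
    and ratio: "\<And>h. (c h / c (h + g))\<^sup>2 \<ge> 1 / B \<and> \<bar>(c h / c (h + g))\<^sup>2 - 1\<bar> \<le> B * \<alpha> (c h)"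
    and f: "modulus_continuous \<alpha> (circle_deriv f)" "\<And>x. circle_deriv f (abs_circle x) = Phi' (\<theta> g) x"
  shows "new_action g \<in> Diff1_modulus \<alpha>" "circle_deriv (new_action g) (abs_circle x) = N' (\<theta> g) x"
proof -
  let ?\<tau> = "\<theta> g"
  have jr: "(jump x / jump (x + ?\<tau>))\<^sup>2 \<ge> 1 / B \<and> \<bar>(jump x / jump (x + ?\<tau>))\<^sup>2 - 1\<bar> \<le> B * \<alpha> (jump x)"
    if "jump x > 0" for x
    using jump_pairI[of "\<lambda>a b. (a / b)\<^sup>2 \<ge> 1 / B \<and> \<bar>(a / b)\<^sup>2 - 1\<bar> \<le> B * \<alpha> a" g x] ratio that by blast
  define C2 where "C2 = 4 * pi * B\<^sup>2 * B"
  have C2: "C2 \<ge> 0" using B by (simp add: C2_def)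
  have Wm: "\<bar>W ?\<tau> y - W ?\<tau> z\<bar> \<le> C2 * \<alpha> \<bar>y - z\<bar>" for y z
    unfolding C2_def
    by (rule W_modulus[OF transl_theta B _ jr])
      (use B in \<open>auto intro: concave_modulus_mono_weak[OF \<alpha>] concave_modulus_star[OF \<alpha>] concave_modulus_zero[OF \<alpha>]\<close>)
  have Wc: "isCont (W ?\<tau>) y" for y by (rule modulus_isCont[OF \<alpha> Wm])
  have WB: "W ?\<tau> y \<le> B" for y using jr by (intro W_le transl_theta B) auto
  note D = Diff1_circle_map[OF N_deg[OF transl_theta] N_deriv[OF transl_theta Wc] N'_cont[OF Wc] N'_pos[OF transl_theta],
      folded new_action_def]
  show deriv: "circle_deriv (new_action g) (abs_circle x) = N' ?\<tau> x" for x by (rule D(2))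
  obtain C1 where C1: "C1 \<ge> 0" "\<And>p q. \<bar>circle_deriv f p - circle_deriv f q\<bar> \<le> C1 * \<alpha> (dist p q)"
    by (rule modulus_continuousD[OF \<alpha> f(1)]) blast
  obtain A where A: "A > 0" "\<And>x y. \<bar>q x - q y\<bar> \<le> A * \<bar>x - y\<bar>" by (rule q_lipschitz) blast
  obtain E where E: "E > 0" "\<And>x y. \<bar>R x - R y\<bar> \<le> E * \<bar>x - y\<bar>" by (rule R_lipschitz) blast
  obtain M where M: "M > 0" "\<And>x. Phi' ?\<tau> x \<le> M" by (rule Phi'_bounded) blast
  define C where "C = C1 * (1 + A) * B + M * (C2 * (1 + E))"
  have main: "\<bar>N' ?\<tau> x - N' ?\<tau> y\<bar> \<le> C * \<alpha> \<bar>x - y\<bar>" for x y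
  proof -
    have "\<bar>Phi' ?\<tau> (q x) - Phi' ?\<tau> (q y)\<bar> \<le> C1 * \<alpha> (dist (abs_circle (q x)) (abs_circle (q y)))"
      using C1(2)[of "abs_circle (q x)" "abs_circle (q y)"] by (simp add: f(2))
    also have "\<dots> \<le> C1 * \<alpha> \<bar>q x - q y\<bar>"
      using C1(1) by (intro mult_left_mono concave_modulus_mono_weak[OF \<alpha>] dist_abs_circle_le) auto
    also have "\<dots> \<le> C1 * ((1 + A) * \<alpha> \<bar>x - y\<bar>)"
      using C1(1) A by (intro mult_left_mono concave_modulus_abs_le[OF \<alpha>]) auto
    finally have 1: "\<bar>Phi' ?\<tau> (q x) - Phi' ?\<tau> (q y)\<bar> \<le> C1 * (1 + A) * \<alpha> \<bar>x - y\<bar>" by simp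
    have "\<bar>W ?\<tau> (R x) - W ?\<tau> (R y)\<bar> \<le> C2 * \<alpha> \<bar>R x - R y\<bar>" by (rule Wm)
    also have "\<dots> \<le> C2 * ((1 + E) * \<alpha> \<bar>x - y\<bar>)"
      using C2 E by (intro mult_left_mono concave_modulus_abs_le[OF \<alpha>]) auto
    finally have 2: "\<bar>W ?\<tau> (R x) - W ?\<tau> (R y)\<bar> \<le> C2 * (1 + E) * \<alpha> \<bar>x - y\<bar>" by simp
    have "\<bar>N' ?\<tau> x - N' ?\<tau> y\<bar> = \<bar>(Phi' ?\<tau> (q x) - Phi' ?\<tau> (q y)) * W ?\<tau> (R x) +
        Phi' ?\<tau> (q y) * (W ?\<tau> (R x) - W ?\<tau> (R y))\<bar>"
      by (simp add: N'_def algebra_simps)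
    also have "\<dots> \<le> \<bar>Phi' ?\<tau> (q x) - Phi' ?\<tau> (q y)\<bar> * W ?\<tau> (R x) +
        Phi' ?\<tau> (q y) * \<bar>W ?\<tau> (R x) - W ?\<tau> (R y)\<bar>"
      using W_pos[OF transl_theta, of g "R x"] Phi'_pos[of ?\<tau> "q y"]
      by - (rule order_trans[OF abs_triangle_ineq], simp add: abs_mult)
    also have "\<dots> \<le> (C1 * (1 + A) * \<alpha> \<bar>x - y\<bar>) * B + M * (C2 * (1 + E) * \<alpha> \<bar>x - y\<bar>)"
    proof (rule add_mono)
      show "\<bar>Phi' ?\<tau> (q x) - Phi' ?\<tau> (q y)\<bar> * W ?\<tau> (R x) \<le> (C1 * (1 + A) * \<alpha> \<bar>x - y\<bar>) * B"
        by (rule mult_mono[OF 1 WB order_trans[OF abs_ge_zero 1] less_imp_le[OF W_pos[OF transl_theta]]])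
      show "Phi' ?\<tau> (q y) * \<bar>W ?\<tau> (R x) - W ?\<tau> (R y)\<bar> \<le> M * (C2 * (1 + E) * \<alpha> \<bar>x - y\<bar>)"
        by (rule mult_mono[OF M(2) 2 less_imp_le[OF M(1)] abs_ge_zero])
    qed
    also have "\<dots> = C * \<alpha> \<bar>x - y\<bar>" by (simp add: C_def algebra_simps)
    finally show ?thesis .
  qed
  have "modulus_continuous \<alpha> (circle_deriv (new_action g))"
  proof (rule modulus_continuousI[OF \<alpha>])
    fix p p' :: circle
    obtain x y where "p = abs_circle x" "p' = abs_circle y" "\<bar>x - y\<bar> = dist p p'" by (rule circle_reps_dist)
    then show "\<bar>circle_deriv (new_action g) p - circle_deriv (new_action g) p'\<bar> \<le> C * \<alpha> (dist p p')"
      using main[of x y] by (simp add: deriv)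
  qed
  then show "new_action g \<in> Diff1_modulus \<alpha>" using D(1) by (simp add: Diff1_modulus_def)
qed

text \<open>New and old maps are compared through \<open>q\<close>, which semiconjugates one to the
  other: \<open>N z\<close> is within \<open>\<eta>\<close> of \<open>q (N z)\<close>, which equals
  \<open>Phi (q z)\<close>.\<close>

lemma new_action_close:
  assumes B: "B \<ge> 1" and \<delta>: "\<delta> \<ge> 0"
    and ratio: "\<And>h. (c h / c (h + g))\<^sup>2 \<ge> 1 / B \<and> \<bar>(c h / c (h + g))\<^sup>2 - 1\<bar> \<le> \<delta>"
    and q: "\<And>z. \<bar>q z - z\<bar> \<le> \<eta>"
  shows "\<bar>N (\<theta> g) z - Phi (\<theta> g) z\<bar> \<le> \<eta> + \<bar>Phi (\<theta> g) (q z) - Phi (\<theta> g) z\<bar>"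
    and "\<bar>N' (\<theta> g) z - Phi' (\<theta> g) z\<bar> \<le> Phi' (\<theta> g) (q z) * (B * \<delta>) + \<bar>Phi' (\<theta> g) (q z) - Phi' (\<theta> g) z\<bar>"
proof -
  have jr: "(jump x / jump (x + \<theta> g))\<^sup>2 \<ge> 1 / B \<and> \<bar>(jump x / jump (x + \<theta> g))\<^sup>2 - 1\<bar> \<le> \<delta>"
    if "jump x > 0" for x
    using jump_pairI[of "\<lambda>a b. (a / b)\<^sup>2 \<ge> 1 / B \<and> \<bar>(a / b)\<^sup>2 - 1\<bar> \<le> \<delta>" g x] ratio that by blast
  show "\<bar>N (\<theta> g) z - Phi (\<theta> g) z\<bar> \<le> \<eta> + \<bar>Phi (\<theta> g) (q z) - Phi (\<theta> g) z\<bar>"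
    using q[of "N (\<theta> g) z"] unfolding q_N[OF transl_theta] by linarith
  have "\<bar>W (\<theta> g) (R z) - 1\<bar> \<le> B * \<delta>" by (rule W_near_one[OF transl_theta B \<delta> jr])
  then have "Phi' (\<theta> g) (q z) * \<bar>W (\<theta> g) (R z) - 1\<bar> \<le> Phi' (\<theta> g) (q z) * (B * \<delta>)"
    using Phi'_pos[of "\<theta> g" "q z"] by (intro mult_left_mono) auto
  moreover have "N' (\<theta> g) z - Phi' (\<theta> g) z =
      Phi' (\<theta> g) (q z) * (W (\<theta> g) (R z) - 1) + (Phi' (\<theta> g) (q z) - Phi' (\<theta> g) z)"
    by (simp add: N'_def algebra_simps)
  moreover have "\<bar>Phi' (\<theta> g) (q z) * (W (\<theta> g) (R z) - 1)\<bar> = Phi' (\<theta> g) (q z) * \<bar>W (\<theta> g) (R z) - 1\<bar>"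
    using Phi'_pos[of "\<theta> g" "q z"] by (simp add: abs_mult)
  ultimately show "\<bar>N' (\<theta> g) z - Phi' (\<theta> g) z\<bar> \<le>
      Phi' (\<theta> g) (q z) * (B * \<delta>) + \<bar>Phi' (\<theta> g) (q z) - Phi' (\<theta> g) z\<bar>"
    by linarith
qed

end

section \<open>Approximation by exceptional actions\<close>

theorem theorem1p6:
  fixes \<alpha> :: "real \<Rightarrow> real"
    and \<rho> :: "int ^ 'd \<Rightarrow> circle \<Rightarrow> circle"
  assumes "concave_modulus \<alpha>"
    and "\<alpha> differentiable_on {0<..}"
    and "set_integrable lborel {0<..1} (\<lambda>t. inv_into {0..} \<alpha> t / t ^ (CARD('d) + 1))"
    and "bdd_above ((\<lambda>t. \<alpha> t / (t * deriv \<alpha> t)) ` {0<..})"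
    and "representation_into (Diff1_modulus \<alpha>) \<rho>"
    and "inj \<rho>"
    and "C1_conjugate_into_rotations \<rho>"
  shows "\<exists>\<rho>s :: nat \<Rightarrow> int ^ 'd \<Rightarrow> circle \<Rightarrow> circle.
    (\<forall>k. representation_into (Diff1_modulus \<alpha>) (\<rho>s k) \<and> exceptional (\<rho>s k)) \<and>
    C1_converges \<rho>s \<rho>"
proof -
  note \<alpha> = assms(1)
  have \<rho>D: "\<rho> g \<in> Diff1" "modulus_continuous \<alpha> (circle_deriv (\<rho> g))"
    and \<rho>add: "\<rho> (g + g') = \<rho> g \<circ> \<rho> g'" for g g'
    using assms(5) by (auto simp: representation_into_def Diff1_modulus_def)
  obtain h where h: "h \<in> Diff1" and ha: "\<forall>g. \<exists>a. h \<circ> \<rho> g \<circ> inv h = rotation a"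
    using assms(7) by (auto simp: C1_conjugate_into_rotations_def)
  from choice[OF ha] obtain a where a: "\<And>g. h \<circ> \<rho> g \<circ> inv h = rotation (a g)" by blast
  have bij: "bij h" using h by (simp add: Diff1_def)
  have hinv: "inv h (h p) = p" "h (inv h p) = p" for p
    using bij by (simp_all add: bij_is_inj bij_is_surj surj_f_inv_f)
  have \<rho>a: "\<rho> g p = inv h (h p + a g)" for g p
  proof -
    have "h (\<rho> g (inv h (h p))) = rotation (a g) (h p)" using fun_cong[OF a[of g], of "h p"] by simp
    then have "h (\<rho> g p) = h p + a g" by (simp add: hinv rotation_def)
    then show ?thesis using hinv(1)[of "\<rho> g p"] by simp
  qed
  have a_add: "a (g + g') = a g + a g'" for g g'
  proof -
    have "h (\<rho> (g + g') (inv h 0)) = h (\<rho> g (\<rho> g' (inv h 0)))" by (simp add: \<rho>add)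
    then show ?thesis by (simp add: \<rho>a hinv add_ac)
  qed
  have a_zero: "a 0 = 0" using a_add[of 0 0] by simp
  \<comment> \<open>Faithfulness enters here: an element with trivial rotation acts as the identity
    does.\<close>
  have a_inj: "g = 0" if "a g = 0" for g
  proof -
    have "\<rho> g = \<rho> 0" by (rule ext) (simp add: \<rho>a that a_zero)
    then show ?thesis using assms(6) by (simp add: inj_eq)
  qed
  define \<theta> where "\<theta> g = frac (rep_circle (a g))" for g
  have abs\<theta>: "abs_circle (\<theta> g) = a g" for g
  proof -
    have "abs_circle (rep_circle (a g) + (- of_int \<lfloor>rep_circle (a g)\<rfloor>)) = abs_circle (rep_circle (a g))"
      by (rule abs_circle_add_Ints) simp
    then show ?thesis by (simp add: \<theta>_def frac_def)
  qed
  have \<theta>_range: "0 \<le> \<theta> g" "\<theta> g < 1" for g by (simp_all add: \<theta>_def frac_lt_1)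
  have \<theta>_add: "\<theta> (g + g') - \<theta> g - \<theta> g' \<in> \<int>" for g g'
  proof -
    have "abs_circle (\<theta> (g + g')) = abs_circle (\<theta> g + \<theta> g')"
      by (simp add: abs\<theta> a_add plus_circle.abs_eq[symmetric])
    then show ?thesis by (simp add: abs_circle_eq_iff algebra_simps)
  qed
  have \<theta>_inj: "g = 0" if "\<theta> g \<in> \<int>" for g
  proof -
    have "abs_circle (\<theta> g) = abs_circle 0" using that by (simp add: abs_circle_eq_iff)
    then show ?thesis using a_inj by (simp add: abs\<theta> zero_circle.abs_eq[symmetric] zero_circle_def[symmetric])
  qed

  obtain H H' where H: "degree_one H" "\<And>x. (H has_real_derivative H' x) (at x)"
    "continuous_on UNIV H'" "\<And>x. H' x > 0" "circle_map H = h"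
    by (rule Diff1_lift[OF h]) blast
  obtain Q where HQ: "\<And>x. H (Q x) = x" and QH: "\<And>x. Q (H x) = x"
    by (rule degree_one_inverse[OF H(1,2,4)]) blast
  define k where "k x = inverse (H' (Q x))" for x
  have Q_deriv: "(Q has_real_derivative k x) (at x)" for x
    unfolding k_def by (rule inverse_deriv[OF H(2,4) HQ QH])
  have k_cont: "continuous_on UNIV k"
  proof -
    have "continuous_on UNIV (\<lambda>x. H' (Q x))"
      by (rule continuous_on_compose2[OF H(3) deriv_continuous_on[OF Q_deriv]]) simp
    then show ?thesis unfolding k_def[abs_def]
      using H(4) by (intro continuous_on_inverse) (auto simp: less_imp_neq[THEN not_sym])
  qed
  have lc: "line_conj Q H k"
    by unfold_locales
      (use degree_one_inverse_degree[OF H(1) HQ QH] Q_deriv k_cont H(4) HQ QH in \<open>simp_all add: k_def\<close>)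
  interpret line_conj Q H k by (rule lc)
  have \<rho>Phi: "circle_map (Phi (\<theta> g)) = \<rho> g" for g
  proof (rule circle_eqI)
    fix x
    have hH: "h (abs_circle y) = abs_circle (H y)" for y
      unfolding H(5)[symmetric] by (rule circle_map_abs[OF H(1)])
    have "h (\<rho> g (abs_circle x)) = abs_circle (H x + \<theta> g)"
      by (simp add: \<rho>a hinv hH abs\<theta> plus_circle.abs_eq[symmetric])
    also have "\<dots> = h (abs_circle (Phi (\<theta> g) x))" by (simp add: hH conj_shift_def HQ)
    finally have "\<rho> g (abs_circle x) = abs_circle (Phi (\<theta> g) x)"
      using bij by (simp add: bij_is_inj inj_eq)
    then show "circle_map (Phi (\<theta> g)) (abs_circle x) = \<rho> g (abs_circle x)"
      by (simp add: circle_map_abs[OF Phi_deg])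
  qed
  have \<rho>deriv: "circle_deriv (\<rho> g) (abs_circle x) = Phi' (\<theta> g) x" for g x
    unfolding \<rho>Phi[symmetric]
    by (rule circle_deriv_lift[OF lift_of_circle_map[OF deriv_continuous_on[OF Phi_deriv] Phi_deg] Phi_deriv])

  \<comment> \<open>Starting the sequence at \<open>j0\<close> makes every total mass less than 1,
    so the construction applies for all indices.\<close>
  obtain j0 where j0: "\<And>j. j \<ge> j0 \<Longrightarrow> infsum (weight \<alpha> j :: int ^ 'd \<Rightarrow> real) UNIV < 1"
    using weight_mass_small[OF \<alpha> assms(3), of 1] by auto
  define c :: "nat \<Rightarrow> int ^ 'd \<Rightarrow> real" where "c j = weight \<alpha> (j0 + j)" for j
  have cb: "conj_blowup \<theta> (c j) Q H k" for j
  proof (intro conj_blowup.intro lc blowup.intro)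
    show "infsum (c j) UNIV < 1" using j0[of "j0 + j"] by (simp add: c_def)
    show "c j summable_on UNIV" unfolding c_def by (rule weight_summable[OF \<alpha> assms(3)])
    show "c j g > 0" for g unfolding c_def by (rule weight_pos[OF \<alpha>])
    show "\<exists>g. \<exists>n\<in>\<int>. u < \<theta> g + n \<and> \<theta> g + n < v" if "u < v" for u v
      by (rule multiples_dense[OF \<theta>_add \<theta>_inj that])
  qed (use \<theta>_range \<theta>_add \<theta>_inj in auto)
  define \<rho>s where "\<rho>s j = conj_blowup.new_action \<theta> (c j) Q k" for j
  \<comment> \<open>\<open>B\<close> depends on g but neither on the gap nor on j. The last bound
    makes the convergence uniform on the circle; uniformity in g is not part of the
    topology.\<close>
  have ratio: "\<exists>B\<ge>1. \<forall>j h. (c j h / c j (h + g))\<^sup>2 \<ge> 1 / B \<and>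
      \<bar>(c j h / c j (h + g))\<^sup>2 - 1\<bar> \<le> B * \<alpha> (c j h) \<and> B * \<alpha> (c j h) \<le> B / real (Suc j)" for g
  proof -
    obtain B where B: "B \<ge> 1"
      "\<And>k h. (weight \<alpha> k h / weight \<alpha> k (h + g))\<^sup>2 \<ge> 1 / B"
      "\<And>k h. \<bar>(weight \<alpha> k h / weight \<alpha> k (h + g))\<^sup>2 - 1\<bar> \<le> B / (2 + real k + l1 h)"
      by (rule weight_ratio[OF \<alpha> assms(2,4), of g]) blast
    have 1: "B * \<alpha> (c j h) = B / (2 + real (j0 + j) + l1 h)" for j h
      by (simp add: c_def modulus_weight[OF \<alpha>])
    have 2: "B / (2 + real (j0 + j) + l1 h) \<le> B / real (Suc j)" for j and h :: "int ^ 'd"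
      using B(1) l1_nonneg[of h] by (intro divide_left_mono mult_pos_pos) auto
    have "(c j h / c j (h + g))\<^sup>2 \<ge> 1 / B \<and>
      \<bar>(c j h / c j (h + g))\<^sup>2 - 1\<bar> \<le> B * \<alpha> (c j h) \<and> B * \<alpha> (c j h) \<le> B / real (Suc j)" for j h
      unfolding 1 unfolding c_def by (intro conjI B(2,3) 2)
    then show ?thesis using B(1) by blast
  qed
  have regular: "\<rho>s j g \<in> Diff1_modulus \<alpha>"
    "circle_deriv (\<rho>s j g) (abs_circle x) = conj_blowup.N' \<theta> (c j) Q H k (\<theta> g) x" for j g x
  proof -
    obtain B where B: "B \<ge> 1" "\<And>j h. (c j h / c j (h + g))\<^sup>2 \<ge> 1 / B \<and>
      \<bar>(c j h / c j (h + g))\<^sup>2 - 1\<bar> \<le> B * \<alpha> (c j h)" using ratio[of g] by blast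
    note conj_blowup.new_action_regular[OF cb \<alpha> B(1) B(2) \<rho>D(2) \<rho>deriv]
    then show "\<rho>s j g \<in> Diff1_modulus \<alpha>"
      "circle_deriv (\<rho>s j g) (abs_circle x) = conj_blowup.N' \<theta> (c j) Q H k (\<theta> g) x"
      unfolding \<rho>s_def by blast+
  qed
  have rep: "representation_into (Diff1_modulus \<alpha>) (\<rho>s j)" for j
    unfolding representation_into_def
    using regular(1) conj_blowup.new_action_add[OF cb] by (simp add: \<rho>s_def)
  have exc: "exceptional (\<rho>s j)" for j
    unfolding \<rho>s_def by (rule conj_blowup.exceptional_new_action[OF cb])

  have close: "\<forall>\<^sub>F j in sequentially. \<forall>p. dist (\<rho>s j g p) (\<rho> g p) < e \<and>
      dist (circle_deriv (\<rho>s j g) p) (circle_deriv (\<rho> g) p) < e" if e: "e > 0" for g e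
  proof -
    obtain B where B: "B \<ge> 1" "\<And>j h. (c j h / c j (h + g))\<^sup>2 \<ge> 1 / B \<and>
      \<bar>(c j h / c j (h + g))\<^sup>2 - 1\<bar> \<le> B * \<alpha> (c j h) \<and> B * \<alpha> (c j h) \<le> B / real (Suc j)"
      using ratio[of g] by blast
    obtain L where L: "L > 0" "\<And>x y. \<bar>Phi (\<theta> g) x - Phi (\<theta> g) y\<bar> \<le> L * \<bar>x - y\<bar>"
      by (rule Phi_lipschitz) blast
    obtain M where M: "M > 0" "\<And>x. Phi' (\<theta> g) x \<le> M" by (rule Phi'_bounded) blast
    obtain d where d: "d > 0" "\<And>x y. \<bar>x - y\<bar> < d \<Longrightarrow> \<bar>Phi' (\<theta> g) x - Phi' (\<theta> g) y\<bar> < e / 2"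
      by (rule Phi'_unif[of "e / 2" "\<theta> g"]) (use e in auto)
    \<comment> \<open>The first entry makes \<open>\<eta> * (1 + L)\<close>, the bound for the
      distance of the maps, smaller than e; the second fits the uniform continuity of the old
      derivative.\<close>
    define \<eta> where "\<eta> = min (e / (2 * (1 + L))) (d / 2)"
    have \<eta>: "\<eta> > 0" "\<eta> < d" "\<eta> * (1 + L) < e"
    proof -
      show "\<eta> > 0" "\<eta> < d" using e d(1) L(1) by (auto simp: \<eta>_def)
      have "\<eta> * (1 + L) \<le> e / (2 * (1 + L)) * (1 + L)" using L(1) by (intro mult_right_mono) (auto simp: \<eta>_def)
      also have "\<dots> = e / 2" using L(1) by (simp add: field_simps)
      finally show "\<eta> * (1 + L) < e" using e by simp
    qed
    obtain dk where dk: "dk > 0" "\<And>x y. \<bar>x - y\<bar> < dk \<Longrightarrow> \<bar>k x - k y\<bar> < \<eta> / 4"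
      by (rule periodic_uniformly_continuous[OF k_cont k_periodic, of "\<eta> / 4"]) (use \<eta> in auto)
    obtain MQ where MQ: "MQ > 0" "\<And>x y. \<bar>Q x - Q y\<bar> \<le> MQ * \<bar>x - y\<bar>" by (rule Q_lipschitz) blast
    \<comment> \<open>Calibrated to the bound on the displacement of \<open>q\<close>: if the mass
      is below s, then \<open>k\<close> varies by at most \<eta>/4 over 2 mass, and 2 (\<eta>/4) + 2
      MQ mass \<le> \<eta>.\<close>
    define s where "s = min (dk / 2) (\<eta> / (4 * MQ))"
    have "s > 0" using dk(1) \<eta>(1) MQ(1) by (simp add: s_def)
    then obtain j1 where j1: "\<And>j. j \<ge> j1 \<Longrightarrow> infsum (weight \<alpha> j :: int ^ 'd \<Rightarrow> real) UNIV < s"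
      using weight_mass_small[OF \<alpha> assms(3)] by blast
    \<comment> \<open>From \<open>j2\<close> on, the contribution M B (B / (j + 1)) of the blown-up
      translation to the derivative error is at most e/2.\<close>
    obtain j2 :: nat where j2: "2 * M * B * B / e < real j2" using reals_Archimedean2 by blast
    have "dist (\<rho>s j g p) (\<rho> g p) < e \<and> dist (circle_deriv (\<rho>s j g) p) (circle_deriv (\<rho> g) p) < e"
      if j: "j \<ge> max j1 j2" for j p
    proof -
      define x where "x = rep_circle p"
      have p: "p = abs_circle x" by (simp add: x_def)
      interpret C: conj_blowup \<theta> "c j" Q H k by (rule cb)
      have mass: "C.mass < s" unfolding C.mass_def using j1[of "j0 + j"] j by (simp add: c_def)
      have near: "\<bar>C.q z - z\<bar> \<le> \<eta>" for z
      proof -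
        have "\<bar>C.q z - z\<bar> \<le> 2 * (\<eta> / 4) + 2 * MQ * C.mass"
        proof (rule C.q_near[OF _ MQ(2,1)])
          show "\<bar>k x - k y\<bar> \<le> \<eta> / 4" if "\<bar>x - y\<bar> \<le> 2 * C.mass" for x y
            using dk(2)[of x y] that mass by (simp add: s_def)
        qed
        also have "2 * MQ * C.mass \<le> 2 * MQ * (\<eta> / (4 * MQ))"
          using mass MQ(1) by (intro mult_left_mono) (auto simp: s_def)
        also have "2 * MQ * (\<eta> / (4 * MQ)) = \<eta> / 2" using MQ(1) by simp
        finally show ?thesis by simp
      qed
      have rat: "(c j h / c j (h + g))\<^sup>2 \<ge> 1 / B \<and> \<bar>(c j h / c j (h + g))\<^sup>2 - 1\<bar> \<le> B / real (Suc j)" for h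
        using B(2)[of j h] by linarith
      have B0: "B / real (Suc j) \<ge> 0" using B(1) by simp
      note cl = C.new_action_close[OF B(1) B0 rat near, of x]
      have "\<rho>s j g p = abs_circle (C.N (\<theta> g) x)"
        unfolding \<rho>s_def C.new_action_def p by (rule circle_map_abs[OF C.N_deg[OF C.transl_theta]])
      moreover have "\<rho> g p = abs_circle (Phi (\<theta> g) x)"
        unfolding \<rho>Phi[symmetric] p by (rule circle_map_abs[OF Phi_deg])
      ultimately have "dist (\<rho>s j g p) (\<rho> g p) \<le> \<bar>C.N (\<theta> g) x - Phi (\<theta> g) x\<bar>"
        using dist_abs_circle_le by simp
      also have "\<dots> \<le> \<eta> + L * \<bar>C.q x - x\<bar>" using cl(1) L(2)[of "C.q x" x] by linarith
      also have "\<dots> \<le> \<eta> + L * \<eta>" using near[of x] L(1) by simp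
      also have "\<dots> < e" using \<eta>(3) by (simp add: algebra_simps)
      finally have 1: "dist (\<rho>s j g p) (\<rho> g p) < e" .
      have "dist (circle_deriv (\<rho>s j g) p) (circle_deriv (\<rho> g) p) = \<bar>C.N' (\<theta> g) x - Phi' (\<theta> g) x\<bar>"
        by (simp add: p regular(2) \<rho>deriv dist_real_def)
      also have "\<dots> \<le> Phi' (\<theta> g) (C.q x) * (B * (B / real (Suc j))) + \<bar>Phi' (\<theta> g) (C.q x) - Phi' (\<theta> g) x\<bar>"
        by (rule cl(2))
      also have "\<dots> < e / 2 + e / 2"
      proof (rule add_le_less_mono)
        have "2 * M * B * B / e < real (Suc j)" using j2 j by simp
        then have "2 * M * B * B < e * real (Suc j)" using e by (simp add: field_simps)
        then have "M * (B * (B / real (Suc j))) \<le> e / 2" by (simp add: field_simps)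
        moreover have "Phi' (\<theta> g) (C.q x) * (B * (B / real (Suc j))) \<le> M * (B * (B / real (Suc j)))"
          using M(2) B(1) by (intro mult_right_mono) auto
        ultimately show "Phi' (\<theta> g) (C.q x) * (B * (B / real (Suc j))) \<le> e / 2" by linarith
        show "\<bar>Phi' (\<theta> g) (C.q x) - Phi' (\<theta> g) x\<bar> < e / 2"
          using near[of x] \<eta>(2) by (intro d(2)) linarith
      qed
      finally show ?thesis using 1 by simp
    qed
    then show ?thesis unfolding eventually_sequentially by blast
  qed
  have "C1_converges \<rho>s \<rho>"
    unfolding C1_converges_def uniform_limit_iff
  proof (intro allI impI conjI)
    fix g and e :: real assume e: "e > 0"
    show "\<forall>\<^sub>F j in sequentially. \<forall>p\<in>UNIV. dist (\<rho>s j g p) (\<rho> g p) < e"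
      using close[OF e, of g] by eventually_elim simp
    show "\<forall>\<^sub>F j in sequentially. \<forall>p\<in>UNIV. dist (circle_deriv (\<rho>s j g) p) (circle_deriv (\<rho> g) p) < e"
      using close[OF e, of g] by eventually_elim simp
  qed
  with rep exc show ?thesis by blast
qed

end
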